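(* Let $A=kQ/I$ be a gentle algebra with marked ribbon surface $(\mathcal S_A,\mathcal M_A,\Gamma_A)$. (String case) Let $M=M(c)$ be a string module corresponding to a non-trivial permissible curve $c$ consecutively crossing arcs $\gamma_1,\dots,\gamma_{r-1}$. Let $\mathfrak I$ be the set of all $i$ with $1\le i\le r-1$ such that one of the following holds: ($2\le i\le r-2$) $p(\gamma_{i-1},\gamma_i,c)$ is on the left of $c$ and $p(\gamma_i,\gamma_{i+1},c)$ is on the right of $c$; ($i=1$, $r\ge3$) $p(\gamma_1,\gamma_2,c)$ is on the right of $c$; ($i=r-1$, $r\ge3$) $p(\gamma_{r-2},\gamma_{r-1},c)$ is on the left of $c$; with $\mathfrak I=\{1\}$ if $r=2$. Then the injective envelope of $M$ is $$E(M)\cong\bigoplus_{i\in\mathfrak I}M(c_{\mathrm{inj}}^{\gamma_i}).$$ (Band case) Let $M=M(c,\varphi)$ be a band module corresponding to a permissible closed curve $c$ consecutively (cyclically) crossing arcs $\gamma_1,\dots,\gamma_r=\gamma_0$ and a Jordan block $\varphi$ over a $k$-linear space $V$. Let $\mathfrak I$ be the set of all $i$ with $1\le i\le r$ such that $p(\gamma_{i-1},\gamma_i,c)$ is on the left of $c$ and $p(\gamma_i,\gamma_{i+1},c)$ is on the right of $c$ (indices modulo $r$). Then $$E(M)\cong\bigoplus_{i\in\mathfrak I}M(c_{\mathrm{inj}}^{\gamma_i})^{\oplus\dim_kV}.$$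
   Context: $k$ is an algebraically closed field. $Q$ is a finite quiver; $\alpha\beta$ denotes the path "first $\alpha$, then $\beta$". $A=kQ/I$ is gentle if: $I$ is an admissible ideal generated by paths of length $2$; every vertex is the source of at most two and the target of at most two arrows; for each arrow $\beta$ there is at most one arrow $\alpha$ with $t(\alpha)=s(\beta)$, $\alpha\beta\notin I$, at most one with $t(\alpha)=s(\beta)$, $\alpha\beta\in I$, at most one with $s(\alpha)=t(\beta)$, $\beta\alpha\notin I$, and at most one with $s(\alpha)=t(\beta)$, $\beta\alpha\in I$. Modules are finitely generated right $A$-modules. Marked ribbon surface: a triple $(\mathcal S,\mathcal M,\Gamma)$ where $\mathcal S$ is an oriented connected surface with non-empty boundary, $\mathcal M$ is a finite set of marked points on $\partial\mathcal S$, and $\Gamma$ is a set of curves (arcs) with endpoints in $\mathcal M$, pairwise not intersecting in the interior of $\mathcal S$, dividing $\mathcal S$ into elementary polygons, each having exactly one side not in $\Gamma$ (this side is a boundary segment between marked points or a whole boundary component without marked points). If an elementary polygon has exactly two sides, one in $\Gamma$ and the other a boundary segment between two marked points, one extra point is added on that boundary segment; $E$ is the set of extra points. The algebra of $(\mathcal S,\mathcal M,\Gamma)$ is $kQ_{\mathcal S}/I_{\mathcal S}$: vertices are the arcs; for every elementary polygon with sides $u,v\in\Gamma$ such that $v$ follows $u$ counterclockwise around a common vertex of the polygon there is an arrow $u\to v$; $I_{\mathcal S}$ is generated by all compositions of two arrows $u\to v\to w$ arising from the same elementary polygon. $(\mathcal S_A,\mathcal M_A,\Gamma_A)$ is the marked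 ribbon surface (unique up to homotopy) whose algebra is $A$; vertices of $Q$ are identified with arcs. Permissible curves: curves $c:(0,1)\to\mathcal S\setminus\partial\mathcal S$ with endpoints $c(0^+),c(1^-)\in\mathcal M\cup E$, with minimal number of crossings with $\Gamma$ up to homotopy, such that (a) the winding number of the end segments around any unmarked boundary component is $0$ or $1$ and (b) whenever $c$ consecutively crosses $u,v\in\Gamma$ (crosses $u$ and then $v$ with no crossing in between), $u,v$ have a common endpoint $p(u,v,c)\in\mathcal M$ such that the segment of $c$ between $u$ and $v$ together with $u,v$ locally bounds a triangle with vertex $p(u,v,c)$. A permissible closed curve is a closed curve in the interior of $\mathcal S$ satisfying (b). A permissible curve is non-trivial if it crosses at least one arc. "Left/right of $c$" refers to the orientation of $c$. Modules: for $c$ consecutively crossing $\gamma_1,\dots,\gamma_{r-1}$, consider the walk on the vertices $\gamma_1,\dots,\gamma_{r-1}$ in which $\gamma_{j-1},\gamma_j$ are joined by the arrow $\gamma_{j-1}\to\gamma_j$ if $p(\gamma_{j-1},\gamma_j,c)$ is on the left of $c$ (counterclockwise crossing), and by the inverse of the arrow $\gamma_j\to\gamma_{j-1}$ if it is on the right. $M(c)$ is the corresponding string module (one basis vector per position; arrows of the walk act as identity along it). For a permissible closed curve $c$ crossing $\Gamma_A$ at least twice, the same rule gives a band, and with an indecomposable automorphism (Jordan block) $\varphi$ of $V$, $M(c,\varphi)$ is the corresponding band module ($V$ at each position, all arrows of the walk acting by identity except one acting by $\varphi$). Injective permissible curve $c_{\mathrm{inj}}^{\gamma}$ of an arc $\gamma$: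 a permissible curve consecutively crossing arcs $\delta_1,\dots,\delta_{s-1}$ for which there is a unique $i$ with $\gamma=\delta_i$ such that, denoting by $m$ (respectively $m'$) the endpoint of $\delta_i$ on the left (respectively right) of the curve, $m=p(\delta_1,\delta_2,c)=\cdots=p(\delta_{i-1},\delta_i,c)$ and $m'=p(\delta_i,\delta_{i+1},c)=\cdots=p(\delta_{s-2},\delta_{s-1},c)$, and there is no arc $\delta$ such that $\delta,\delta_1,\dots,\delta_i$ have common endpoint $m$ and surround $m$ in counterclockwise order, and no arc $\delta'$ such that $\delta_i,\dots,\delta_{s-1},\delta'$ have common endpoint $m'$ and surround $m'$ in clockwise order. *)

theory Defs
  imports
    "HOL-Complex_Analysis.Complex_Analysis"
    "HOL-Computational_Algebra.Polynomial"
    "HOL-Algebra.QuotRing"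
    "HOL-Algebra.Module"
begin

section \<open>Quivers, path algebras and gentle algebras\<close>

record ('v, 'e) quiver =
  verts :: "'v set"
  arrs :: "'e set"
  src :: "'e \<Rightarrow> 'v"
  tgt :: "'e \<Rightarrow> 'v"

definition finite_quiver :: "('v, 'e) quiver \<Rightarrow> bool" where
  "finite_quiver Q \<longleftrightarrow> finite (verts Q) \<and> finite (arrs Q) \<and>
     src Q ` arrs Q \<subseteq> verts Q \<and> tgt Q ` arrs Q \<subseteq> verts Q"

text \<open>A path is its source together with its list of arrows, first arrow first;
  \<open>(v, [])\<close> is the stationary path at \<open>v\<close>.\<close>

type_synonym ('v, 'e) qpath = "'v \<times> 'e list"

fun walks_from :: "('v, 'e) quiver \<Rightarrow> 'v \<Rightarrow> 'e list \<Rightarrow> bool" where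
  "walks_from Q v [] \<longleftrightarrow> v \<in> verts Q"
| "walks_from Q v (e # es) \<longleftrightarrow> e \<in> arrs Q \<and> src Q e = v \<and> walks_from Q (tgt Q e) es"

definition qpaths :: "('v, 'e) quiver \<Rightarrow> ('v, 'e) qpath set" where
  "qpaths Q = {(v, es). walks_from Q v es}"

fun path_target :: "('v, 'e) quiver \<Rightarrow> ('v, 'e) qpath \<Rightarrow> 'v" where
  "path_target Q (v, es) = (if es = [] then v else tgt Q (last es))"

definition path_algebra :: "('v, 'e) quiver \<Rightarrow> (('v, 'e) qpath \<Rightarrow> 'k::field) ring" where
  "path_algebra Q =
    \<lparr>carrier = {a. finite {p. a p \<noteq> 0} \<and> {p. a p \<noteq> 0} \<subseteq> qpaths Q},
     mult = (\<lambda>a b (v, es). \<Sum>i\<le>length es.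
               a (v, take i es) * b (path_target Q (v, take i es), drop i es)),
     one = (\<lambda>(v, es). if v \<in> verts Q \<and> es = [] then 1 else 0),
     zero = (\<lambda>_. 0),
     add = (\<lambda>a b p. a p + b p)\<rparr>"

definition path_elem :: "('v, 'e) qpath \<Rightarrow> ('v, 'e) qpath \<Rightarrow> 'k::field" where
  "path_elem p = (\<lambda>q. if q = p then 1 else 0)"

text \<open>The \<open>m\<close>-th power of the arrow ideal has the paths of length at least \<open>m\<close> as a basis.\<close>

definition arrow_ideal_power :: "('v, 'e) quiver \<Rightarrow> nat \<Rightarrow> (('v, 'e) qpath \<Rightarrow> 'k::field) set" where
  "arrow_ideal_power Q m =
     {a \<in> carrier (path_algebra Q). \<forall>v es. a (v, es) \<noteq> 0 \<longrightarrow> m \<le> length es}"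

definition admissible_ideal :: "('v, 'e) quiver \<Rightarrow> (('v, 'e) qpath \<Rightarrow> 'k::field) set \<Rightarrow> bool" where
  "admissible_ideal Q I \<longleftrightarrow> ideal I (path_algebra Q) \<and>
     I \<subseteq> arrow_ideal_power Q 2 \<and> (\<exists>m\<ge>2. arrow_ideal_power Q m \<subseteq> I)"

abbreviation comp2 :: "('v, 'e) quiver \<Rightarrow> 'e \<Rightarrow> 'e \<Rightarrow> ('v, 'e) qpath \<Rightarrow> 'k::field" where
  "comp2 Q \<alpha> \<beta> \<equiv> path_elem (src Q \<alpha>, [\<alpha>, \<beta>])"

definition gentle :: "('v, 'e) quiver \<Rightarrow> (('v, 'e) qpath \<Rightarrow> 'k::field) set \<Rightarrow> bool" where
  "gentle Q I \<longleftrightarrow>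
     finite_quiver Q \<and> admissible_ideal Q I \<and>
     (\<exists>R \<subseteq> {p \<in> qpaths Q. length (snd p) = 2}. I = genideal (path_algebra Q) (path_elem ` R)) \<and>
     (\<forall>v \<in> verts Q. card {\<alpha> \<in> arrs Q. src Q \<alpha> = v} \<le> 2 \<and> card {\<alpha> \<in> arrs Q. tgt Q \<alpha> = v} \<le> 2) \<and>
     (\<forall>\<beta> \<in> arrs Q.
        card {\<alpha> \<in> arrs Q. tgt Q \<alpha> = src Q \<beta> \<and> comp2 Q \<alpha> \<beta> \<notin> I} \<le> 1 \<and>
        card {\<alpha> \<in> arrs Q. tgt Q \<alpha> = src Q \<beta> \<and> comp2 Q \<alpha> \<beta> \<in> I} \<le> 1 \<and>
        card {\<alpha> \<in> arrs Q. src Q \<alpha> = tgt Q \<beta> \<and> comp2 Q \<beta> \<alpha> \<notin> I} \<le> 1 \<and>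
        card {\<alpha> \<in> arrs Q. src Q \<alpha> = tgt Q \<beta> \<and> comp2 Q \<beta> \<alpha> \<in> I} \<le> 1)"

section \<open>Right modules and injective envelopes\<close>

text \<open>The scalar multiplication of the record \<open>module\<close> is used for the right action:
  \<open>a \<odot> x\<close> is what is usually written \<open>x a\<close>, hence the order of the factors in the
  associativity law. The fields \<open>mult\<close> and \<open>one\<close> of a module are irrelevant.\<close>

definition right_module :: "('r, 'z) ring_scheme \<Rightarrow> ('r, 'm) module \<Rightarrow> bool" where
  "right_module R M \<longleftrightarrow> ring R \<and> abelian_group M \<and>
     (\<forall>a \<in> carrier R. \<forall>x \<in> carrier M. a \<odot>\<^bsub>M\<^esub> x \<in> carrier M) \<and>
     (\<forall>a \<in> carrier R. \<forall>b \<in> carrier R. \<forall>x \<in> carrier M.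
        (a \<oplus>\<^bsub>R\<^esub> b) \<odot>\<^bsub>M\<^esub> x = a \<odot>\<^bsub>M\<^esub> x \<oplus>\<^bsub>M\<^esub> b \<odot>\<^bsub>M\<^esub> x) \<and>
     (\<forall>a \<in> carrier R. \<forall>x \<in> carrier M. \<forall>y \<in> carrier M.
        a \<odot>\<^bsub>M\<^esub> (x \<oplus>\<^bsub>M\<^esub> y) = a \<odot>\<^bsub>M\<^esub> x \<oplus>\<^bsub>M\<^esub> a \<odot>\<^bsub>M\<^esub> y) \<and>
     (\<forall>a \<in> carrier R. \<forall>b \<in> carrier R. \<forall>x \<in> carrier M.
        (a \<otimes>\<^bsub>R\<^esub> b) \<odot>\<^bsub>M\<^esub> x = b \<odot>\<^bsub>M\<^esub> (a \<odot>\<^bsub>M\<^esub> x)) \<and>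
     (\<forall>x \<in> carrier M. \<one>\<^bsub>R\<^esub> \<odot>\<^bsub>M\<^esub> x = x)"

definition right_submodule :: "('r, 'z) ring_scheme \<Rightarrow> 'm set \<Rightarrow> ('r, 'm) module \<Rightarrow> bool" where
  "right_submodule R N M \<longleftrightarrow> N \<subseteq> carrier M \<and> \<zero>\<^bsub>M\<^esub> \<in> N \<and>
     (\<forall>x \<in> N. \<forall>y \<in> N. x \<oplus>\<^bsub>M\<^esub> y \<in> N) \<and> (\<forall>a \<in> carrier R. \<forall>x \<in> N. a \<odot>\<^bsub>M\<^esub> x \<in> N)"

definition fg_module :: "('r, 'z) ring_scheme \<Rightarrow> ('r, 'm) module \<Rightarrow> bool" where
  "fg_module R M \<longleftrightarrow> right_module R M \<and>
     (\<exists>X. finite X \<and> X \<subseteq> carrier M \<and>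
        (\<forall>N. right_submodule R N M \<and> X \<subseteq> N \<longrightarrow> N = carrier M))"

definition module_maps ::
    "('r, 'z) ring_scheme \<Rightarrow> ('r, 'm) module \<Rightarrow> ('r, 'n) module \<Rightarrow> ('m \<Rightarrow> 'n) set" where
  "module_maps R M N = {f \<in> carrier M \<rightarrow> carrier N.
     (\<forall>x \<in> carrier M. \<forall>y \<in> carrier M. f (x \<oplus>\<^bsub>M\<^esub> y) = f x \<oplus>\<^bsub>N\<^esub> f y) \<and>
     (\<forall>a \<in> carrier R. \<forall>x \<in> carrier M. f (a \<odot>\<^bsub>M\<^esub> x) = a \<odot>\<^bsub>N\<^esub> f x)}"

definition module_iso :: "('r, 'z) ring_scheme \<Rightarrow> ('r, 'm) module \<Rightarrow> ('r, 'n) module \<Rightarrow> bool" where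
  "module_iso R M N \<longleftrightarrow> (\<exists>f \<in> module_maps R M N. bij_betw f (carrier M) (carrier N))"

text \<open>Injective objects of the category of finitely generated right modules. The test
  monomorphisms \<open>X \<rightarrow> Y\<close> have carriers in the types \<open>'x\<close> and \<open>'y\<close>, which stay arbitrary.\<close>

definition injective_module ::
    "'x itself \<Rightarrow> 'y itself \<Rightarrow> ('r, 'z) ring_scheme \<Rightarrow> ('r, 'm) module \<Rightarrow> bool" where
  "injective_module _ _ R E \<longleftrightarrow> fg_module R E \<and>
     (\<forall>(X :: ('r, 'x) module) (Y :: ('r, 'y) module).
        \<forall>f \<in> module_maps R X Y. \<forall>g \<in> module_maps R X E.
          fg_module R X \<and> fg_module R Y \<and> inj_on f (carrier X) \<longrightarrow>
          (\<exists>h \<in> module_maps R Y E. \<forall>x \<in> carrier X. h (f x) = g x))"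

definition injective_envelope ::
    "'x itself \<Rightarrow> 'y itself \<Rightarrow> ('r, 'z) ring_scheme \<Rightarrow> ('r, 'm) module \<Rightarrow> ('r, 'n) module \<Rightarrow>
     ('m \<Rightarrow> 'n) \<Rightarrow> bool" where
  "injective_envelope tx ty R M E \<iota> \<longleftrightarrow>
     fg_module R M \<and> injective_module tx ty R E \<and>
     \<iota> \<in> module_maps R M E \<and> inj_on \<iota> (carrier M) \<and>
     (\<forall>N. right_submodule R N E \<and> N \<inter> \<iota> ` carrier M = {\<zero>\<^bsub>E\<^esub>} \<longrightarrow> N = {\<zero>\<^bsub>E\<^esub>})"

definition direct_sum :: "'i set \<Rightarrow> ('i \<Rightarrow> ('r, 'm) module) \<Rightarrow> ('r, 'i \<Rightarrow> 'm) module" where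
  "direct_sum J N =
    \<lparr>carrier = (\<Pi>\<^sub>E i\<in>J. carrier (N i)),
     mult = undefined, one = undefined,
     zero = (\<lambda>i\<in>J. \<zero>\<^bsub>N i\<^esub>),
     add = (\<lambda>x y. \<lambda>i\<in>J. x i \<oplus>\<^bsub>N i\<^esub> y i),
     smult = (\<lambda>a x. \<lambda>i\<in>J. a \<odot>\<^bsub>N i\<^esub> x i)\<rparr>"

section \<open>Walks and their modules\<close>

text \<open>A letter \<open>j\<close> of a walk is an arrow joining the position \<open>letter_source j\<close> to the position
  \<open>letter_target j\<close> and acting by the linear map \<open>letter_map j\<close>.\<close>

record ('v, 'e, 'w) walk =
  positions :: "nat set"
  vertex_at :: "nat \<Rightarrow> 'v"
  letters :: "nat set"
  letter_source :: "nat \<Rightarrow> nat"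
  letter_target :: "nat \<Rightarrow> nat"
  letter_arrow :: "nat \<Rightarrow> 'e"
  letter_map :: "nat \<Rightarrow> 'w \<Rightarrow> 'w"

definition vertex_act :: "('v, 'e, 'w::ab_group_add) walk \<Rightarrow> 'v \<Rightarrow> (nat \<Rightarrow> 'w) \<Rightarrow> nat \<Rightarrow> 'w" where
  "vertex_act W v f = (\<lambda>i. if vertex_at W i = v then f i else 0)"

definition arrow_act :: "('v, 'e, 'w::ab_group_add) walk \<Rightarrow> 'e \<Rightarrow> (nat \<Rightarrow> 'w) \<Rightarrow> nat \<Rightarrow> 'w" where
  "arrow_act W \<alpha> f = (\<lambda>i. \<Sum>j | j \<in> letters W \<and> letter_arrow W j = \<alpha> \<and> letter_target W j = i.
     letter_map W j (f (letter_source W j)))"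

fun path_act :: "('v, 'e, 'w::ab_group_add) walk \<Rightarrow> ('v, 'e) qpath \<Rightarrow> (nat \<Rightarrow> 'w) \<Rightarrow> nat \<Rightarrow> 'w" where
  "path_act W (v, es) f = foldl (\<lambda>g \<alpha>. arrow_act W \<alpha> g) (vertex_act W v f) es"

definition algebra_act ::
    "('k \<Rightarrow> 'w \<Rightarrow> 'w) \<Rightarrow> ('v, 'e, 'w::ab_group_add) walk \<Rightarrow> (('v, 'e) qpath \<Rightarrow> 'k::field) \<Rightarrow>
     (nat \<Rightarrow> 'w) \<Rightarrow> nat \<Rightarrow> 'w" where
  "algebra_act scl W a f = (\<lambda>i. \<Sum>p | a p \<noteq> 0. scl (a p) (path_act W p f i))"

text \<open>One copy of the space \<open>'w\<close> at every position. A residue class of \<open>kQ/I\<close> acts through any of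
  its representatives.\<close>

definition walk_module ::
    "('k \<Rightarrow> 'w \<Rightarrow> 'w) \<Rightarrow> ('v, 'e, 'w::ab_group_add) walk \<Rightarrow>
     ((('v, 'e) qpath \<Rightarrow> 'k::field) set, nat \<Rightarrow> 'w) module" where
  "walk_module scl W =
    \<lparr>carrier = {f. \<forall>i. i \<notin> positions W \<longrightarrow> f i = 0},
     mult = undefined, one = undefined,
     zero = (\<lambda>_. 0),
     add = (\<lambda>f g i. f i + g i),
     smult = (\<lambda>C f. algebra_act scl W (SOME a. a \<in> C) f)\<rparr>"

definition indecomposable_automorphism ::
    "('k::field \<Rightarrow> 'w \<Rightarrow> 'w::ab_group_add) \<Rightarrow> ('w \<Rightarrow> 'w) \<Rightarrow> bool" where
  "indecomposable_automorphism scl \<phi> \<longleftrightarrow>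
     (\<exists>B. finite_dimensional_vector_space scl B) \<and> (\<exists>x::'w. x \<noteq> 0) \<and>
     Vector_Spaces.linear scl scl \<phi> \<and> bij \<phi> \<and>
     (\<forall>U W. module.subspace scl U \<and> module.subspace scl W \<and> \<phi> ` U \<subseteq> U \<and> \<phi> ` W \<subseteq> W \<and>
        U \<inter> W = {0} \<and> {u + w | u w. u \<in> U \<and> w \<in> W} = UNIV \<longrightarrow> U = {0} \<or> W = {0})"

section \<open>Oriented surfaces\<close>

definition half_plane :: "complex set" where
  "half_plane = {z. 0 \<le> Im z}"

text \<open>Meant for injective continuous maps, for which the winding number below is \<open>1\<close> or \<open>-1\<close>.\<close>

definition orientation_preserving :: "complex set \<Rightarrow> (complex \<Rightarrow> complex) \<Rightarrow> bool" where
  "orientation_preserving U f \<longleftrightarrow>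
     (\<forall>z \<rho>. 0 < \<rho> \<and> cball z \<rho> \<subseteq> U \<longrightarrow> winding_number (f \<circ> circlepath z \<rho>) (f z) = 1)"

definition oriented_surface :: "'p topology \<Rightarrow> ('p set \<times> ('p \<Rightarrow> complex)) set \<Rightarrow> bool" where
  "oriented_surface S \<A> \<longleftrightarrow>
     Hausdorff_space S \<and> second_countable S \<and>
     (\<Union>(U, f) \<in> \<A>. U) = topspace S \<and>
     (\<forall>(U, f) \<in> \<A>. openin S U \<and> openin (top_of_set half_plane) (f ` U) \<and>
        homeomorphic_map (subtopology S U) (top_of_set (f ` U)) f) \<and>
     (\<forall>(U, f) \<in> \<A>. \<forall>(U', f') \<in> \<A>.
        orientation_preserving (f ` (U \<inter> U')) (f' \<circ> inv_into U f))"

definition surface_boundary :: "('p set \<times> ('p \<Rightarrow> complex)) set \<Rightarrow> 'p set" where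
  "surface_boundary \<A> = {p. \<exists>(U, f) \<in> \<A>. p \<in> U \<and> Im (f p) = 0}"

section \<open>Marked ribbon surfaces\<close>

text \<open>
  An elementary polygon is the image of a model polygon under a characteristic map.
  The sides of the model with \<open>n\<close> outer sides are the arcs of the unit circle between consecutive
  \<open>n\<close>-th roots of unity, numbered \<open>0, \<dots>, n - 1\<close> counterclockwise; side \<open>x\<close> leads from vertex \<open>x\<close>
  to vertex \<open>x + 1\<close> (modulo \<open>n\<close>).
  In \<open>Disc n\<close> the last side is the boundary segment and the other \<open>n - 1\<close> sides are in \<open>\<Gamma>\<close>.
  In \<open>Annulus n\<close> all outer sides are in \<open>\<Gamma>\<close>, and the side not in \<open>\<Gamma>\<close> is the inner circle, which
  becomes a boundary component without marked points.\<close>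

datatype shape = Disc nat | Annulus nat

fun num_sides :: "shape \<Rightarrow> nat" where
  "num_sides (Disc n) = n"
| "num_sides (Annulus n) = n"

fun num_arc_sides :: "shape \<Rightarrow> nat" where
  "num_arc_sides (Disc n) = n - 1"
| "num_arc_sides (Annulus n) = n"

fun model :: "shape \<Rightarrow> complex set" where
  "model (Disc n) = cball 0 1"
| "model (Annulus n) = cball 0 1 - ball 0 (1/2)"

fun model_interior :: "shape \<Rightarrow> complex set" where
  "model_interior (Disc n) = ball 0 1"
| "model_interior (Annulus n) = ball 0 1 - cball 0 (1/2)"

definition circ :: "nat \<Rightarrow> real \<Rightarrow> complex" where
  "circ n u = cis (2 * pi * u / real n)"

definition model_side :: "nat \<Rightarrow> nat \<Rightarrow> real \<Rightarrow> complex" where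
  "model_side n x s = circ n (real x + s)"

definition model_minus_arcs :: "shape \<Rightarrow> complex set" where
  "model_minus_arcs h =
     model h - (\<Union>x < num_arc_sides h. model_side (num_sides h) x ` {0..1})"

definition prev_side :: "nat \<Rightarrow> nat \<Rightarrow> nat" where
  "prev_side n x = (x + n - 1) mod n"

text \<open>
  \<open>arcs\<close> indexes the curves in \<open>\<Gamma>\<close>, parametrised by \<open>arc_path\<close>; \<open>side P x = (\<gamma>, d)\<close> says that
  side \<open>x\<close> of the polygon \<open>P\<close> is glued to the arc \<open>\<gamma>\<close>, in the direction of the parametrisation of
  \<open>\<gamma>\<close> iff \<open>d\<close>.\<close>

record ('p, 'v, 'g) ribbon_surface =
  surf :: "'p topology"
  atlas :: "('p set \<times> ('p \<Rightarrow> complex)) set"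
  marked :: "'p set"
  arcs :: "'v set"
  arc_path :: "'v \<Rightarrow> real \<Rightarrow> 'p"
  extra :: "'p set"
  polygons :: "'g set"
  shape :: "'g \<Rightarrow> shape"
  chart :: "'g \<Rightarrow> complex \<Rightarrow> 'p"
  side :: "'g \<Rightarrow> nat \<Rightarrow> 'v \<times> bool"

abbreviation bdry :: "('p, 'v, 'g) ribbon_surface \<Rightarrow> 'p set" where
  "bdry X \<equiv> surface_boundary (atlas X)"

abbreviation surface_interior :: "('p, 'v, 'g) ribbon_surface \<Rightarrow> 'p set" where
  "surface_interior X \<equiv> topspace (surf X) - bdry X"

abbreviation sides :: "('p, 'v, 'g) ribbon_surface \<Rightarrow> 'g \<Rightarrow> nat" where
  "sides X P \<equiv> num_sides (shape X P)"

definition arc_side :: "('p, 'v, 'g) ribbon_surface \<Rightarrow> 'g \<Rightarrow> nat \<Rightarrow> bool" where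
  "arc_side X P x \<longleftrightarrow> P \<in> polygons X \<and> x < num_arc_sides (shape X P)"

definition marked_arcs :: "('p, 'v, 'g) ribbon_surface \<Rightarrow> bool" where
  "marked_arcs X \<longleftrightarrow>
     finite (arcs X) \<and>
     (\<forall>\<gamma> \<in> arcs X. pathin (surf X) (arc_path X \<gamma>) \<and>
        arc_path X \<gamma> 0 \<in> marked X \<and> arc_path X \<gamma> 1 \<in> marked X \<and>
        inj_on (arc_path X \<gamma>) {0<..<1} \<and> arc_path X \<gamma> ` {0<..<1} \<subseteq> surface_interior X) \<and>
     (\<forall>\<gamma> \<in> arcs X. \<forall>\<delta> \<in> arcs X. \<gamma> \<noteq> \<delta> \<longrightarrow>
        arc_path X \<gamma> ` {0<..<1} \<inter> arc_path X \<delta> ` {0<..<1} = {})"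

fun boundary_side :: "('p, 'v, 'g) ribbon_surface \<Rightarrow> 'g \<Rightarrow> shape \<Rightarrow> bool" where
  "boundary_side X P (Disc n) \<longleftrightarrow> 2 \<le> n \<and>
     chart X P ` model_side n (n - 1) ` {0<..<1} \<subseteq> bdry X - marked X"
| "boundary_side X P (Annulus n) \<longleftrightarrow> 1 \<le> n \<and>
     chart X P ` sphere 0 (1/2) \<in> connected_components_of (subtopology (surf X) (bdry X)) \<and>
     chart X P ` sphere 0 (1/2) \<inter> marked X = {}"

text \<open>
  The arcs divide the surface into the elementary polygons. Each arc has two banks, one for each
  direction, and each bank is exactly one polygon side.\<close>

definition polygonal_dissection :: "('p, 'v, 'g) ribbon_surface \<Rightarrow> bool" where
  "polygonal_dissection X \<longleftrightarrow>
     finite (polygons X) \<and>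
     (\<forall>P \<in> polygons X.
        continuous_map (top_of_set (model (shape X P))) (surf X) (chart X P) \<and>
        chart X P ` model_interior (shape X P) \<subseteq> surface_interior X \<and>
        (\<forall>(U, f) \<in> atlas X. orientation_preserving
           {z \<in> model_interior (shape X P). chart X P z \<in> U} (f \<circ> chart X P)) \<and>
        boundary_side X P (shape X P)) \<and>
     bij_betw (\<lambda>(P, z). chart X P z) (SIGMA P : polygons X. model_minus_arcs (shape X P))
       (topspace (surf X) - (\<Union>\<gamma> \<in> arcs X. arc_path X \<gamma> ` {0..1})) \<and>
     bij_betw (\<lambda>(P, x). side X P x) {(P, x). arc_side X P x} (arcs X \<times> UNIV) \<and>
     (\<forall>P x \<gamma> d. arc_side X P x \<and> side X P x = (\<gamma>, d) \<longrightarrow>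
        (\<forall>s \<in> {0..1}. chart X P (model_side (sides X P) x s) =
           arc_path X \<gamma> (if d then s else 1 - s)))"

definition extra_points :: "('p, 'v, 'g) ribbon_surface \<Rightarrow> bool" where
  "extra_points X \<longleftrightarrow>
     (let digons = {P \<in> polygons X. shape X P = Disc 2};
          seg = (\<lambda>P. chart X P ` model_side 2 1 ` {0<..<1})
      in extra X \<subseteq> (\<Union>P \<in> digons. seg P) \<and> (\<forall>P \<in> digons. \<exists>!e. e \<in> extra X \<inter> seg P))"

definition marked_ribbon_surface :: "('p, 'v, 'g) ribbon_surface \<Rightarrow> bool" where
  "marked_ribbon_surface X \<longleftrightarrow>
     oriented_surface (surf X) (atlas X) \<and> connected_space (surf X) \<and> bdry X \<noteq> {} \<and>
     finite (marked X) \<and> marked X \<subseteq> bdry X \<and>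
     marked_arcs X \<and> polygonal_dissection X \<and> extra_points X"

text \<open>
  At vertex \<open>x\<close> of a polygon, side \<open>prev_side n x\<close> follows side \<open>x\<close> counterclockwise (inside the
  polygon). So the pair \<open>(P, x)\<close> gives an arrow from the arc on side \<open>x\<close> to the arc on side
  \<open>prev_side n x\<close>, provided that both sides are in \<open>\<Gamma>\<close>.\<close>

definition corners :: "('p, 'v, 'g) ribbon_surface \<Rightarrow> ('g \<times> nat) set" where
  "corners X = {(P, x). arc_side X P x \<and> arc_side X P (prev_side (sides X P) x)}"

text \<open>
  \<open>kQ/I\<close> is the algebra of \<open>X\<close>: the vertices of \<open>Q\<close> are the arcs, \<open>\<theta>\<close> names the arrow belonging to
  a corner. Two arrows \<open>u \<rightarrow> v \<rightarrow> w\<close> arising from the same polygon have to meet at the same side \<open>v\<close>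
  of it; an arc may occur on two sides of one polygon.\<close>

definition algebra_of_surface ::
    "('p, 'v, 'g) ribbon_surface \<Rightarrow> ('v, 'e) quiver \<Rightarrow> (('v, 'e) qpath \<Rightarrow> 'k::field) set \<Rightarrow>
     ('g \<times> nat \<Rightarrow> 'e) \<Rightarrow> bool" where
  "algebra_of_surface X Q I \<theta> \<longleftrightarrow>
     verts Q = arcs X \<and> bij_betw \<theta> (corners X) (arrs Q) \<and>
     (\<forall>(P, x) \<in> corners X. src Q (\<theta> (P, x)) = fst (side X P x) \<and>
        tgt Q (\<theta> (P, x)) = fst (side X P (prev_side (sides X P) x))) \<and>
     I = genideal (path_algebra Q)
       {comp2 Q (\<theta> (P, x)) (\<theta> (P, prev_side (sides X P) x)) | P x.
          (P, x) \<in> corners X \<and> (P, prev_side (sides X P) x) \<in> corners X}"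

section \<open>Permissible curves\<close>

text \<open>
  A trace records how a curve crosses the arcs. Segment \<open>j\<close> of the curve runs through the polygon
  \<open>poly j\<close>, entering through its side \<open>entry j\<close> and leaving through its side \<open>exit_side j\<close>;
  \<open>on_left j\<close> says that the common endpoint of these two sides which is cut off by the
  segment lies on the left of the curve.
  For a curve crossing \<open>\<gamma>\<^sub>1, \<dots>, \<gamma>\<^bsub>r-1\<^esub>\<close> we have \<open>len = r\<close>, the segments are numbered
  \<open>0, \<dots>, r - 1\<close>, and segment \<open>j\<close> joins \<open>\<gamma>\<^sub>j\<close> to \<open>\<gamma>\<^bsub>j+1\<^esub>\<close>; segments \<open>0\<close> and \<open>r - 1\<close> are the end
  segments. For a closed curve crossing \<open>\<gamma>\<^sub>1, \<dots>, \<gamma>\<^sub>r\<close> we have \<open>len = r\<close>, and the segments are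
  numbered \<open>1, \<dots>, r\<close>, cyclically.\<close>

record 'g trace =
  len :: nat
  poly :: "nat \<Rightarrow> 'g"
  entry :: "nat \<Rightarrow> nat"
  exit_side :: "nat \<Rightarrow> nat"
  on_left :: "nat \<Rightarrow> bool"

definition crossed :: "('p, 'v, 'g) ribbon_surface \<Rightarrow> 'g trace \<Rightarrow> nat \<Rightarrow> 'v" where
  "crossed X tr j = fst (side X (poly tr j) (entry tr j))"

text \<open>\<open>\<sigma>\<close> is the restriction of \<open>c\<close> to \<open>{t0..t1}\<close>, lifted to the model of \<open>P\<close>.\<close>

definition segment ::
    "('p, 'v, 'g) ribbon_surface \<Rightarrow> (real \<Rightarrow> 'p) \<Rightarrow> 'g \<Rightarrow> real \<Rightarrow> real \<Rightarrow> (real \<Rightarrow> complex) \<Rightarrow> bool" where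
  "segment X c P t0 t1 \<sigma> \<longleftrightarrow> P \<in> polygons X \<and> t0 < t1 \<and> path \<sigma> \<and>
     path_image \<sigma> \<subseteq> model (shape X P) \<and> \<sigma> ` {0<..<1} \<subseteq> model_interior (shape X P) \<and>
     (\<forall>s \<in> {0..1}. c ((1 - s) * t0 + s * t1) = chart X P (\<sigma> s))"

text \<open>The curve leaves \<open>P\<close> through side \<open>y\<close> and enters \<open>P'\<close> through side \<open>x\<close>, which are the two
  banks of one arc.\<close>

definition crossing ::
    "('p, 'v, 'g) ribbon_surface \<Rightarrow> 'g \<Rightarrow> nat \<Rightarrow> (real \<Rightarrow> complex) \<Rightarrow> 'g \<Rightarrow> nat \<Rightarrow> (real \<Rightarrow> complex) \<Rightarrow> bool" where
  "crossing X P y \<sigma> P' x \<sigma>' \<longleftrightarrow>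
     arc_side X P y \<and> pathfinish \<sigma> \<in> model_side (sides X P) y ` {0<..<1} \<and>
     arc_side X P' x \<and> pathstart \<sigma>' \<in> model_side (sides X P') x ` {0<..<1} \<and>
     fst (side X P y) = fst (side X P' x) \<and> snd (side X P y) \<noteq> snd (side X P' x)"

definition circ_path :: "nat \<Rightarrow> real \<Rightarrow> real \<Rightarrow> real \<Rightarrow> complex" where
  "circ_path n u v s = circ n ((1 - s) * u + s * v)"

text \<open>
  The segment \<open>\<sigma>\<close> from side \<open>x\<close> to side \<open>y\<close> bounds a (singular) triangle together with the pieces
  of these sides up to a common vertex: it is homotopic, with fixed endpoints, to the path which
  first runs along side \<open>x\<close> to that vertex and then along side \<open>y\<close>. As the polygon lies on the left
  of its boundary, the vertex lies on the left of \<open>\<sigma>\<close> if it is the first vertex of side \<open>x\<close> and on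
  the right if it is the last vertex of side \<open>x\<close>.\<close>

definition triangle ::
    "('p, 'v, 'g) ribbon_surface \<Rightarrow> 'g \<Rightarrow> nat \<Rightarrow> nat \<Rightarrow> bool \<Rightarrow> (real \<Rightarrow> complex) \<Rightarrow> bool" where
  "triangle X P x y lft \<sigma> \<longleftrightarrow> arc_side X P x \<and> arc_side X P y \<and>
     (let n = sides X P in
      \<exists>u \<in> {0<..<1}. \<exists>v \<in> {0<..<1}.
        if lft
        then y = prev_side n x \<and>
          homotopic_paths (model (shape X P)) \<sigma> (circ_path n (real x + u) (real x - 1 + v))
        else x = prev_side n y \<and>
          homotopic_paths (model (shape X P)) \<sigma> (circ_path n (real x + u) (real x + 1 + v)))"

definition arc_points :: "('p, 'v, 'g) ribbon_surface \<Rightarrow> 'p set" where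
  "arc_points X = (\<Union>\<gamma> \<in> arcs X. arc_path X \<gamma> ` {0..1})"

definition crossing_times :: "('p, 'v, 'g) ribbon_surface \<Rightarrow> (real \<Rightarrow> 'p) \<Rightarrow> real set" where
  "crossing_times X c = {s. 0 < s \<and> s < 1 \<and> c s \<in> arc_points X}"

definition curve :: "('p, 'v, 'g) ribbon_surface \<Rightarrow> (real \<Rightarrow> 'p) \<Rightarrow> bool" where
  "curve X c \<longleftrightarrow> pathin (surf X) c \<and> c 0 \<in> marked X \<union> extra X \<and> c 1 \<in> marked X \<union> extra X \<and>
     c ` {0<..<1} \<subseteq> surface_interior X"

definition minimal_crossings :: "('p, 'v, 'g) ribbon_surface \<Rightarrow> (real \<Rightarrow> 'p) \<Rightarrow> bool" where
  "minimal_crossings X c \<longleftrightarrow> finite (crossing_times X c) \<and>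
     (\<forall>c'. curve X c' \<and> finite (crossing_times X c') \<and>
        homotopic_with (\<lambda>h. h 0 = c 0 \<and> h 1 = c 1) (top_of_set {0..1}) (surf X) c c' \<longrightarrow>
        card (crossing_times X c) \<le> card (crossing_times X c'))"

text \<open>The number of complete turns of an end segment around the hole of its polygon is at most one.
  Both endpoints lie on the unit circle, so the library's winding number is the total angle divided
  by \<open>2 * pi\<close>.\<close>

fun end_winding :: "shape \<Rightarrow> (real \<Rightarrow> complex) \<Rightarrow> bool" where
  "end_winding (Disc n) \<sigma> \<longleftrightarrow> True"
| "end_winding (Annulus n) \<sigma> \<longleftrightarrow> \<lfloor>\<bar>Re (winding_number \<sigma> 0)\<bar>\<rfloor> \<in> {0, 1}"

definition permissible_curve :: "('p, 'v, 'g) ribbon_surface \<Rightarrow> (real \<Rightarrow> 'p) \<Rightarrow> 'g trace \<Rightarrow> bool" where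
  "permissible_curve X c tr \<longleftrightarrow> curve X c \<and> minimal_crossings X c \<and>
     (\<exists>t \<sigma>. let r = len tr in
        1 \<le> r \<and> t 0 = 0 \<and> t r = 1 \<and>
        (\<forall>j<r. segment X c (poly tr j) (t j) (t (Suc j)) (\<sigma> j)) \<and>
        (\<forall>j. 1 \<le> j \<and> j < r \<longrightarrow>
           crossing X (poly tr (j - 1)) (exit_side tr (j - 1)) (\<sigma> (j - 1))
             (poly tr j) (entry tr j) (\<sigma> j)) \<and>
        (\<forall>j \<in> {0, r - 1}. end_winding (shape X (poly tr j)) (\<sigma> j)) \<and>
        (\<forall>j. 1 \<le> j \<and> j + 2 \<le> r \<longrightarrow>
           triangle X (poly tr j) (entry tr j) (exit_side tr j) (on_left tr j) (\<sigma> j)))"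

definition cyc_prev :: "nat \<Rightarrow> nat \<Rightarrow> nat" where
  "cyc_prev r j = (if j = 1 then r else j - 1)"

definition cyc_next :: "nat \<Rightarrow> nat \<Rightarrow> nat" where
  "cyc_next r j = (if j = r then 1 else j + 1)"

text \<open>A closed curve is a map on the real line with period \<open>1\<close>.\<close>

definition permissible_closed_curve ::
    "('p, 'v, 'g) ribbon_surface \<Rightarrow> (real \<Rightarrow> 'p) \<Rightarrow> 'g trace \<Rightarrow> bool" where
  "permissible_closed_curve X c tr \<longleftrightarrow>
     continuous_map euclidean (surf X) c \<and> (\<forall>s. c (s + 1) = c s) \<and> range c \<subseteq> surface_interior X \<and>
     (\<exists>t \<sigma>. let r = len tr in
        1 \<le> r \<and> t (Suc r) = t 1 + 1 \<and>
        (\<forall>j \<in> {1..r}.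
           segment X c (poly tr j) (t j) (t (Suc j)) (\<sigma> j) \<and>
           crossing X (poly tr (cyc_prev r j)) (exit_side tr (cyc_prev r j)) (\<sigma> (cyc_prev r j))
             (poly tr j) (entry tr j) (\<sigma> j) \<and>
           triangle X (poly tr j) (entry tr j) (exit_side tr j) (on_left tr j) (\<sigma> j)))"

section \<open>The modules of permissible curves\<close>

definition crossing_corner :: "'g trace \<Rightarrow> nat \<Rightarrow> 'g \<times> nat" where
  "crossing_corner tr j = (poly tr j, if on_left tr j then entry tr j else exit_side tr j)"

definition string_walk ::
    "('p, 'v, 'g) ribbon_surface \<Rightarrow> ('g \<times> nat \<Rightarrow> 'e) \<Rightarrow> 'g trace \<Rightarrow> ('v, 'e, 'k::field) walk" where
  "string_walk X \<theta> tr =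
    \<lparr>positions = {j. 1 \<le> j \<and> j < len tr},
     vertex_at = crossed X tr,
     letters = {j. 1 \<le> j \<and> j + 2 \<le> len tr},
     letter_source = (\<lambda>j. if on_left tr j then j else j + 1),
     letter_target = (\<lambda>j. if on_left tr j then j + 1 else j),
     letter_arrow = (\<lambda>j. \<theta> (crossing_corner tr j)),
     letter_map = (\<lambda>_ x. x)\<rparr>"

definition string_module ::
    "('p, 'v, 'g) ribbon_surface \<Rightarrow> ('g \<times> nat \<Rightarrow> 'e) \<Rightarrow> 'g trace \<Rightarrow>
     ((('v, 'e) qpath \<Rightarrow> 'k::field) set, nat \<Rightarrow> 'k) module" where
  "string_module X \<theta> tr = walk_module (*) (string_walk X \<theta> tr)"

text \<open>The automorphism is put on an arbitrary letter \<open>l\<close> of the cyclic walk.\<close>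

definition band_walk ::
    "('p, 'v, 'g) ribbon_surface \<Rightarrow> ('g \<times> nat \<Rightarrow> 'e) \<Rightarrow> 'g trace \<Rightarrow> nat \<Rightarrow> ('w \<Rightarrow> 'w) \<Rightarrow>
     ('v, 'e, 'w) walk" where
  "band_walk X \<theta> tr l \<phi> =
    \<lparr>positions = {1..len tr},
     vertex_at = crossed X tr,
     letters = {1..len tr},
     letter_source = (\<lambda>j. if on_left tr j then j else cyc_next (len tr) j),
     letter_target = (\<lambda>j. if on_left tr j then cyc_next (len tr) j else j),
     letter_arrow = (\<lambda>j. \<theta> (crossing_corner tr j)),
     letter_map = (\<lambda>j x. if j = l then \<phi> x else x)\<rparr>"

definition band_module ::
    "('k \<Rightarrow> 'w \<Rightarrow> 'w::ab_group_add) \<Rightarrow> ('p, 'v, 'g) ribbon_surface \<Rightarrow> ('g \<times> nat \<Rightarrow> 'e) \<Rightarrow>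
     'g trace \<Rightarrow> nat \<Rightarrow> ('w \<Rightarrow> 'w) \<Rightarrow> ((('v, 'e) qpath \<Rightarrow> 'k::field) set, nat \<Rightarrow> 'w) module" where
  "band_module scl X \<theta> tr l \<phi> = walk_module scl (band_walk X \<theta> tr l \<phi>)"

text \<open>The sets \<open>\<II>\<close> of the theorem.\<close>

definition string_indices :: "'g trace \<Rightarrow> nat set" where
  "string_indices tr = (let r = len tr in
     {i. 1 \<le> i \<and> i \<le> r - 1 \<and>
        (2 \<le> i \<and> i \<le> r - 2 \<and> on_left tr (i - 1) \<and> \<not> on_left tr i \<or>
         i = 1 \<and> 3 \<le> r \<and> \<not> on_left tr 1 \<or>
         i = r - 1 \<and> 3 \<le> r \<and> on_left tr (r - 2) \<or>
         i = 1 \<and> r = 2)})"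

definition band_indices :: "'g trace \<Rightarrow> nat set" where
  "band_indices tr = {i \<in> {1..len tr}. on_left tr (cyc_prev (len tr) i) \<and> \<not> on_left tr i}"

section \<open>Injective permissible curves\<close>

text \<open>
  An arc has two ends, which may lie at the same marked point. The end \<open>(\<gamma>, d)\<close> is the start of
  \<open>\<gamma>\<close> if \<open>d\<close> holds, and its finish otherwise. In particular a polygon side labelled
  \<open>(\<gamma>, d)\<close> starts with the end \<open>(\<gamma>, d)\<close> and finishes with the end \<open>(\<gamma>, \<not> d)\<close>.\<close>

definition endpoint :: "('p, 'v, 'g) ribbon_surface \<Rightarrow> 'v \<times> bool \<Rightarrow> 'p" where
  "endpoint X e = arc_path X (fst e) (if snd e then 0 else 1)"

definition opposite_end :: "'v \<times> bool \<Rightarrow> 'v \<times> bool" where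
  "opposite_end e = (fst e, \<not> snd e)"

definition ccw_next :: "('p, 'v, 'g) ribbon_surface \<Rightarrow> 'v \<times> bool \<Rightarrow> 'v \<times> bool \<Rightarrow> bool" where
  "ccw_next X e e' \<longleftrightarrow> (\<exists>(P, x) \<in> corners X.
     e = side X P x \<and> e' = opposite_end (side X P (prev_side (sides X P) x)))"

text \<open>The arc ends at a marked point, which lies on the boundary, are linearly ordered
  counterclockwise by the transitive closure of \<open>ccw_next\<close>.\<close>

definition surround_ccw ::
    "('p, 'v, 'g) ribbon_surface \<Rightarrow> 'p \<Rightarrow> ('v \<times> bool) list \<Rightarrow> bool" where
  "surround_ccw X m es \<longleftrightarrow> (\<forall>e \<in> set es. fst e \<in> arcs X \<and> endpoint X e = m) \<and>
     sorted_wrt (ccw_next X)\<^sup>+\<^sup>+ es"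

definition surround_cw ::
    "('p, 'v, 'g) ribbon_surface \<Rightarrow> 'p \<Rightarrow> ('v \<times> bool) list \<Rightarrow> bool" where
  "surround_cw X m es \<longleftrightarrow> surround_ccw X m (rev es)"

text \<open>The ends, on the left and on the right of the curve, of the \<open>j\<close>-th crossed arc: a curve
  entering a polygon through a side has the first vertex of that side on its left.\<close>

definition left_end :: "('p, 'v, 'g) ribbon_surface \<Rightarrow> 'g trace \<Rightarrow> nat \<Rightarrow> 'v \<times> bool" where
  "left_end X tr j = side X (poly tr j) (entry tr j)"

definition right_end :: "('p, 'v, 'g) ribbon_surface \<Rightarrow> 'g trace \<Rightarrow> nat \<Rightarrow> 'v \<times> bool" where
  "right_end X tr j = opposite_end (left_end X tr j)"

text \<open>The point \<open>p(\<gamma>\<^sub>j, \<gamma>\<^bsub>j+1\<^esub>, c)\<close>.\<close>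

definition common_point :: "('p, 'v, 'g) ribbon_surface \<Rightarrow> 'g trace \<Rightarrow> nat \<Rightarrow> 'p" where
  "common_point X tr j = (case crossing_corner tr j of (P, x) \<Rightarrow> chart X P (circ (sides X P) (real x)))"

text \<open>As the two endpoints \<open>m\<close>, \<open>m'\<close> may coincide, the equations \<open>m = p(\<delta>\<^sub>j, \<delta>\<^bsub>j+1\<^esub>, c)\<close> include that
  the common endpoint is on the left of the curve, and similarly for \<open>m'\<close>.\<close>

definition injective_permissible_curve ::
    "('p, 'v, 'g) ribbon_surface \<Rightarrow> 'v \<Rightarrow> (real \<Rightarrow> 'p) \<Rightarrow> 'g trace \<Rightarrow> bool" where
  "injective_permissible_curve X \<gamma> c tr \<longleftrightarrow> permissible_curve X c tr \<and>
     (\<exists>!i. 1 \<le> i \<and> i < len tr \<and> crossed X tr i = \<gamma> \<and>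
        (let m = endpoint X (left_end X tr i); m' = endpoint X (right_end X tr i) in
         (\<forall>j. 1 \<le> j \<and> j < i \<longrightarrow> on_left tr j \<and> common_point X tr j = m) \<and>
         (\<forall>j. i \<le> j \<and> j + 2 \<le> len tr \<longrightarrow> \<not> on_left tr j \<and> common_point X tr j = m') \<and>
         \<not> (\<exists>e. surround_ccw X m (e # map (left_end X tr) [1..<Suc i])) \<and>
         \<not> (\<exists>e. surround_cw X m' (map (right_end X tr) [i..<len tr] @ [e]))))"

end

theory Submission
  imports Defs
begin

text \<open>
  Call an element of a module a socle element if all arrows annihilate it. As long paths lie in
  \<open>I\<close>, every nonzero submodule contains a nonzero socle element. Hence a module map into an
  injective module is an injective envelope as soon as it is bijective between the socle elements
  of both sides.

  The crossings of the injective permissible curve of an arc \<open>\<gamma>\<close> correspond to the nonzero paths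
  ending at \<open>\<gamma>\<close>: maximality of the curve excludes further paths. So a linear functional \<open>\<xi>\<close> on a
  module \<open>Y\<close> gives a module map from \<open>Y\<close> to the module of this curve, whose coefficient at the
  crossing of the path \<open>p\<close> is \<open>\<xi> (y p)\<close>, and every module map arises in this way. As functionals
  extend from submodules, the module is injective; its socle elements are concentrated at \<open>\<gamma>\<close>.

  The socle elements of the string or band module of \<open>c\<close> are supported on the positions that no
  letter leaves, which are the indices in \<open>\<II>\<close>. The maps given by the coordinates at these
  positions therefore form an envelope.\<close>

section \<open>Monomials of a path algebra\<close>

text \<open>Arcs may be loops, and one arc may occupy two sides of the same polygon. Hence the
  combinatorics is carried out with sides instead of arcs and marked points: an arc has two banks,
  each bank is one polygon side, and a curve crossing the arc leaves through one bank and enters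
  through the other. An arrow ending at an arc arrives at exactly one of the two banks. At a
  crossing of an injective curve such an arrow is a letter of the curve, or forms a relation with
  the first arrow of the path of this crossing, or would lengthen the fan of arcs at one end of the
  curve. This trichotomy turns maximality of the curve into completeness of its list of paths.

  Two obstacles shape the algebra. Modules are records without a scalar multiplication, so their
  linear structure is recovered from the action of multiples of the identity. And a residue class
  acts on a walk module through a chosen representative, so the ideal must be known to annihilate
  the walk module before the latter is known to be a module.\<close>

definition mon :: "'k::field \<Rightarrow> ('v, 'e) qpath \<Rightarrow> ('v, 'e) qpath \<Rightarrow> 'k" where
  "mon c p = (\<lambda>q. if q = p then c else 0)"

lemma path_elem_mon: "path_elem p = mon 1 p"
  by (simp add: path_elem_def mon_def)

lemma path_algebra_add: "a \<oplus>\<^bsub>path_algebra Q\<^esub> b = (\<lambda>p. a p + b p)"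
  by (simp add: path_algebra_def)

lemma path_algebra_zero: "\<zero>\<^bsub>path_algebra Q\<^esub> = (\<lambda>_. 0)"
  by (simp add: path_algebra_def)

lemma path_algebra_one:
  "\<one>\<^bsub>path_algebra Q\<^esub> = (\<lambda>(v, es). if v \<in> verts Q \<and> es = [] then 1 else 0)"
  by (simp add: path_algebra_def)

lemma path_algebra_mult:
  "(a \<otimes>\<^bsub>path_algebra Q\<^esub> b) (v, es) =
     (\<Sum>i\<le>length es. a (v, take i es) * b (path_target Q (v, take i es), drop i es))"
  by (simp add: path_algebra_def)

lemma path_algebra_carrier:
  "a \<in> carrier (path_algebra Q) \<longleftrightarrow> finite {p. a p \<noteq> 0} \<and> {p. a p \<noteq> 0} \<subseteq> qpaths Q"
  by (simp add: path_algebra_def)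

lemma mon_carrier: "p \<in> qpaths Q \<Longrightarrow> mon c p \<in> carrier (path_algebra Q)"
  by (auto simp: path_algebra_carrier mon_def)

text \<open>A list can be cut into \<open>es\<close> followed by \<open>fs\<close> at one place
  only, so at most one summand of the convolution survives.\<close>

lemma mon_mult:
  "mon c (v, es) \<otimes>\<^bsub>path_algebra Q\<^esub> mon d (w, fs) =
     (if path_target Q (v, es) = w then mon (c * d) (v, es @ fs) else (\<lambda>_. 0))"
proof (intro ext, safe)
  fix u gs
  let ?A = "path_algebra Q"
  let ?c = "path_target Q (v, es) = w \<and> u = v \<and> gs = es @ fs"
  have summand: "mon c (v, es) (u, take i gs) * mon d (w, fs) (path_target Q (u, take i gs), drop i gs)
      = (if i = length es then (if ?c then c * d else 0) else 0)" if "i \<le> length gs" for i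
  proof (cases "u = v \<and> take i gs = es \<and> drop i gs = fs \<and> path_target Q (u, take i gs) = w")
    case True
    then have "length es = i" "gs = es @ fs"
      using that by (metis length_take min.absorb2, metis append_take_drop_id)
    then show ?thesis
      using True by (auto simp: mon_def)
  next
    case False
    then have "mon c (v, es) (u, take i gs) * mon d (w, fs) (path_target Q (u, take i gs), drop i gs) = 0"
      by (auto simp add: mon_def simp del: path_target.simps)
    moreover have "\<not> (i = length es \<and> ?c)"
      using False by auto
    ultimately show ?thesis
      by argo
  qed
  have "(mon c (v, es) \<otimes>\<^bsub>?A\<^esub> mon d (w, fs)) (u, gs) =
      (\<Sum>i\<le>length gs. if i = length es then (if ?c then c * d else 0) else 0)"
    unfolding path_algebra_mult by (rule sum.cong) (use summand in auto)
  also have "\<dots> = (if length es \<le> length gs \<and> ?c then c * d else 0)"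
    by simp
  finally show "(mon c (v, es) \<otimes>\<^bsub>?A\<^esub> mon d (w, fs)) (u, gs) =
      (if path_target Q (v, es) = w then mon (c * d) (v, es @ fs) else (\<lambda>_. 0)) (u, gs)"
    by (auto simp: mon_def)
qed

text \<open>Elements have finite support and are therefore finite sums of monomials. The coefficient
  stays inside the monomial, which spares a case for scalar multiples.\<close>

lemma path_algebra_induct [consumes 1, case_names zero add mon]:
  assumes a: "a \<in> carrier (path_algebra Q)"
    and zero: "P (\<lambda>_. 0)"
    and add: "\<And>a b. a \<in> carrier (path_algebra Q) \<Longrightarrow> b \<in> carrier (path_algebra Q) \<Longrightarrow>
      P a \<Longrightarrow> P b \<Longrightarrow> P (\<lambda>p. a p + b p)"
    and mon: "\<And>c v es. walks_from Q v es \<Longrightarrow> P (mon c (v, es))"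
  shows "P a"
proof -
  have "P a" if "finite F" "F \<subseteq> qpaths Q" "{p. a p \<noteq> 0} \<subseteq> F" for F a
    using that
  proof (induction F arbitrary: a rule: finite_induct)
    case empty
    then have "a = (\<lambda>_. 0)"
      by auto
    then show ?case
      using zero by simp
  next
    case (insert p F)
    \<comment> \<open>One path of the support is split off: \<open>a\<close> is its monomial plus
      \<open>?b\<close>.\<close>
    let ?b = "a(p := 0)"
    have "{q. ?b q \<noteq> 0} \<subseteq> F"
      using insert.prems by auto
    moreover from this have b: "?b \<in> carrier (path_algebra Q)"
      using insert.hyps insert.prems unfolding path_algebra_carrier
      by (meson finite_subset insert_subset order_trans)
    moreover have p: "p \<in> qpaths Q" "F \<subseteq> qpaths Q" "walks_from Q (fst p) (snd p)"
      using insert.prems by (auto simp: qpaths_def)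
    ultimately have "P (mon (a p) p)" "P ?b"
      using insert.IH[of ?b] mon[of "fst p" "snd p" "a p"] by (simp_all del: fun_upd_apply)
    then have "P (\<lambda>q. mon (a p) p q + ?b q)"
      by (rule add[OF mon_carrier[OF p(1)] b])
    moreover have "(\<lambda>q. mon (a p) p q + ?b q) = a"
      by (auto simp: mon_def)
    ultimately show ?case
      by simp
  qed
  then show ?thesis
    using a unfolding path_algebra_carrier by blast
qed

text \<open>A walk with empty list asks its start to be a vertex. For empty \<open>fs\<close> the
  equivalence therefore needs targets of arrows to be vertices, which \<open>finite_quiver\<close>
  provides.\<close>

lemma walks_from_append:
  assumes "finite_quiver Q"
  shows "walks_from Q v (es @ fs) \<longleftrightarrow>
    walks_from Q v es \<and> walks_from Q (path_target Q (v, es)) fs"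
proof (induction es arbitrary: v)
  case Nil
  then show ?case
    using assms by (cases fs) (auto simp: finite_quiver_def)
qed (use assms in \<open>auto simp: finite_quiver_def\<close>)

section \<open>Modules over the algebra of a bound quiver\<close>

text \<open>The action pulled back along the projection to the quotient ring, so that one computes
  with paths instead of residue classes.\<close>

definition lact :: "('v, 'e) quiver \<Rightarrow> (('v, 'e) qpath \<Rightarrow> 'k::field) set \<Rightarrow>
    ((('v, 'e) qpath \<Rightarrow> 'k) set, 'm) module \<Rightarrow> (('v, 'e) qpath \<Rightarrow> 'k) \<Rightarrow> 'm \<Rightarrow> 'm" where
  "lact Q I M a x = (I +>\<^bsub>path_algebra Q\<^esub> a) \<odot>\<^bsub>M\<^esub> x"

text \<open>The relations are kept as an explicit set of pairs of arrows, because walks are later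
  compared with relations pair by pair and not through membership in \<open>I\<close>.\<close>

locale bound_quiver =
  fixes Q :: "('v, 'e) quiver" and I :: "(('v, 'e) qpath \<Rightarrow> 'k::field) set" and Z :: "('e \<times> 'e) set"
  assumes finite_quiver: "finite_quiver Q"
    and admissible: "admissible_ideal Q I"
    and relations: "Z \<subseteq> {(\<alpha>, \<beta>). \<alpha> \<in> arrs Q \<and> \<beta> \<in> arrs Q \<and> tgt Q \<alpha> = src Q \<beta>}"
    and generated: "I = genideal (path_algebra Q) ((\<lambda>(\<alpha>, \<beta>). comp2 Q \<alpha> \<beta>) ` Z)"
begin

abbreviation P :: "(('v, 'e) qpath \<Rightarrow> 'k) ring" where "P \<equiv> path_algebra Q"

abbreviation R :: "(('v, 'e) qpath \<Rightarrow> 'k) set ring" where "R \<equiv> P Quot I"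

abbreviation act :: "((('v, 'e) qpath \<Rightarrow> 'k) set, 'm) module \<Rightarrow> (('v, 'e) qpath \<Rightarrow> 'k) \<Rightarrow> 'm \<Rightarrow> 'm"
  where "act \<equiv> lact Q I"

abbreviation arrow :: "'e \<Rightarrow> ('v, 'e) qpath \<Rightarrow> 'k" where "arrow \<alpha> \<equiv> mon 1 (src Q \<alpha>, [\<alpha>])"

sublocale ideal I P
  using admissible by (simp add: admissible_ideal_def)

lemma arrow_vertices: "\<alpha> \<in> arrs Q \<Longrightarrow> src Q \<alpha> \<in> verts Q" "\<alpha> \<in> arrs Q \<Longrightarrow> tgt Q \<alpha> \<in> verts Q"
  using finite_quiver by (auto simp: finite_quiver_def)

lemma mon_closed [simp]: "walks_from Q v es \<Longrightarrow> mon c (v, es) \<in> carrier P"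
  by (rule mon_carrier) (simp add: qpaths_def)

lemma arrow_closed [simp]: "\<alpha> \<in> arrs Q \<Longrightarrow> arrow \<alpha> \<in> carrier P"
  by (simp add: arrow_vertices)

lemma walks_append:
  "walks_from Q v (es @ fs) \<longleftrightarrow> walks_from Q v es \<and> walks_from Q (path_target Q (v, es)) fs"
  by (rule walks_from_append[OF finite_quiver])

lemma path_target_verts: "walks_from Q v es \<Longrightarrow> path_target Q (v, es) \<in> verts Q"
  using walks_append[of v es "[]"] by simp

text \<open>The multiple \<open>c\<close> of the identity. Its action is the scalar multiplication
  of a module.\<close>

definition scal :: "'k \<Rightarrow> ('v, 'e) qpath \<Rightarrow> 'k" where
  "scal c = (\<lambda>(v, es). if v \<in> verts Q \<and> es = [] then c else 0)"

lemma scal_closed [simp]: "scal c \<in> carrier P"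
proof -
  have "{p. scal c p \<noteq> 0} \<subseteq> (\<lambda>v. (v, [])) ` verts Q"
    by (auto simp: scal_def split: if_splits)
  moreover have "(\<lambda>v. (v, [])) ` verts Q \<subseteq> qpaths Q"
    by (auto simp: qpaths_def)
  ultimately show ?thesis
    using finite_quiver unfolding path_algebra_carrier finite_quiver_def
    by (meson finite_imageI finite_subset order_trans)
qed

lemma scal_one: "scal 1 = \<one>\<^bsub>P\<^esub>"
  by (simp add: scal_def path_algebra_one)

lemma scal_add: "scal (c + d) = scal c \<oplus>\<^bsub>P\<^esub> scal d"
  by (auto simp: scal_def path_algebra_add)

text \<open>Only the cut at the end of the path leaves a stationary second factor. It counts because
  the end of a path in the support of \<open>a\<close> is a vertex of \<open>Q\<close>.\<close>

lemma mult_scal: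
  assumes "a \<in> carrier P" shows "a \<otimes>\<^bsub>P\<^esub> scal c = (\<lambda>p. c * a p)"
proof (intro ext, safe)
  fix v es
  have "(a \<otimes>\<^bsub>P\<^esub> scal c) (v, es) = (\<Sum>i\<le>length es. if i = length es then c * a (v, es) else 0)"
    unfolding path_algebra_mult
  proof (rule sum.cong[OF refl])
    fix i assume i: "i \<in> {..length es}"
    show "a (v, take i es) * scal c (path_target Q (v, take i es), drop i es) =
        (if i = length es then c * a (v, es) else 0)"
    proof (cases "i = length es")
      case True
      have "a (v, es) \<noteq> 0 \<Longrightarrow> path_target Q (v, es) \<in> verts Q"
        using assms path_target_verts[of v es] by (auto simp: path_algebra_carrier qpaths_def)
      then show ?thesis
        using True by (cases "a (v, es) = 0") (auto simp: scal_def)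
    qed (use i in \<open>auto simp: scal_def\<close>)
  qed
  then show "(a \<otimes>\<^bsub>P\<^esub> scal c) (v, es) = c * a (v, es)"
    by simp
qed

lemma mon_scal: "walks_from Q v es \<Longrightarrow> mon c (v, es) = mon 1 (v, es) \<otimes>\<^bsub>P\<^esub> scal c"
  using mult_scal[OF mon_closed, of v es 1 c] by (simp add: mon_def if_distrib cong: if_cong)

lemma mon_snoc:
  "walks_from Q v (es @ [\<alpha>]) \<Longrightarrow> mon c (v, es @ [\<alpha>]) = mon c (v, es) \<otimes>\<^bsub>P\<^esub> arrow \<alpha>"
  using walks_append[of v es "[\<alpha>]"] by (simp add: mon_mult)

lemma carrier_R: "carrier R = (\<lambda>a. I +>\<^bsub>P\<^esub> a) ` carrier P"
  by (auto simp: FactRing_def A_RCOSETS_def' a_r_coset_def r_coset_def)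

lemma coset_I: "a \<in> I \<Longrightarrow> I +>\<^bsub>P\<^esub> a = \<zero>\<^bsub>R\<^esub>"
  using a_coset_join2[of a I] a_Hcarr a_subgroup by (simp add: FactRing_def)

definition socle :: "((('v, 'e) qpath \<Rightarrow> 'k) set, 'm) module \<Rightarrow> 'm set" where
  "socle M = {x \<in> carrier M. \<forall>\<alpha> \<in> arrs Q. act M (arrow \<alpha>) x = \<zero>\<^bsub>M\<^esub>}"

lemma long_path_in_I:
  "\<exists>m. \<forall>v es. walks_from Q v es \<and> m \<le> length es \<longrightarrow> mon 1 (v, es) \<in> I"
proof -
  from admissible obtain m where m: "(arrow_ideal_power Q m :: (('v, 'e) qpath \<Rightarrow> 'k) set) \<subseteq> I"
    unfolding admissible_ideal_def by blast
  have "(mon 1 (v, es) :: _ \<Rightarrow> 'k) \<in> arrow_ideal_power Q m"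
    if "walks_from Q v es \<and> m \<le> length es" for v es
  proof -
    have "mon (1 :: 'k) (v, es) (w, fs) \<noteq> 0 \<Longrightarrow> fs = es" for w fs
      by (simp add: mon_def split: if_splits)
    then show ?thesis
      using that by (auto simp: arrow_ideal_power_def)
  qed
  then show ?thesis
    using m by blast
qed

end

locale bound_module = bound_quiver Q I Z
  for Q :: "('v, 'e) quiver" and I :: "(('v, 'e) qpath \<Rightarrow> 'k::field) set" and Z +
  fixes M :: "((('v, 'e) qpath \<Rightarrow> 'k) set, 'm) module"
  assumes right_module: "right_module R M"
begin

sublocale M: abelian_group M
  using right_module by (simp add: right_module_def)

lemma act_closed [simp]:
  "a \<in> carrier P \<Longrightarrow> x \<in> carrier M \<Longrightarrow> act M a x \<in> carrier M"
  using right_module by (simp add: right_module_def lact_def carrier_R)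

lemma act_add:
  "a \<in> carrier P \<Longrightarrow> b \<in> carrier P \<Longrightarrow> x \<in> carrier M \<Longrightarrow>
     act M (a \<oplus>\<^bsub>P\<^esub> b) x = act M a x \<oplus>\<^bsub>M\<^esub> act M b x"
  using right_module ring_hom_add[OF rcos_ring_hom, of a b]
  by (simp add: right_module_def lact_def carrier_R)

lemma act_plus:
  "a \<in> carrier P \<Longrightarrow> x \<in> carrier M \<Longrightarrow> y \<in> carrier M \<Longrightarrow>
     act M a (x \<oplus>\<^bsub>M\<^esub> y) = act M a x \<oplus>\<^bsub>M\<^esub> act M a y"
  using right_module by (simp add: right_module_def lact_def carrier_R)

lemma act_mult:
  "a \<in> carrier P \<Longrightarrow> b \<in> carrier P \<Longrightarrow> x \<in> carrier M \<Longrightarrow>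
     act M (a \<otimes>\<^bsub>P\<^esub> b) x = act M b (act M a x)"
  using right_module ring_hom_mult[OF rcos_ring_hom, of a b]
  by (simp add: right_module_def lact_def carrier_R)

lemma act_one [simp]: "x \<in> carrier M \<Longrightarrow> act M \<one>\<^bsub>P\<^esub> x = x"
  using right_module by (simp add: right_module_def lact_def FactRing_def)

text \<open>For \<open>a\<close> in \<open>I\<close> the elements \<open>a\<close> and
  \<open>a + a\<close> have the same residue class, so \<open>act M a x\<close> equals its own
  double and is zero.\<close>

lemma act_I:
  assumes "a \<in> I" "x \<in> carrier M" shows "act M a x = \<zero>\<^bsub>M\<^esub>"
proof -
  have a: "a \<in> carrier P"
    using assms a_Hcarr by blast
  have "I +>\<^bsub>P\<^esub> (a \<oplus>\<^bsub>P\<^esub> a) = I +>\<^bsub>P\<^esub> a"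
    using assms by (simp add: coset_I)
  then have "act M a x \<oplus>\<^bsub>M\<^esub> act M a x = act M a x"
    using act_add[OF a a assms(2)] by (simp add: lact_def)
  then show ?thesis
    using M.add.l_cancel_one[of "act M a x" "act M a x"] a assms by simp
qed

lemma act_zero_left [simp]: "x \<in> carrier M \<Longrightarrow> act M (\<lambda>_. 0) x = \<zero>\<^bsub>M\<^esub>"
  using act_I[of "\<lambda>_. 0"] zero_closed additive_subgroup.zero_closed[OF is_additive_subgroup]
  by (simp add: path_algebra_zero)

lemma act_zero [simp]: "a \<in> carrier P \<Longrightarrow> act M a \<zero>\<^bsub>M\<^esub> = \<zero>\<^bsub>M\<^esub>"
  using act_plus[of a "\<zero>\<^bsub>M\<^esub>" "\<zero>\<^bsub>M\<^esub>"] M.add.l_cancel_one[of "act M a \<zero>\<^bsub>M\<^esub>" "act M a \<zero>\<^bsub>M\<^esub>"] by simp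

text \<open>Among the paths that do not annihilate \<open>x\<close>, one of maximal length works: a
  further arrow either makes a longer path or does not compose with it. Maximal length exists
  because long paths lie in \<open>I\<close>.\<close>

lemma act_into_socle:
  assumes x: "x \<in> carrier M" "x \<noteq> \<zero>\<^bsub>M\<^esub>"
  obtains a where "a \<in> carrier P" "act M a x \<in> socle M" "act M a x \<noteq> \<zero>\<^bsub>M\<^esub>"
proof -
  let ?S = "\<lambda>n. \<exists>v es. walks_from Q v es \<and> length es = n \<and> act M (mon 1 (v, es)) x \<noteq> \<zero>\<^bsub>M\<^esub>"
  obtain m where m: "walks_from Q v es \<Longrightarrow> m \<le> length es \<Longrightarrow> mon 1 (v, es) \<in> I" for v es
    using long_path_in_I by blast
  have bound: "n < m" if "?S n" for n
    using that m act_I x(1) by (meson linorder_not_le)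
  \<comment> \<open>Otherwise all paths, hence all algebra elements including the identity, would
    annihilate \<open>x\<close>.\<close>
  have "\<exists>n. ?S n"
  proof (rule ccontr)
    assume neg: "\<not> (\<exists>n. ?S n)"
    have "act M a x = \<zero>\<^bsub>M\<^esub>" if "a \<in> carrier P" for a
      using that
    proof (induction rule: path_algebra_induct)
      case (add a b)
      then show ?case
        using act_add[OF add(1,2) x(1)] by (simp add: path_algebra_add)
    next
      case (mon c v es)
      then have "act M (mon 1 (v, es)) x = \<zero>\<^bsub>M\<^esub>"
        using neg by blast
      then show ?case
        using mon x act_mult[of "mon 1 (v, es)" "scal c" x] by (simp flip: mon_scal)
    qed (use x in simp)
    then show False
      using x act_one by (metis one_closed)
  qed
  then obtain n where n: "?S n" "\<And>k. ?S k \<Longrightarrow> k \<le> n"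
    using bound ex_has_greatest_nat[of ?S _ "\<lambda>n. n" m] by (metis less_imp_le)
  then obtain v es where es: "walks_from Q v es" "length es = n" "act M (mon 1 (v, es)) x \<noteq> \<zero>\<^bsub>M\<^esub>"
    by blast
  have "act M (arrow \<alpha>) (act M (mon 1 (v, es)) x) = \<zero>\<^bsub>M\<^esub>" if \<alpha>: "\<alpha> \<in> arrs Q" for \<alpha>
  proof -
    have "act M (arrow \<alpha>) (act M (mon 1 (v, es)) x) = act M (mon 1 (v, es) \<otimes>\<^bsub>P\<^esub> arrow \<alpha>) x"
      using act_mult es \<alpha> x by simp
    also have "\<dots> = \<zero>\<^bsub>M\<^esub>"
    proof (cases "path_target Q (v, es) = src Q \<alpha>")
      case True
      then have "walks_from Q v (es @ [\<alpha>])"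
        unfolding walks_append using es \<alpha> by (simp add: arrow_vertices)
      then have "act M (mon 1 (v, es @ [\<alpha>])) x = \<zero>\<^bsub>M\<^esub>"
        using n(2)[of "Suc n"] es(2) by (metis Suc_n_not_le_n length_append_singleton)
      then show ?thesis
        using True by (simp add: mon_mult)
    qed (simp add: mon_mult x del: path_target.simps)
    finally show ?thesis .
  qed
  then show ?thesis
    using es x that[of "mon 1 (v, es)"] by (simp add: socle_def)
qed

end

lemma (in bound_quiver) module_mapsI:
  assumes "\<And>x. x \<in> carrier M \<Longrightarrow> f x \<in> carrier N"
    and "\<And>x y. x \<in> carrier M \<Longrightarrow> y \<in> carrier M \<Longrightarrow> f (x \<oplus>\<^bsub>M\<^esub> y) = f x \<oplus>\<^bsub>N\<^esub> f y"
    and "\<And>a x. a \<in> carrier P \<Longrightarrow> x \<in> carrier M \<Longrightarrow> f (act M a x) = act N a (f x)"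
  shows "f \<in> module_maps R M N"
  using assms by (auto simp: module_maps_def carrier_R lact_def)

lemma (in bound_quiver) module_maps_act:
  "f \<in> module_maps R M N \<Longrightarrow> a \<in> carrier P \<Longrightarrow> x \<in> carrier M \<Longrightarrow> f (act M a x) = act N a (f x)"
  by (auto simp: module_maps_def carrier_R lact_def)

text \<open>Arrows and stationary paths with a coefficient generate the path algebra. The last arrow
  of a path acts last on a right module, so paths are peeled from the end and the coefficient
  remains on the stationary path.\<close>

lemma (in bound_quiver) module_maps_mon_induct:
  assumes M: "right_module R M" and N: "right_module R N"
    and closed: "\<And>x. x \<in> carrier M \<Longrightarrow> f x \<in> carrier N"
    and add: "\<And>x y. x \<in> carrier M \<Longrightarrow> y \<in> carrier M \<Longrightarrow> f (x \<oplus>\<^bsub>M\<^esub> y) = f x \<oplus>\<^bsub>N\<^esub> f y"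
    and zero: "f \<zero>\<^bsub>M\<^esub> = \<zero>\<^bsub>N\<^esub>"
    and vertex: "\<And>c v x. v \<in> verts Q \<Longrightarrow> x \<in> carrier M \<Longrightarrow>
      f (act M (mon c (v, [])) x) = act N (mon c (v, [])) (f x)"
    and arrow: "\<And>\<alpha> x. \<alpha> \<in> arrs Q \<Longrightarrow> x \<in> carrier M \<Longrightarrow>
      f (act M (arrow \<alpha>) x) = act N (arrow \<alpha>) (f x)"
  shows "f \<in> module_maps R M N"
proof (rule module_mapsI)
  show "\<And>x. x \<in> carrier M \<Longrightarrow> f x \<in> carrier N"
    by (rule closed)
  show "\<And>x y. x \<in> carrier M \<Longrightarrow> y \<in> carrier M \<Longrightarrow> f (x \<oplus>\<^bsub>M\<^esub> y) = f x \<oplus>\<^bsub>N\<^esub> f y"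
    by (rule add)
  interpret M: bound_module Q I Z M
    using M by unfold_locales
  interpret N: bound_module Q I Z N
    using N by unfold_locales
  fix a x assume a: "a \<in> carrier P" and x: "x \<in> carrier M"
  show "f (act M a x) = act N a (f x)"
    using a
  proof (induction rule: path_algebra_induct)
    case zero
    then show ?case
      using x closed assms(5) by simp
  next
    case (add a b)
    then show ?case
      using M.act_add[OF add(1,2) x] N.act_add[OF add(1,2) closed[OF x]] x assms(4)
      by (simp add: path_algebra_add)
  next
    case (mon c v es)
    then show ?case
    proof (induction es rule: rev_induct)
      case Nil
      then show ?case
        using x vertex by simp
    next
      case (snoc \<alpha> es)
      then have *: "walks_from Q v es" "\<alpha> \<in> arrs Q"
        by (auto simp: walks_append)
      then show ?case
        using snoc x arrow closed by (simp add: mon_snoc M.act_mult N.act_mult)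
    qed
  qed
qed

section \<open>Modules of walks\<close>

text \<open>The coefficient space is general, so that strings (the field itself) and bands (the
  space of the automorphism) are treated together. \<open>incoming_unique\<close> excludes sums, and
  so cancellation, in \<open>arrow_act\<close>; \<open>no_relation\<close> makes the generators of
  \<open>I\<close> act as zero; \<open>letter_inj\<close> allows the socle to be read off the
  letters.\<close>

locale bound_walk = bound_quiver Q I Z + V: finite_dimensional_vector_space scl B
  for Q :: "('v, 'e) quiver" and I :: "(('v, 'e) qpath \<Rightarrow> 'k::field) set" and Z
    and scl :: "'k \<Rightarrow> 'w \<Rightarrow> 'w::ab_group_add" and B +
  fixes W :: "('v, 'e, 'w) walk"
  assumes finite_positions: "finite (positions W)"
    and finite_letters: "finite (letters W)"
    and vertex_verts: "i \<in> positions W \<Longrightarrow> vertex_at W i \<in> verts Q"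
    and letter_source: "j \<in> letters W \<Longrightarrow> letter_source W j \<in> positions W"
    and letter_target: "j \<in> letters W \<Longrightarrow> letter_target W j \<in> positions W"
    and letter_arrow: "j \<in> letters W \<Longrightarrow> letter_arrow W j \<in> arrs Q"
    and src_letter: "j \<in> letters W \<Longrightarrow> src Q (letter_arrow W j) = vertex_at W (letter_source W j)"
    and tgt_letter: "j \<in> letters W \<Longrightarrow> tgt Q (letter_arrow W j) = vertex_at W (letter_target W j)"
    and letter_linear: "j \<in> letters W \<Longrightarrow> Vector_Spaces.linear scl scl (letter_map W j)"
    and letter_inj: "j \<in> letters W \<Longrightarrow> letter_map W j x = 0 \<Longrightarrow> x = 0"
    and incoming_unique: "j \<in> letters W \<Longrightarrow> j' \<in> letters W \<Longrightarrow> letter_target W j = letter_target W j' \<Longrightarrow>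
      letter_arrow W j = letter_arrow W j' \<Longrightarrow> j = j'"
    and no_relation: "j \<in> letters W \<Longrightarrow> j' \<in> letters W \<Longrightarrow> letter_target W j = letter_source W j' \<Longrightarrow>
      (letter_arrow W j, letter_arrow W j') \<notin> Z"
begin

abbreviation N :: "((('v, 'e) qpath \<Rightarrow> 'k) set, nat \<Rightarrow> 'w) module" where
  "N \<equiv> walk_module scl W"

abbreviation aact :: "(('v, 'e) qpath \<Rightarrow> 'k) \<Rightarrow> (nat \<Rightarrow> 'w) \<Rightarrow> nat \<Rightarrow> 'w" where
  "aact \<equiv> algebra_act scl W"

lemma carrier_N: "f \<in> carrier N \<longleftrightarrow> (\<forall>i. i \<notin> positions W \<longrightarrow> f i = 0)"
  by (simp add: walk_module_def)

lemma N_simps [simp]: "\<zero>\<^bsub>N\<^esub> = (\<lambda>_. 0)" "f \<oplus>\<^bsub>N\<^esub> g = (\<lambda>i. f i + g i)"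
  by (simp_all add: walk_module_def)

lemma letter_map_add: "j \<in> letters W \<Longrightarrow> letter_map W j (x + y) = letter_map W j x + letter_map W j y"
  using letter_linear Vector_Spaces.linear_iff by blast

lemma letter_map_scale: "j \<in> letters W \<Longrightarrow> letter_map W j (scl c x) = scl c (letter_map W j x)"
  using letter_linear Vector_Spaces.linear_iff by blast

lemma letter_map_zero: "j \<in> letters W \<Longrightarrow> letter_map W j 0 = 0"
  using letter_map_scale[of j 0 0] by simp

lemma arrow_act_letter:
  assumes "j \<in> letters W"
  shows "arrow_act W (letter_arrow W j) f (letter_target W j) = letter_map W j (f (letter_source W j))"
proof -
  have "{j'. j' \<in> letters W \<and> letter_arrow W j' = letter_arrow W j \<and>
      letter_target W j' = letter_target W j} = {j}"
    using assms incoming_unique by auto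
  then show ?thesis
    by (simp add: arrow_act_def)
qed

lemma arrow_act_none:
  "(\<And>j. j \<in> letters W \<Longrightarrow> letter_arrow W j = \<alpha> \<Longrightarrow> letter_target W j = i \<Longrightarrow> f (letter_source W j) = 0) \<Longrightarrow>
     arrow_act W \<alpha> f i = 0"
  by (auto simp: arrow_act_def letter_map_zero intro!: sum.neutral)

lemma arrow_act_nonzero:
  assumes "arrow_act W \<alpha> f i \<noteq> 0"
  obtains j where "j \<in> letters W" "letter_arrow W j = \<alpha>" "letter_target W j = i" "f (letter_source W j) \<noteq> 0"
  using arrow_act_none assms by blast

lemma arrow_act_add: "arrow_act W \<alpha> (\<lambda>i. f i + g i) = (\<lambda>i. arrow_act W \<alpha> f i + arrow_act W \<alpha> g i)"
  by (simp add: arrow_act_def letter_map_add sum.distrib)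

lemma arrow_act_scale: "arrow_act W \<alpha> (\<lambda>i. scl c (f i)) = (\<lambda>i. scl c (arrow_act W \<alpha> f i))"
  by (simp add: arrow_act_def letter_map_scale V.scale_sum_right)

lemma arrow_act_zero: "arrow_act W \<alpha> (\<lambda>_. 0) = (\<lambda>_. 0)"
  by (auto intro: arrow_act_none)

lemma path_act_snoc: "path_act W (v, es @ [\<alpha>]) f = arrow_act W \<alpha> (path_act W (v, es) f)"
  by simp

lemma path_act_add: "path_act W p (\<lambda>i. f i + g i) = (\<lambda>i. path_act W p f i + path_act W p g i)"
proof (cases p)
  case (Pair v es)
  show ?thesis
    unfolding Pair
    by (induction es rule: rev_induct) (auto simp: vertex_act_def arrow_act_add)
qed

lemma path_act_scale: "path_act W p (\<lambda>i. scl c (f i)) = (\<lambda>i. scl c (path_act W p f i))"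
proof (cases p)
  case (Pair v es)
  show ?thesis
    unfolding Pair
    by (induction es rule: rev_induct) (auto simp: vertex_act_def arrow_act_scale)
qed

lemma path_act_zero: "path_act W p (\<lambda>_. 0) = (\<lambda>_. 0)"
  using path_act_scale[of p 0 "\<lambda>_. 0"] by simp

lemma path_act_support: "path_act W (v, es) f i \<noteq> 0 \<Longrightarrow> vertex_at W i = path_target Q (v, es)"
proof (cases es rule: rev_cases)
  case Nil
  then show "path_act W (v, es) f i \<noteq> 0 \<Longrightarrow> vertex_at W i = path_target Q (v, es)"
    by (auto simp: vertex_act_def split: if_splits)
next
  case (snoc fs \<alpha>)
  assume "path_act W (v, es) f i \<noteq> 0"
  then obtain j where "j \<in> letters W" "letter_arrow W j = \<alpha>" "letter_target W j = i"
    unfolding snoc path_act_snoc by (rule arrow_act_nonzero)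
  then show "vertex_at W i = path_target Q (v, es)"
    using snoc tgt_letter by auto
qed

lemma path_act_closed: "f \<in> carrier N \<Longrightarrow> path_act W (v, es) f \<in> carrier N"
proof (cases es rule: rev_cases)
  case (snoc fs \<alpha>)
  show ?thesis
    unfolding snoc path_act_snoc carrier_N using arrow_act_nonzero letter_target by metis
qed (simp add: carrier_N vertex_act_def)

text \<open>The result of the first path is supported on positions at its target, so the
  \<open>vertex_act\<close> that opens the second path is the identity on it or kills it.\<close>

lemma path_act_append:
  "path_act W (w, fs) (path_act W (v, es) f) =
     (if path_target Q (v, es) = w then path_act W (v, es @ fs) f else (\<lambda>_. 0))"
proof -
  have "vertex_act W w (path_act W (v, es) f) =
      (if path_target Q (v, es) = w then path_act W (v, es) f else (\<lambda>_. 0))"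
  proof -
    have "path_act W (v, es) f i = 0" if "vertex_at W i \<noteq> path_target Q (v, es)" for i
      using path_act_support that by blast
    then show ?thesis
      unfolding vertex_act_def by (auto simp: fun_eq_iff simp del: path_act.simps path_target.simps)
  qed
  then have "path_act W (w, fs) (path_act W (v, es) f) = (if path_target Q (v, es) = w
      then foldl (\<lambda>g \<alpha>. arrow_act W \<alpha> g) (path_act W (v, es) f) fs
      else foldl (\<lambda>g \<alpha>. arrow_act W \<alpha> g) (\<lambda>_. 0) fs)"
    by (simp del: path_target.simps)
  moreover have "foldl (\<lambda>g \<alpha>. arrow_act W \<alpha> g) (\<lambda>_. 0) fs = (\<lambda>_. 0)"
    by (induction fs) (auto simp: arrow_act_zero)
  moreover have "path_act W (v, es @ fs) f = foldl (\<lambda>g \<alpha>. arrow_act W \<alpha> g) (path_act W (v, es) f) fs"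
    by simp
  ultimately show ?thesis
    by argo
qed

text \<open>Actions of different algebra elements become comparable once both sums run over one
  common finite set of paths.\<close>

lemma algebra_act_superset:
  assumes "finite F" "{p. a p \<noteq> 0} \<subseteq> F"
  shows "aact a f i = (\<Sum>p\<in>F. scl (a p) (path_act W p f i))"
  unfolding algebra_act_def using assms by (intro sum.mono_neutral_left) auto

lemma algebra_act_add:
  assumes "a \<in> carrier P" "b \<in> carrier P"
  shows "aact (\<lambda>p. a p + b p) f = (\<lambda>i. aact a f i + aact b f i)"
proof
  fix i
  let ?F = "{p. a p \<noteq> 0} \<union> {p. b p \<noteq> 0}"
  have "finite ?F"
    using assms by (simp add: path_algebra_carrier)
  then have "aact (\<lambda>p. a p + b p) f i = (\<Sum>p\<in>?F. scl (a p + b p) (path_act W p f i))"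
    "aact a f i = (\<Sum>p\<in>?F. scl (a p) (path_act W p f i))"
    "aact b f i = (\<Sum>p\<in>?F. scl (b p) (path_act W p f i))"
    by (intro algebra_act_superset; auto)+
  then show "aact (\<lambda>p. a p + b p) f i = aact a f i + aact b f i"
    by (simp add: V.scale_left_distrib sum.distrib del: path_act.simps)
qed

lemma algebra_act_zero_left: "aact (\<lambda>_. 0) f = (\<lambda>_. 0)"
  by (simp add: algebra_act_def)

lemma algebra_act_mon: "aact (mon c p) f = (\<lambda>i. scl c (path_act W p f i))"
proof
  fix i
  have "{q. mon c p q \<noteq> 0} \<subseteq> {p}"
    by (auto simp: mon_def)
  then show "aact (mon c p) f i = scl c (path_act W p f i)"
    using algebra_act_superset[of "{p}" "mon c p" f i] by (simp add: mon_def)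
qed

lemma algebra_act_plus: "aact a (\<lambda>i. f i + g i) = (\<lambda>i. aact a f i + aact a g i)"
  by (simp add: algebra_act_def path_act_add V.scale_right_distrib sum.distrib del: path_act.simps)

lemma algebra_act_zero: "aact a (\<lambda>_. 0) = (\<lambda>_. 0)"
  by (simp add: algebra_act_def path_act_zero del: path_act.simps)

lemma algebra_act_closed: "f \<in> carrier N \<Longrightarrow> aact a f \<in> carrier N"
  using path_act_closed[of f] unfolding carrier_N algebra_act_def
  by (auto intro!: sum.neutral simp del: path_act.simps)

text \<open>Both sides are additive in either factor, so a nested induction leaves two monomials,
  for which it is the concatenation rule for paths.\<close>

lemma algebra_act_mult:
  assumes "a \<in> carrier P" "b \<in> carrier P"
  shows "aact (a \<otimes>\<^bsub>P\<^esub> b) f = aact b (aact a f)"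
  using assms(2)
proof (induction rule: path_algebra_induct)
  case zero
  have "a \<otimes>\<^bsub>P\<^esub> (\<lambda>_. 0) = (\<lambda>_. 0)"
    using r_null[OF assms(1)] by (simp add: path_algebra_zero)
  then show ?case
    by (simp add: algebra_act_zero_left)
next
  case (add b c)
  have "a \<otimes>\<^bsub>P\<^esub> (\<lambda>p. b p + c p) = (\<lambda>p. (a \<otimes>\<^bsub>P\<^esub> b) p + (a \<otimes>\<^bsub>P\<^esub> c) p)"
    using r_distr[OF add(1,2) assms(1)] by (simp add: path_algebra_add)
  then show ?case
    using add assms(1) by (simp add: algebra_act_add)
next
  case (mon d w fs)
  let ?b = "mon d (w, fs)"
  have b: "?b \<in> carrier P"
    using mon by simp
  show ?case
    using assms(1)
  proof (induction rule: path_algebra_induct)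
    case zero
    have "(\<lambda>_. 0) \<otimes>\<^bsub>P\<^esub> ?b = (\<lambda>_. 0)"
      using l_null[OF b] by (simp add: path_algebra_zero)
    then show ?case
      by (simp add: algebra_act_zero_left algebra_act_zero)
  next
    case (add a c)
    have "(\<lambda>p. a p + c p) \<otimes>\<^bsub>P\<^esub> ?b = (\<lambda>p. (a \<otimes>\<^bsub>P\<^esub> ?b) p + (c \<otimes>\<^bsub>P\<^esub> ?b) p)"
      using l_distr[OF add(1,2) b] by (simp add: path_algebra_add)
    then show ?case
      using add b by (simp add: algebra_act_add algebra_act_plus)
  next
    case (mon c v es)
    show ?case
      by (simp add: mon_mult algebra_act_mon path_act_scale path_act_append algebra_act_zero_left
          mult.commute del: path_act.simps path_target.simps)
  qed
qed

text \<open>Of the stationary paths that make up \<open>scal c\<close>, only the one at the vertex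
  of position \<open>i\<close> contributes at \<open>i\<close>.\<close>

lemma algebra_act_scal:
  assumes "f \<in> carrier N" shows "aact (scal c) f = (\<lambda>i. scl c (f i))"
proof
  fix i
  have "finite ((\<lambda>v. (v, [])) ` verts Q)" "{p. scal c p \<noteq> 0} \<subseteq> (\<lambda>v. (v, [])) ` verts Q"
    using finite_quiver by (auto simp: finite_quiver_def scal_def split: if_splits)
  then have "aact (scal c) f i = (\<Sum>p\<in>(\<lambda>v. (v, [])) ` verts Q. scl (scal c p) (path_act W p f i))"
    by (rule algebra_act_superset)
  also have "\<dots> = (\<Sum>v\<in>verts Q. scl (scal c (v, [])) (path_act W (v, []) f i))"
    by (subst sum.reindex) (auto simp: inj_on_def)
  also have "\<dots> = (\<Sum>v\<in>verts Q. if v = vertex_at W i then scl c (f i) else 0)"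
    by (intro sum.cong) (auto simp: scal_def vertex_act_def)
  also have "\<dots> = scl c (f i)"
    using finite_quiver assms vertex_verts[of i] by (auto simp: finite_quiver_def carrier_N)
  finally show "aact (scal c) f i = scl c (f i)" .
qed

text \<open>The annihilator \<open>K\<close> of the walk module is a two-sided ideal that contains
  the generators, hence contains the ideal generated by them.\<close>

lemma algebra_act_I:
  assumes "a \<in> I" "f \<in> carrier N"
  shows "aact a f = (\<lambda>_. 0)"
proof -
  define K where "K = {a \<in> carrier P. \<forall>f \<in> carrier N. aact a f = (\<lambda>_. 0)}"
  \<comment> \<open>With the additive inverse written as a product, closure of \<open>K\<close>
    under inverses follows from the rule for products.\<close>
  have neg: "\<ominus>\<^bsub>P\<^esub> a = a \<otimes>\<^bsub>P\<^esub> scal (-1)" if "a \<in> carrier P" for a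
  proof -
    have "a \<oplus>\<^bsub>P\<^esub> a \<otimes>\<^bsub>P\<^esub> scal (-1) = \<zero>\<^bsub>P\<^esub>"
      by (simp add: mult_scal[OF that] path_algebra_add path_algebra_zero)
    then show ?thesis
      using that minus_equality[of "a \<otimes>\<^bsub>P\<^esub> scal (-1)" a] by (simp add: a_comm)
  qed
  have "ideal K P"
  proof (rule idealI)
    show "subgroup K (add_monoid P)"
    proof (rule add.subgroupI)
      show "K \<noteq> {}"
        using zero_closed by (auto simp: K_def path_algebra_zero algebra_act_zero_left)
      show "\<ominus>\<^bsub>P\<^esub> a \<in> K" if "a \<in> K" for a
        using that by (auto simp: K_def neg algebra_act_mult algebra_act_zero)
      show "a \<oplus>\<^bsub>P\<^esub> b \<in> K" if "a \<in> K" "b \<in> K" for a b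
        using that a_closed[of a b] by (auto simp: K_def path_algebra_add algebra_act_add)
    qed (auto simp: K_def)
  qed (auto simp: K_def algebra_act_mult algebra_act_zero algebra_act_closed ring_axioms)
  moreover have "comp2 Q \<alpha> \<beta> \<in> K" if "(\<alpha>, \<beta>) \<in> Z" for \<alpha> \<beta>
  proof -
    have ab: "\<alpha> \<in> arrs Q" "\<beta> \<in> arrs Q" "tgt Q \<alpha> = src Q \<beta>"
      using relations that by auto
    then have "comp2 Q \<alpha> \<beta> \<in> carrier P"
      by (simp add: path_elem_mon arrow_vertices)
    \<comment> \<open>A nonzero value would need two successive letters whose arrows form a pair in
      \<open>Z\<close>.\<close>
    moreover have "path_act W (src Q \<alpha>, [\<alpha>, \<beta>]) f i = 0" for f i
      using no_relation that by (auto intro!: arrow_act_none)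
    then have "aact (comp2 Q \<alpha> \<beta>) f = (\<lambda>_. 0)" for f
      by (simp add: path_elem_mon algebra_act_mon del: path_act.simps)
    ultimately show ?thesis
      by (simp add: K_def)
  qed
  ultimately have "I \<subseteq> K"
    unfolding generated by (intro genideal_minimal) auto
  then show ?thesis
    using assms by (auto simp: K_def)
qed

text \<open>The representative picked by \<open>SOME\<close> differs from \<open>a\<close> by an
  element of \<open>I\<close>, which acts as zero.\<close>

lemma smult_N:
  assumes a: "a \<in> carrier P" and f: "f \<in> carrier N"
  shows "(I +>\<^bsub>P\<^esub> a) \<odot>\<^bsub>N\<^esub> f = aact a f"
proof -
  have "(SOME b. b \<in> I +>\<^bsub>P\<^esub> a) \<in> I +>\<^bsub>P\<^esub> a"
    using a_rcos_self[OF a] by (rule someI[of "\<lambda>b. b \<in> I +>\<^bsub>P\<^esub> a"])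
  then obtain h where h: "h \<in> I" "(SOME b. b \<in> I +>\<^bsub>P\<^esub> a) = h \<oplus>\<^bsub>P\<^esub> a"
    by (auto simp: a_r_coset_def r_coset_def)
  then have "aact (SOME b. b \<in> I +>\<^bsub>P\<^esub> a) f = aact a f"
    using f a a_Hcarr algebra_act_I by (simp add: path_algebra_add algebra_act_add)
  then show ?thesis
    by (simp add: walk_module_def)
qed

lemma act_N: "a \<in> carrier P \<Longrightarrow> f \<in> carrier N \<Longrightarrow> act N a f = aact a f"
  by (simp add: lact_def smult_N)

lemma right_module_N: "right_module R N"
proof -
  have "abelian_group N"
  proof (rule abelian_groupI)
    fix f assume f: "f \<in> carrier N"
    show "\<exists>g\<in>carrier N. g \<oplus>\<^bsub>N\<^esub> f = \<zero>\<^bsub>N\<^esub>"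
      using f by (intro bexI[of _ "\<lambda>i. - f i"]) (auto simp: carrier_N)
  qed (auto simp: carrier_N add.assoc add.commute)
  moreover have "(I +>\<^bsub>P\<^esub> a) \<oplus>\<^bsub>R\<^esub> (I +>\<^bsub>P\<^esub> b) = I +>\<^bsub>P\<^esub> (a \<oplus>\<^bsub>P\<^esub> b)"
    "(I +>\<^bsub>P\<^esub> a) \<otimes>\<^bsub>R\<^esub> (I +>\<^bsub>P\<^esub> b) = I +>\<^bsub>P\<^esub> (a \<otimes>\<^bsub>P\<^esub> b)"
    if "a \<in> carrier P" "b \<in> carrier P" for a b
    using that ring_hom_add[OF rcos_ring_hom, of a b] ring_hom_mult[OF rcos_ring_hom, of a b] by auto
  moreover have "aact (a \<oplus>\<^bsub>P\<^esub> b) f = (\<lambda>i. aact a f i + aact b f i)"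
    if "a \<in> carrier P" "b \<in> carrier P" for a b f
    using that by (simp add: path_algebra_add algebra_act_add)
  moreover have "(\<lambda>i. f i + g i) \<in> carrier N" if "f \<in> carrier N" "g \<in> carrier N" for f g
    using that by (simp add: carrier_N)
  moreover have "\<one>\<^bsub>R\<^esub> \<odot>\<^bsub>N\<^esub> f = f" if "f \<in> carrier N" for f
  proof -
    have "\<one>\<^bsub>R\<^esub> = I +>\<^bsub>P\<^esub> scal 1"
      by (simp add: FactRing_def scal_one)
    then show ?thesis
      using that by (simp add: smult_N algebra_act_scal)
  qed
  ultimately show ?thesis
    unfolding right_module_def
    by (auto simp: quotient_is_ring carrier_R smult_N algebra_act_closed algebra_act_plus
        algebra_act_mult)
qed

sublocale bound_module Q I Z N
  by unfold_locales (rule right_module_N)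

definition single :: "nat \<Rightarrow> 'w \<Rightarrow> nat \<Rightarrow> 'w" where
  "single i x = (\<lambda>j. if j = i then x else 0)"

lemma single_closed: "i \<in> positions W \<Longrightarrow> single i x \<in> carrier N"
  by (simp add: carrier_N single_def)

text \<open>The vectors of \<open>B\<close>, placed at single positions, are generators: the scalars
  \<open>scal c\<close> alone already span everything from them, as there are finitely many
  positions.\<close>

lemma fg_module_N: "fg_module R N"
proof -
  let ?X = "(\<lambda>(i, b). single i b) ` (positions W \<times> B)"
  have "S = carrier N" if S: "right_submodule R S N" and X: "?X \<subseteq> S" for S
  proof
    show "S \<subseteq> carrier N"
      using S by (simp add: right_submodule_def)
    have S_add: "(\<lambda>i. f i + g i) \<in> S" if "f \<in> S" "g \<in> S" for f g
      using S that by (auto simp: right_submodule_def)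
    have S_scale: "(\<lambda>i. scl c (f i)) \<in> S" if "f \<in> S" for f c
    proof -
      have f: "f \<in> carrier N"
        using S that by (auto simp: right_submodule_def)
      have "act N (scal c) f \<in> S"
        using S that by (auto simp: right_submodule_def lact_def carrier_R)
      then show ?thesis
        using f by (simp add: act_N algebra_act_scal)
    qed
    have single_S: "single i x \<in> S" if i: "i \<in> positions W" for i x
    proof -
      have "V.subspace {x. single i x \<in> S}"
      proof (rule V.subspaceI)
        show "0 \<in> {x. single i x \<in> S}"
          using S by (simp add: right_submodule_def single_def)
        fix x y c assume "x \<in> {x. single i x \<in> S}" "y \<in> {x. single i x \<in> S}"
        moreover have "(\<lambda>j. single i x j + single i y j) = single i (x + y)"
          "(\<lambda>j. scl c (single i x j)) = single i (scl c x)"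
          by (auto simp: single_def)
        ultimately show "x + y \<in> {x. single i x \<in> S}" "scl c x \<in> {x. single i x \<in> S}"
          using S_add S_scale by (metis mem_Collect_eq)+
      qed
      moreover have "B \<subseteq> {x. single i x \<in> S}"
        using X i by auto
      ultimately have "V.span B \<subseteq> {x. single i x \<in> S}"
        by (rule V.span_minimal[rotated])
      then show ?thesis
        using V.span_Basis by auto
    qed
    have "f \<in> S" if "finite F" "F \<subseteq> positions W" "\<And>i. i \<notin> F \<Longrightarrow> f i = 0" for F f
      using that
    proof (induction F arbitrary: f rule: finite_induct)
      case empty
      then have "f = (\<lambda>_. 0)"
        by auto
      then show ?case
        using S by (simp add: right_submodule_def)
    next
      case (insert i F)
      have "f(i := 0) \<in> S"
        using insert.prems by (intro insert.IH) auto
      then have "(\<lambda>j. single i (f i) j + (f(i := 0)) j) \<in> S"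
        using S_add single_S insert.prems by blast
      moreover have "(\<lambda>j. single i (f i) j + (f(i := 0)) j) = f"
        by (auto simp: single_def)
      ultimately show ?case
        by simp
    qed
    then show "carrier N \<subseteq> S"
      using finite_positions by (auto simp: carrier_N)
  qed
  moreover have "finite ?X" "?X \<subseteq> carrier N"
    using finite_positions V.finite_Basis single_closed by auto
  ultimately show ?thesis
    unfolding fg_module_def using right_module_N by blast
qed

lemma act_arrow: "\<alpha> \<in> arrs Q \<Longrightarrow> f \<in> carrier N \<Longrightarrow> act N (arrow \<alpha>) f = arrow_act W \<alpha> f"
proof -
  assume "\<alpha> \<in> arrs Q" "f \<in> carrier N"
  \<comment> \<open>Letters labelled \<open>\<alpha>\<close> read only positions at the source of
    \<open>\<alpha>\<close>, so the projection to this vertex changes nothing.\<close>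
  moreover have "arrow_act W \<alpha> (vertex_act W (src Q \<alpha>) f) = arrow_act W \<alpha> f"
    unfolding arrow_act_def by (intro ext sum.cong) (auto simp: vertex_act_def src_letter)
  ultimately show ?thesis
    by (simp add: act_N algebra_act_mon)
qed

text \<open>Nothing cancels: the value at the target of a letter after applying its arrow is the
  image, under an injective map, of the value at its source.\<close>

lemma socle_N:
  "socle N = {f \<in> carrier N. \<forall>i. f i \<noteq> 0 \<longrightarrow> (\<forall>j \<in> letters W. letter_source W j \<noteq> i)}"
proof (intro equalityI subsetI)
  fix f assume f: "f \<in> socle N"
  then have c: "f \<in> carrier N"
    by (simp add: socle_def)
  have "f (letter_source W j) = 0" if j: "j \<in> letters W" for j
  proof -
    have "arrow_act W (letter_arrow W j) f = (\<lambda>_. 0)"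
      using f c j letter_arrow act_arrow[OF letter_arrow[OF j] c] by (simp add: socle_def)
    then have "arrow_act W (letter_arrow W j) f (letter_target W j) = 0"
      by simp
    then show ?thesis
      using arrow_act_letter[OF j] letter_inj[OF j] by simp
  qed
  then show "f \<in> {f \<in> carrier N. \<forall>i. f i \<noteq> 0 \<longrightarrow> (\<forall>j \<in> letters W. letter_source W j \<noteq> i)}"
    using c by auto
next
  fix f assume f: "f \<in> {f \<in> carrier N. \<forall>i. f i \<noteq> 0 \<longrightarrow> (\<forall>j \<in> letters W. letter_source W j \<noteq> i)}"
  then have "arrow_act W \<alpha> f = (\<lambda>_. 0)" for \<alpha>
    by (intro ext arrow_act_none) auto
  then show "f \<in> socle N"
    using f by (simp add: socle_def act_arrow)
qed

end

section \<open>Injective modules and envelopes\<close>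

context bound_quiver
begin

text \<open>The domain is explicit because a functional is first given on the image of a
  monomorphism and then extended to the whole module.\<close>

definition functional :: "((('v, 'e) qpath \<Rightarrow> 'k) set, 'm) module \<Rightarrow> 'm set \<Rightarrow> ('m \<Rightarrow> 'k) \<Rightarrow> bool" where
  "functional M U \<xi> \<longleftrightarrow>
     (\<forall>x \<in> U. \<forall>y \<in> U. \<xi> (x \<oplus>\<^bsub>M\<^esub> y) = \<xi> x + \<xi> y) \<and>
     (\<forall>c. \<forall>x \<in> U. \<xi> (act M (scal c) x) = c * \<xi> x)"

end

context bound_module
begin

lemma scal_act_add:
  "x \<in> carrier M \<Longrightarrow> act M (scal (c + d)) x = act M (scal c) x \<oplus>\<^bsub>M\<^esub> act M (scal d) x"
  by (simp add: scal_add act_add)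

lemma scal_act_mult: "x \<in> carrier M \<Longrightarrow> act M (scal c) (act M (scal d) x) = act M (scal (c * d)) x"
proof -
  assume "x \<in> carrier M"
  moreover have "scal (c * d) = scal d \<otimes>\<^bsub>P\<^esub> scal c"
    unfolding mult_scal[OF scal_closed] by (auto simp: scal_def)
  ultimately show ?thesis
    by (simp add: act_mult)
qed

lemma scal_act_one: "x \<in> carrier M \<Longrightarrow> act M (scal 1) x = x"
  by (simp add: scal_one)

lemma scal_act_zero: "x \<in> carrier M \<Longrightarrow> act M (scal 0) x = \<zero>\<^bsub>M\<^esub>"
proof -
  have "scal 0 = (\<lambda>_. 0)"
    by (auto simp: scal_def)
  then show "x \<in> carrier M \<Longrightarrow> act M (scal 0) x = \<zero>\<^bsub>M\<^esub>"
    by simp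
qed

text \<open>Zorn's lemma, applied to the graphs of partial functionals extending
  \<open>\<xi>\<close>: a maximal graph is total, since otherwise one more vector could be adjoined
  to its domain.\<close>

lemma functional_extension:
  assumes U: "right_submodule R U M" and \<xi>: "functional M U \<xi>"
  obtains \<eta> where "functional M (carrier M) \<eta>" "\<And>x. x \<in> U \<Longrightarrow> \<eta> x = \<xi> x"
proof -
  define s where "s c x = act M (scal c) x" for c x
  have U_carrier: "U \<subseteq> carrier M" and U_zero: "\<zero>\<^bsub>M\<^esub> \<in> U"
    and U_add: "\<And>x y. x \<in> U \<Longrightarrow> y \<in> U \<Longrightarrow> x \<oplus>\<^bsub>M\<^esub> y \<in> U"
    and U_s: "\<And>c x. x \<in> U \<Longrightarrow> s c x \<in> U"
    using U by (auto simp: right_submodule_def s_def lact_def carrier_R)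
  have \<xi>_add: "\<And>x y. x \<in> U \<Longrightarrow> y \<in> U \<Longrightarrow> \<xi> (x \<oplus>\<^bsub>M\<^esub> y) = \<xi> x + \<xi> y"
    and \<xi>_s: "\<And>c x. x \<in> U \<Longrightarrow> \<xi> (s c x) = c * \<xi> x"
    using \<xi> by (auto simp: functional_def s_def)
  have s_closed: "s c x \<in> carrier M" if "x \<in> carrier M" for c x
    using that by (simp add: s_def)
  have s_mult: "s c (s d x) = s (c * d) x" if "x \<in> carrier M" for c d x
    using that by (simp add: s_def scal_act_mult)
  have s_plus: "s c (x \<oplus>\<^bsub>M\<^esub> y) = s c x \<oplus>\<^bsub>M\<^esub> s c y" if "x \<in> carrier M" "y \<in> carrier M" for c x y
    using that by (simp add: s_def act_plus)
  have s_add: "s (c + d) x = s c x \<oplus>\<^bsub>M\<^esub> s d x" if "x \<in> carrier M" for c d x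
    using that by (simp add: s_def scal_act_add)
  have s_one: "s 1 x = x" and s_zero: "s 0 x = \<zero>\<^bsub>M\<^esub>" if "x \<in> carrier M" for x
    using that by (simp_all add: s_def scal_act_one scal_act_zero)
  \<comment> \<open>Single-valuedness of a graph is expressed by its fibre over zero, which for a
    linear relation is equivalent and passes easily to unions of chains.\<close>
  define \<A> where "\<A> = {H. H \<subseteq> carrier M \<times> UNIV \<and> (\<zero>\<^bsub>M\<^esub>, 0) \<in> H \<and>
    (\<forall>x a y b. (x, a) \<in> H \<and> (y, b) \<in> H \<longrightarrow> (x \<oplus>\<^bsub>M\<^esub> y, a + b) \<in> H) \<and>
    (\<forall>c x a. (x, a) \<in> H \<longrightarrow> (s c x, c * a) \<in> H) \<and>
    (\<forall>a. (\<zero>\<^bsub>M\<^esub>, a) \<in> H \<longrightarrow> a = 0) \<and> (\<forall>x \<in> U. (x, \<xi> x) \<in> H)}"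
  have \<xi>_zero: "\<xi> \<zero>\<^bsub>M\<^esub> = 0"
    using \<xi>_s[of "\<zero>\<^bsub>M\<^esub>" 0] U_zero s_zero by simp
  have "(\<lambda>x. (x, \<xi> x)) ` U \<in> \<A>"
    unfolding \<A>_def using U_carrier U_zero \<xi>_zero
    by (auto simp: U_add U_s \<xi>_add \<xi>_s)
  then have nonempty: "\<A> \<noteq> {}"
    by blast
  have "\<exists>H\<in>\<A>. \<forall>H'\<in>\<A>. H \<subseteq> H' \<longrightarrow> H' = H"
  proof (rule subset_Zorn_nonempty[OF nonempty])
    fix C assume C: "C \<noteq> {}" "subset.chain \<A> C"
    then have CA: "H \<in> \<A>" if "H \<in> C" for H
      using that by (auto simp: subset_chain_def)
    have "(x \<oplus>\<^bsub>M\<^esub> y, a + b) \<in> \<Union>C" if xy: "(x, a) \<in> \<Union>C" "(y, b) \<in> \<Union>C" for x a y b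
    proof -
      obtain H H' where H: "H \<in> C" "H' \<in> C" "(x, a) \<in> H" "(y, b) \<in> H'"
        using xy by blast
      then consider "H \<subseteq> H'" | "H' \<subseteq> H"
        using C by (auto simp: subset_chain_def)
      then obtain K where "K \<in> C" "(x, a) \<in> K" "(y, b) \<in> K"
        using H by (metis subsetD)
      then have "(x \<oplus>\<^bsub>M\<^esub> y, a + b) \<in> K"
        using CA[of K] unfolding \<A>_def by blast
      then show ?thesis
        using \<open>K \<in> C\<close> by blast
    qed
    moreover have "(s c x, c * a) \<in> \<Union>C" if "(x, a) \<in> \<Union>C" for c x a
      using that CA unfolding \<A>_def by blast
    moreover have "\<Union>C \<subseteq> carrier M \<times> UNIV"
      using CA unfolding \<A>_def by blast
    moreover have "(\<zero>\<^bsub>M\<^esub>, 0) \<in> \<Union>C"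
      using C(1) CA unfolding \<A>_def by blast
    moreover have "a = 0" if "(\<zero>\<^bsub>M\<^esub>, a) \<in> \<Union>C" for a
      using that CA unfolding \<A>_def by blast
    moreover have "(x, \<xi> x) \<in> \<Union>C" if "x \<in> U" for x
      using that C(1) CA unfolding \<A>_def by blast
    ultimately show "\<Union>C \<in> \<A>"
      unfolding \<A>_def by blast
  qed
  then obtain H where HA: "H \<in> \<A>" and max: "\<And>H'. H' \<in> \<A> \<Longrightarrow> H \<subseteq> H' \<Longrightarrow> H' = H"
    by blast
  have H_carrier: "\<And>x a. (x, a) \<in> H \<Longrightarrow> x \<in> carrier M" and H_zero: "(\<zero>\<^bsub>M\<^esub>, 0) \<in> H"
    and H_add: "\<And>x a y b. (x, a) \<in> H \<Longrightarrow> (y, b) \<in> H \<Longrightarrow> (x \<oplus>\<^bsub>M\<^esub> y, a + b) \<in> H"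
    and H_s: "\<And>c x a. (x, a) \<in> H \<Longrightarrow> (s c x, c * a) \<in> H"
    and H_unique: "\<And>a. (\<zero>\<^bsub>M\<^esub>, a) \<in> H \<Longrightarrow> a = 0"
    and H_\<xi>: "\<And>x. x \<in> U \<Longrightarrow> (x, \<xi> x) \<in> H"
    using HA unfolding \<A>_def by blast+
  have total: "\<exists>a. (y, a) \<in> H" if y: "y \<in> carrier M" for y
  proof (rule ccontr)
    assume neg: "\<nexists>a. (y, a) \<in> H"
    \<comment> \<open>The graph is enlarged by the line through \<open>y\<close>, on which the new
      functional is chosen to vanish.\<close>
    define H' where "H' = {(u \<oplus>\<^bsub>M\<^esub> s t y, a) | u t a. (u, a) \<in> H}"
    have H'I: "(u \<oplus>\<^bsub>M\<^esub> s t y, a) \<in> H'" if "(u, a) \<in> H" for u t a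
      using that unfolding H'_def by blast
    have sub: "H \<subseteq> H'"
    proof safe
      fix u a assume "(u, a) \<in> H"
      then show "(u, a) \<in> H'"
        using H'I[of u a 0] H_carrier s_zero[OF y] by simp
    qed
    have "H' \<in> \<A>"
      unfolding \<A>_def
    proof (intro CollectI conjI allI impI ballI)
      show "H' \<subseteq> carrier M \<times> UNIV"
        using H_carrier y s_closed unfolding H'_def by auto
      show "(\<zero>\<^bsub>M\<^esub>, 0) \<in> H'"
        using H_zero sub by blast
      show "(x, \<xi> x) \<in> H'" if "x \<in> U" for x
        using H_\<xi> sub that by blast
    next
      fix x1 a1 x2 a2 assume "(x1, a1) \<in> H' \<and> (x2, a2) \<in> H'"
      then obtain u1 t1 u2 t2 where *: "x1 = u1 \<oplus>\<^bsub>M\<^esub> s t1 y" "(u1, a1) \<in> H"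
        "x2 = u2 \<oplus>\<^bsub>M\<^esub> s t2 y" "(u2, a2) \<in> H"
        unfolding H'_def by blast
      have "x1 \<oplus>\<^bsub>M\<^esub> x2 = (u1 \<oplus>\<^bsub>M\<^esub> u2) \<oplus>\<^bsub>M\<^esub> s (t1 + t2) y"
        using H_carrier[OF *(2)] H_carrier[OF *(4)] y s_closed[OF y]
        by (simp add: * s_add M.a_ac)
      then show "(x1 \<oplus>\<^bsub>M\<^esub> x2, a1 + a2) \<in> H'"
        using H'I[OF H_add[OF *(2,4)]] by simp
    next
      fix c x a assume "(x, a) \<in> H'"
      then obtain u t where *: "x = u \<oplus>\<^bsub>M\<^esub> s t y" "(u, a) \<in> H"
        unfolding H'_def by blast
      have "s c x = s c u \<oplus>\<^bsub>M\<^esub> s (c * t) y"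
        using H_carrier[OF *(2)] y s_closed by (simp add: * s_plus s_mult)
      then show "(s c x, c * a) \<in> H'"
        using H'I[OF H_s[OF *(2)]] by simp
    next
      fix a assume "(\<zero>\<^bsub>M\<^esub>, a) \<in> H'"
      then obtain u t where *: "\<zero>\<^bsub>M\<^esub> = u \<oplus>\<^bsub>M\<^esub> s t y" "(u, a) \<in> H"
        unfolding H'_def by blast
      have u: "u \<in> carrier M"
        using H_carrier *(2) by blast
      show "a = 0"
      proof (cases "t = 0")
        case True
        then have "u = \<zero>\<^bsub>M\<^esub>"
          using * u s_zero[OF y] by simp
        then show ?thesis
          using * H_unique by simp
      next
        case False
        \<comment> \<open>For nonzero \<open>t\<close> the vector \<open>y\<close> is a multiple of
          \<open>u\<close> and lies in the domain of \<open>H\<close> already, against its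
          choice.\<close>
        have "y = s (- 1 / t) u"
        proof -
          have "s (1 / t) (u \<oplus>\<^bsub>M\<^esub> s t y) = s (1 / t) \<zero>\<^bsub>M\<^esub>"
            using * by simp
          then have "s (1 / t) u \<oplus>\<^bsub>M\<^esub> y = \<zero>\<^bsub>M\<^esub>"
            using False u y s_closed by (simp add: s_plus s_mult s_one) (simp add: s_def)
          moreover have "s (1 / t) u \<oplus>\<^bsub>M\<^esub> s (- 1 / t) u = \<zero>\<^bsub>M\<^esub>"
            using s_add[OF u, of "1 / t" "- 1 / t"] s_zero[OF u] by simp
          ultimately show ?thesis
            using u y s_closed[OF u] M.add.right_cancel by (metis M.a_comm)
        qed
        then show ?thesis
          using neg H_s[OF *(2)] by blast
      qed
    qed
    then have "H' = H"
      using max sub by blast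
    moreover have "(\<zero>\<^bsub>M\<^esub> \<oplus>\<^bsub>M\<^esub> s 1 y, 0) \<in> H'"
      by (rule H'I) (rule H_zero)
    ultimately show False
      using neg y s_one by simp
  qed
  \<comment> \<open>The difference of two values at \<open>x\<close> is a value at zero.\<close>
  have unique: "a = b" if "(x, a) \<in> H" "(x, b) \<in> H" for x a b
  proof -
    have x: "x \<in> carrier M"
      using H_carrier that by blast
    have "(x \<oplus>\<^bsub>M\<^esub> s (- 1) x, a + - 1 * b) \<in> H"
      using that H_add H_s by blast
    moreover have "x \<oplus>\<^bsub>M\<^esub> s (- 1) x = \<zero>\<^bsub>M\<^esub>"
      using s_add[OF x, of 1 "- 1"] s_zero[OF x] s_one[OF x] by simp
    ultimately show ?thesis
      using H_unique[of "a + - 1 * b"] by simp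
  qed
  define \<eta> where "\<eta> x = (THE a. (x, a) \<in> H)" for x
  have \<eta>_eq: "\<eta> x = a" if "(x, a) \<in> H" for x a
    unfolding \<eta>_def using that unique by blast
  have graph: "(x, \<eta> x) \<in> H" if "x \<in> carrier M" for x
    using total[OF that] \<eta>_eq by auto
  have "functional M (carrier M) \<eta>"
    unfolding functional_def
    using graph H_add[THEN \<eta>_eq] H_s[THEN \<eta>_eq] by (simp add: s_def)
  moreover have "\<eta> x = \<xi> x" if "x \<in> U" for x
    using H_\<xi>[OF that] by (rule \<eta>_eq)
  ultimately show thesis
    by (rule that)
qed

end

text \<open>The position \<open>s\<close> stands for the path \<open>pth s\<close> from its vertex to the vertex \<open>v\<close> of \<open>i0\<close>; the
  assumptions say that these are all paths ending at \<open>v\<close> that are nonzero in \<open>kQ/I\<close>. So the walk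
  module is the dual of the projective left module of \<open>v\<close>.\<close>

locale injective_walk = bound_walk Q I Z "(*)" "{1}" W
  for Q :: "('v, 'e) quiver" and I :: "(('v, 'e) qpath \<Rightarrow> 'k::field) set" and Z
    and W :: "('v, 'e, 'k) walk" +
  fixes i0 :: nat and pth :: "nat \<Rightarrow> 'e list"
  assumes letter_id: "j \<in> letters W \<Longrightarrow> letter_map W j x = x"
    and i0: "i0 \<in> positions W"
    and pth_i0: "pth i0 = []"
    and pth_letter: "j \<in> letters W \<Longrightarrow>
      pth (letter_source W j) = letter_arrow W j # pth (letter_target W j)"
    and ex_letter: "s \<in> positions W \<Longrightarrow> s \<noteq> i0 \<Longrightarrow> \<exists>j \<in> letters W. letter_source W j = s"
    and complete: "s \<in> positions W \<Longrightarrow> \<alpha> \<in> arrs Q \<Longrightarrow> tgt Q \<alpha> = vertex_at W s \<Longrightarrow>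
      (\<exists>j \<in> letters W. letter_target W j = s \<and> letter_arrow W j = \<alpha>) \<or>
      (\<exists>\<beta> es. pth s = \<beta> # es \<and> (\<alpha>, \<beta>) \<in> Z)"
begin

abbreviation path_to_i0 :: "nat \<Rightarrow> ('v, 'e) qpath \<Rightarrow> 'k" where
  "path_to_i0 s \<equiv> mon 1 (vertex_at W s, pth s)"

text \<open>Every position other than \<open>i0\<close> is the source of a letter, and the path of
  the target of this letter is shorter by one arrow.\<close>

lemma pth_induct [consumes 1, case_names base letter]:
  assumes "s \<in> positions W" "Pr i0"
    and "\<And>j. j \<in> letters W \<Longrightarrow> Pr (letter_target W j) \<Longrightarrow> Pr (letter_source W j)"
  shows "Pr s"
  using assms(1)
proof (induction "length (pth s)" arbitrary: s rule: less_induct)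
  case less
  show ?case
  proof (cases "s = i0")
    case False
    then obtain j where "j \<in> letters W" "letter_source W j = s"
      using ex_letter less.prems by blast
    then show ?thesis
      using assms(3)[of j] less.hyps[of "letter_target W j"] pth_letter[of j] letter_target by auto
  qed (use assms(2) in simp)
qed

lemma walks_pth: "s \<in> positions W \<Longrightarrow> walks_from Q (vertex_at W s) (pth s)"
proof (induction rule: pth_induct)
  case base
  show ?case
    using i0 vertex_verts by (simp add: pth_i0)
next
  case (letter j)
  then show ?case
    using letter_arrow by (simp add: pth_letter src_letter tgt_letter)
qed

text \<open>All letters act as the identity, so the path of \<open>s\<close> carries the coefficient
  at \<open>s\<close> unchanged to \<open>i0\<close>. An element is thus determined by the
  \<open>i0\<close>-coordinates of its multiples.\<close>

lemma act_path_to_i0: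
  assumes "f \<in> carrier N" "s \<in> positions W"
  shows "act N (path_to_i0 s) f i0 = f s"
proof -
  have "foldl (\<lambda>g \<alpha>. arrow_act W \<alpha> g) g (pth s) i0 = g s" for g
    using assms(2)
  proof (induction arbitrary: g rule: pth_induct)
    case (letter j)
    then show ?case
      using arrow_act_letter[OF letter(1), of g] by (simp add: pth_letter letter_id)
  qed (simp add: pth_i0)
  then show ?thesis
    using assms walks_pth by (simp add: act_N algebra_act_mon vertex_act_def)
qed

text \<open>In coordinates, the standard passage from functionals on \<open>Y\<close> to maps from
  \<open>Y\<close> into the dual of a projective left module.\<close>

definition coeffs :: "((('v, 'e) qpath \<Rightarrow> 'k) set, 'm) module \<Rightarrow> ('m \<Rightarrow> 'k) \<Rightarrow> 'm \<Rightarrow> nat \<Rightarrow> 'k" where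
  "coeffs Y \<xi> y = (\<lambda>s. if s \<in> positions W then \<xi> (act Y (path_to_i0 s) y) else 0)"

text \<open>Putting an arrow in front of the path of \<open>s\<close> gives the path of another
  position, an element of \<open>I\<close>, or zero. By \<open>complete\<close> this matches what
  the arrow does to the coefficient at \<open>s\<close> in the walk module.\<close>

lemma coeffs_hom:
  assumes Y: "right_module R Y" and \<xi>: "functional Y (carrier Y) \<xi>"
  shows "coeffs Y \<xi> \<in> module_maps R Y N"
proof (rule module_maps_mon_induct[OF Y right_module_N])
  interpret Y: bound_module Q I Z Y
    using Y by unfold_locales
  have \<xi>_add: "\<And>x y. x \<in> carrier Y \<Longrightarrow> y \<in> carrier Y \<Longrightarrow> \<xi> (x \<oplus>\<^bsub>Y\<^esub> y) = \<xi> x + \<xi> y"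
    and \<xi>_scal: "\<And>c x. x \<in> carrier Y \<Longrightarrow> \<xi> (act Y (scal c) x) = c * \<xi> x"
    using \<xi> by (auto simp: functional_def)
  have \<xi>_zero: "\<xi> \<zero>\<^bsub>Y\<^esub> = 0"
    using \<xi>_scal[of "\<zero>\<^bsub>Y\<^esub>" 0] Y.scal_act_zero by simp
  show "coeffs Y \<xi> y \<in> carrier N" for y
    by (simp add: carrier_N coeffs_def)
  show "coeffs Y \<xi> \<zero>\<^bsub>Y\<^esub> = \<zero>\<^bsub>N\<^esub>"
    by (auto simp: coeffs_def walks_pth \<xi>_zero)
  show "coeffs Y \<xi> (x \<oplus>\<^bsub>Y\<^esub> y) = coeffs Y \<xi> x \<oplus>\<^bsub>N\<^esub> coeffs Y \<xi> y"
    if "x \<in> carrier Y" "y \<in> carrier Y" for x y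
    using that by (auto simp: coeffs_def Y.act_plus \<xi>_add walks_pth)
  have closed: "coeffs Y \<xi> y \<in> carrier N" for y
    by (simp add: carrier_N coeffs_def)
  show "coeffs Y \<xi> (act Y (mon c (v, [])) y) = act N (mon c (v, [])) (coeffs Y \<xi> y)"
    if v: "v \<in> verts Q" and y: "y \<in> carrier Y" for c v y
  proof
    fix s
    have "act N (mon c (v, [])) (coeffs Y \<xi> y) s = (if vertex_at W s = v then c * coeffs Y \<xi> y s else 0)"
      using v closed by (simp add: act_N algebra_act_mon vertex_act_def)
    moreover have "\<xi> (act Y (path_to_i0 s) (act Y (mon c (v, [])) y)) =
        (if vertex_at W s = v then c * \<xi> (act Y (path_to_i0 s) y) else 0)"
      if s: "s \<in> positions W"
    proof -
      have "act Y (path_to_i0 s) (act Y (mon c (v, [])) y) =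
          act Y (mon c (v, []) \<otimes>\<^bsub>P\<^esub> path_to_i0 s) y"
        using s v y walks_pth by (simp add: Y.act_mult)
      \<comment> \<open>The coefficient is moved to the right end of the path, where it acts last
        and can be taken out of \<open>\<xi>\<close>.\<close>
      also have "mon c (v, []) \<otimes>\<^bsub>P\<^esub> path_to_i0 s =
          (if vertex_at W s = v then path_to_i0 s \<otimes>\<^bsub>P\<^esub> scal c else (\<lambda>_. 0))"
        using mon_scal[OF walks_pth[OF s], of c] by (auto simp: mon_mult)
      finally have "\<xi> (act Y (path_to_i0 s) (act Y (mon c (v, [])) y)) =
          (if vertex_at W s = v then \<xi> (act Y (path_to_i0 s \<otimes>\<^bsub>P\<^esub> scal c) y) else 0)"
        using y \<xi>_zero by simp
      moreover have "\<xi> (act Y (path_to_i0 s \<otimes>\<^bsub>P\<^esub> scal c) y) = c * \<xi> (act Y (path_to_i0 s) y)"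
        using s y walks_pth by (simp add: Y.act_mult \<xi>_scal)
      ultimately show ?thesis
        by metis
    qed
    ultimately show "coeffs Y \<xi> (act Y (mon c (v, [])) y) s = act N (mon c (v, [])) (coeffs Y \<xi> y) s"
      by (auto simp: coeffs_def)
  qed
  show "coeffs Y \<xi> (act Y (arrow \<alpha>) y) = act N (arrow \<alpha>) (coeffs Y \<xi> y)"
    if \<alpha>: "\<alpha> \<in> arrs Q" and y: "y \<in> carrier Y" for \<alpha> y
  proof
    fix s
    show "coeffs Y \<xi> (act Y (arrow \<alpha>) y) s = act N (arrow \<alpha>) (coeffs Y \<xi> y) s"
    proof (cases "s \<in> positions W")
      case False
      then show ?thesis
        using closed \<alpha> act_closed[of "arrow \<alpha>" "coeffs Y \<xi> y"] by (auto simp: carrier_N coeffs_def)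
    next
      case s: True
      have rhs: "act N (arrow \<alpha>) (coeffs Y \<xi> y) s = arrow_act W \<alpha> (coeffs Y \<xi> y) s"
        using \<alpha> closed by (simp add: act_arrow)
      have lhs: "coeffs Y \<xi> (act Y (arrow \<alpha>) y) s = \<xi> (act Y (arrow \<alpha> \<otimes>\<^bsub>P\<^esub> path_to_i0 s) y)"
        using s \<alpha> y walks_pth by (simp add: coeffs_def Y.act_mult)
      show ?thesis
      proof (cases "\<exists>j \<in> letters W. letter_target W j = s \<and> letter_arrow W j = \<alpha>")
        case True
        then obtain j where j: "j \<in> letters W" "letter_target W j = s" "letter_arrow W j = \<alpha>"
          by blast
        then have "arrow \<alpha> \<otimes>\<^bsub>P\<^esub> path_to_i0 s = path_to_i0 (letter_source W j)"
          using src_letter[of j] tgt_letter[of j] pth_letter[of j] by (auto simp: mon_mult)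
        moreover have "arrow_act W \<alpha> (coeffs Y \<xi> y) s = coeffs Y \<xi> y (letter_source W j)"
          using arrow_act_letter[OF j(1), of "coeffs Y \<xi> y"] j letter_id by simp
        ultimately show ?thesis
          using lhs rhs j letter_source by (simp add: coeffs_def)
      next
        case False
        then have "arrow_act W \<alpha> (coeffs Y \<xi> y) s = 0"
          by (intro arrow_act_none) auto
        \<comment> \<open>No letter with this arrow enters \<open>s\<close>. If
          \<open>\<alpha>\<close> ends at the vertex of \<open>s\<close>, the product begins with a
          relation; if not, the factors do not compose.\<close>
        moreover have "act Y (arrow \<alpha> \<otimes>\<^bsub>P\<^esub> path_to_i0 s) y = \<zero>\<^bsub>Y\<^esub>"
        proof (cases "tgt Q \<alpha> = vertex_at W s")
          case True
          then obtain \<beta> es where \<beta>: "pth s = \<beta> # es" "(\<alpha>, \<beta>) \<in> Z"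
            using complete[OF s \<alpha> True] False by blast
          have wes: "walks_from Q (tgt Q \<beta>) es" and "\<beta> \<in> arrs Q"
            using walks_pth[OF s] \<beta> by auto
          have "arrow \<alpha> \<otimes>\<^bsub>P\<^esub> path_to_i0 s = comp2 Q \<alpha> \<beta> \<otimes>\<^bsub>P\<^esub> mon 1 (tgt Q \<beta>, es)"
            using True \<beta> by (simp add: mon_mult path_elem_mon)
          moreover have "comp2 Q \<alpha> \<beta> \<in> I"
          proof -
            have "comp2 Q a b \<in> carrier P" if "(a, b) \<in> Z" for a b
              using relations that by (auto simp: path_elem_mon arrow_vertices)
            then have "(\<lambda>(\<alpha>, \<beta>). comp2 Q \<alpha> \<beta>) ` Z \<subseteq> genideal P ((\<lambda>(\<alpha>, \<beta>). comp2 Q \<alpha> \<beta>) ` Z)"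
              by (intro genideal_self) auto
            then show ?thesis
              using \<beta>(2) generated by auto
          qed
          ultimately have "arrow \<alpha> \<otimes>\<^bsub>P\<^esub> path_to_i0 s \<in> I"
            using I_r_closed wes by simp
          then show ?thesis
            using Y.act_I y by blast
        next
          case False
          then show ?thesis
            using y by (simp add: mon_mult)
        qed
        ultimately show ?thesis
          using lhs rhs \<xi>_zero by simp
      qed
    qed
  qed
qed

text \<open>The \<open>i0\<close>-coordinate of \<open>g\<close>, transported to the image of
  \<open>f\<close>, extends to a functional on \<open>Y\<close>. The map with its coefficients
  restricts to \<open>g\<close>, because the coefficient at \<open>s\<close> is the
  \<open>i0\<close>-coordinate after acting by the path of \<open>s\<close>.\<close>

lemma injective_N: "injective_module TYPE('x) TYPE('y) R N"
proof -
  have "\<exists>h \<in> module_maps R Y N. \<forall>x \<in> carrier X. h (f x) = g x"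
    if f: "f \<in> module_maps R X Y" and g: "g \<in> module_maps R X N"
      and X: "right_module R X" and Y: "right_module R Y" and inj: "inj_on f (carrier X)"
    for X :: "((('v, 'e) qpath \<Rightarrow> 'k) set, 'x) module"
      and Y :: "((('v, 'e) qpath \<Rightarrow> 'k) set, 'y) module" and f g
  proof -
    interpret X: bound_module Q I Z X
      using X by unfold_locales
    interpret Y: bound_module Q I Z Y
      using Y by unfold_locales
    let ?U = "f ` carrier X"
    define \<xi> where "\<xi> u = g (inv_into (carrier X) f u) i0" for u
    have \<xi>_f: "\<xi> (f x) = g x i0" if "x \<in> carrier X" for x
      using that inj by (simp add: \<xi>_def)
    have f_add: "f x \<oplus>\<^bsub>Y\<^esub> f y = f (x \<oplus>\<^bsub>X\<^esub> y)" if "x \<in> carrier X" "y \<in> carrier X" for x y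
      using f that by (simp add: module_maps_def)
    have g_add: "g (x \<oplus>\<^bsub>X\<^esub> y) = (\<lambda>i. g x i + g y i)" if "x \<in> carrier X" "y \<in> carrier X" for x y
      using g that by (simp add: module_maps_def)
    have f_act: "act Y a (f x) = f (act X a x)" if "a \<in> carrier P" "x \<in> carrier X" for a x
      using module_maps_act[OF f that] by simp
    have g_act: "g (act X a x) = act N a (g x)" if "a \<in> carrier P" "x \<in> carrier X" for a x
      using module_maps_act[OF g that] by simp
    have g_closed: "g x \<in> carrier N" if "x \<in> carrier X" for x
      using g that by (auto simp: module_maps_def)
    have "f \<zero>\<^bsub>X\<^esub> = \<zero>\<^bsub>Y\<^esub>"
      using f_act[of "\<lambda>_. 0" "\<zero>\<^bsub>X\<^esub>"] zero_closed f by (simp add: path_algebra_zero module_maps_def Pi_iff)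
    then have "\<zero>\<^bsub>Y\<^esub> \<in> ?U"
      by (metis X.M.zero_closed imageI)
    moreover have "a \<odot>\<^bsub>Y\<^esub> y \<in> ?U" if ay: "a \<in> carrier R" "y \<in> ?U" for a y
    proof -
      obtain b x where b: "b \<in> carrier P" "a = I +>\<^bsub>P\<^esub> b" "x \<in> carrier X" "y = f x"
        using ay unfolding carrier_R by blast
      then have "a \<odot>\<^bsub>Y\<^esub> y = f (act X b x)"
        using f_act[of b x] by (simp add: lact_def)
      then show ?thesis
        using b by simp
    qed
    ultimately have U: "right_submodule R ?U Y"
      using f by (auto simp: right_submodule_def f_add module_maps_def)
    have "functional Y ?U \<xi>"
      unfolding functional_def
      by (auto simp: f_add f_act \<xi>_f g_add g_act act_N algebra_act_scal g_closed)
    then obtain \<eta> where \<eta>: "functional Y (carrier Y) \<eta>" "\<And>u. u \<in> ?U \<Longrightarrow> \<eta> u = \<xi> u"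
      using Y.functional_extension[OF U] by blast
    have "coeffs Y \<eta> (f x) = g x" if x: "x \<in> carrier X" for x
    proof
      fix s
      show "coeffs Y \<eta> (f x) s = g x s"
      proof (cases "s \<in> positions W")
        case True
        then have "coeffs Y \<eta> (f x) s = \<eta> (f (act X (path_to_i0 s) x))"
          using x walks_pth by (simp add: coeffs_def f_act)
        also have "\<dots> = act N (path_to_i0 s) (g x) i0"
          using x True walks_pth \<eta>(2) by (simp add: \<xi>_f g_act)
        also have "\<dots> = g x s"
          using act_path_to_i0 g_closed x True by blast
        finally show ?thesis .
      next
        case False
        then show ?thesis
          using g_closed[OF x] by (simp add: coeffs_def carrier_N)
      qed
    qed
    then show ?thesis
      using coeffs_hom[OF Y \<eta>(1)] by blast
  qed
  then show ?thesis
    unfolding injective_module_def using fg_module_N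
    by (auto simp: fg_module_def[of R "_ :: (_, 'x) module"] fg_module_def[of R "_ :: (_, 'y) module"])
qed

text \<open>The path of the source of a letter is nonempty while \<open>pth i0\<close> is empty, so
  no letter leaves \<open>i0\<close>; by \<open>ex_letter\<close> some letter leaves every other
  position.\<close>

lemma socle_injective_walk: "socle N = {f. \<forall>i. i \<noteq> i0 \<longrightarrow> f i = 0}"
proof -
  have "\<forall>j \<in> letters W. letter_source W j \<noteq> i0"
    using pth_letter pth_i0 by force
  then show ?thesis
    unfolding socle_N using i0 ex_letter by (auto simp: carrier_N) metis+
qed

end

context bound_quiver
begin

text \<open>The two socle conditions serve the two halves of the definition: the first removes the
  kernel, the second makes every nonzero submodule of \<open>E\<close> meet the image.\<close>

lemma injective_envelopeI:
  assumes M: "fg_module R M" and E: "injective_module TYPE('x) TYPE('y) R E"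
    and \<iota>: "\<iota> \<in> module_maps R M E"
    and socle_inj: "\<And>x. x \<in> socle M \<Longrightarrow> \<iota> x = \<zero>\<^bsub>E\<^esub> \<Longrightarrow> x = \<zero>\<^bsub>M\<^esub>"
    and socle_surj: "socle E \<subseteq> \<iota> ` carrier M"
  shows "injective_envelope TYPE('x) TYPE('y) R M E \<iota>"
proof -
  interpret M: bound_module Q I Z M
    using M by unfold_locales (simp add: fg_module_def)
  interpret E: bound_module Q I Z E
    using E by unfold_locales (simp add: injective_module_def fg_module_def)
  have \<iota>_add: "\<iota> (x \<oplus>\<^bsub>M\<^esub> y) = \<iota> x \<oplus>\<^bsub>E\<^esub> \<iota> y" if "x \<in> carrier M" "y \<in> carrier M" for x y
    using \<iota> that by (simp add: module_maps_def)
  have \<iota>_closed: "\<iota> x \<in> carrier E" if "x \<in> carrier M" for x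
    using \<iota> that by (auto simp: module_maps_def)
  have kernel: "x = \<zero>\<^bsub>M\<^esub>" if x: "x \<in> carrier M" "\<iota> x = \<zero>\<^bsub>E\<^esub>" for x
  proof (rule ccontr)
    assume "x \<noteq> \<zero>\<^bsub>M\<^esub>"
    then obtain a where a: "a \<in> carrier P" "act M a x \<in> socle M" "act M a x \<noteq> \<zero>\<^bsub>M\<^esub>"
      using M.act_into_socle x(1) by blast
    have "\<iota> (act M a x) = \<zero>\<^bsub>E\<^esub>"
      using module_maps_act[OF \<iota> a(1) x(1)] x(2) a(1) by simp
    then show False
      using socle_inj a by blast
  qed
  have "inj_on \<iota> (carrier M)"
  proof (rule inj_onI)
    fix x y assume xy: "x \<in> carrier M" "y \<in> carrier M" "\<iota> x = \<iota> y"
    let ?d = "\<ominus>\<^bsub>M\<^esub> y"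
    have "\<iota> (y \<oplus>\<^bsub>M\<^esub> ?d) = \<iota> (x \<oplus>\<^bsub>M\<^esub> ?d)"
      using xy by (simp add: \<iota>_add)
    moreover have "\<iota> \<zero>\<^bsub>M\<^esub> = \<zero>\<^bsub>E\<^esub>"
      using \<iota>_add[of "\<zero>\<^bsub>M\<^esub>" "\<zero>\<^bsub>M\<^esub>"] \<iota>_closed[of "\<zero>\<^bsub>M\<^esub>"]
        E.M.add.l_cancel_one[of "\<iota> \<zero>\<^bsub>M\<^esub>" "\<iota> \<zero>\<^bsub>M\<^esub>"] by simp
    ultimately have "x \<oplus>\<^bsub>M\<^esub> ?d = \<zero>\<^bsub>M\<^esub>"
      using xy by (intro kernel) (simp_all add: M.M.r_neg)
    then have "x \<oplus>\<^bsub>M\<^esub> ?d = y \<oplus>\<^bsub>M\<^esub> ?d"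
      using xy by (simp add: M.M.r_neg)
    then show "x = y"
      using xy by simp
  qed
  moreover have "S = {\<zero>\<^bsub>E\<^esub>}"
    if S: "right_submodule R S E" and disjoint: "S \<inter> \<iota> ` carrier M = {\<zero>\<^bsub>E\<^esub>}" for S
  proof (rule ccontr)
    assume "S \<noteq> {\<zero>\<^bsub>E\<^esub>}"
    then obtain z where z: "z \<in> S" "z \<noteq> \<zero>\<^bsub>E\<^esub>" "z \<in> carrier E"
      using S by (auto simp: right_submodule_def)
    then obtain a where a: "a \<in> carrier P" "act E a z \<in> socle E" "act E a z \<noteq> \<zero>\<^bsub>E\<^esub>"
      using E.act_into_socle by blast
    then have "act E a z \<in> S"
      using S z by (auto simp: right_submodule_def lact_def carrier_R)
    then show False
      using a socle_surj disjoint by blast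
  qed
  ultimately show ?thesis
    unfolding injective_envelope_def using assms by blast
qed

section \<open>Finite direct sums of modules\<close>

lemma direct_sum_simps [simp]:
  "carrier (direct_sum J N) = (\<Pi>\<^sub>E i\<in>J. carrier (N i))"
  "\<zero>\<^bsub>direct_sum J N\<^esub> = (\<lambda>i\<in>J. \<zero>\<^bsub>N i\<^esub>)"
  "x \<oplus>\<^bsub>direct_sum J N\<^esub> y = (\<lambda>i\<in>J. x i \<oplus>\<^bsub>N i\<^esub> y i)"
  "a \<odot>\<^bsub>direct_sum J N\<^esub> x = (\<lambda>i\<in>J. a \<odot>\<^bsub>N i\<^esub> x i)"
  by (simp_all add: direct_sum_def)

lemma act_direct_sum: "act (direct_sum J N) a x = (\<lambda>i\<in>J. act (N i) a (x i))"
  by (simp add: lact_def)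

lemma right_module_direct_sum:
  assumes "\<And>i. i \<in> J \<Longrightarrow> right_module R (N i)"
  shows "right_module R (direct_sum J N)"
proof -
  have ab: "abelian_group (N i)" if "i \<in> J" for i
    using assms[OF that] by (simp add: right_module_def)
  have "abelian_group (direct_sum J N)"
  proof (rule abelian_groupI)
    fix x y z assume xyz: "x \<in> carrier (direct_sum J N)" "y \<in> carrier (direct_sum J N)"
      "z \<in> carrier (direct_sum J N)"
    show "x \<oplus>\<^bsub>direct_sum J N\<^esub> y \<oplus>\<^bsub>direct_sum J N\<^esub> z = x \<oplus>\<^bsub>direct_sum J N\<^esub> (y \<oplus>\<^bsub>direct_sum J N\<^esub> z)"
      using xyz ab by (auto simp: PiE_iff fun_eq_iff abelian_monoid.a_assoc abelian_group_def)
  next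
    fix x y assume xy: "x \<in> carrier (direct_sum J N)" "y \<in> carrier (direct_sum J N)"
    show "x \<oplus>\<^bsub>direct_sum J N\<^esub> y \<in> carrier (direct_sum J N)"
      using xy ab by (auto simp: PiE_iff abelian_monoid.a_closed abelian_group_def)
    show "x \<oplus>\<^bsub>direct_sum J N\<^esub> y = y \<oplus>\<^bsub>direct_sum J N\<^esub> x"
      using xy ab by (auto simp: PiE_iff fun_eq_iff abelian_monoid.a_comm abelian_group_def)
  next
    fix x assume x: "x \<in> carrier (direct_sum J N)"
    show "\<zero>\<^bsub>direct_sum J N\<^esub> \<oplus>\<^bsub>direct_sum J N\<^esub> x = x"
      using x ab
      by (auto simp: PiE_iff fun_eq_iff extensional_def abelian_monoid.l_zero abelian_group_def)
    show "\<exists>y\<in>carrier (direct_sum J N). y \<oplus>\<^bsub>direct_sum J N\<^esub> x = \<zero>\<^bsub>direct_sum J N\<^esub>"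
      using x ab
      by (intro bexI[of _ "\<lambda>i\<in>J. \<ominus>\<^bsub>N i\<^esub> x i"])
        (auto simp: PiE_iff fun_eq_iff abelian_group.l_neg abelian_group.a_inv_closed)
  qed (use ab in \<open>auto simp: abelian_monoid.zero_closed abelian_group_def\<close>)
  moreover have "\<one>\<^bsub>R\<^esub> \<odot>\<^bsub>direct_sum J N\<^esub> x = x" if "x \<in> carrier (direct_sum J N)" for x
    using that assms by (auto simp: PiE_iff fun_eq_iff extensional_def right_module_def)
  moreover have "a \<odot>\<^bsub>direct_sum J N\<^esub> x \<in> carrier (direct_sum J N)"
    if "a \<in> carrier R" "x \<in> carrier (direct_sum J N)" for a x
    using that assms by (auto simp: PiE_iff right_module_def)
  ultimately show ?thesis
    using assms unfolding right_module_def
    by (auto simp: quotient_is_ring PiE_iff fun_eq_iff)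
qed

text \<open>A submodule containing the embedded generators contains every embedded summand.
  Finiteness of \<open>J\<close> then allows a family to be built up one coordinate at a
  time.\<close>

lemma fg_module_direct_sum:
  assumes J: "finite J" and N: "\<And>i. i \<in> J \<Longrightarrow> fg_module R (N i)"
  shows "fg_module R (direct_sum J N)"
proof -
  have rm: "right_module R (N i)" if "i \<in> J" for i
    using N[OF that] by (simp add: fg_module_def)
  have "\<forall>i \<in> J. \<exists>X. finite X \<and> X \<subseteq> carrier (N i) \<and>
      (\<forall>S. right_submodule R S (N i) \<and> X \<subseteq> S \<longrightarrow> S = carrier (N i))"
    using N by (simp add: fg_module_def)
  then obtain X where X: "\<And>i. i \<in> J \<Longrightarrow> finite (X i)" "\<And>i. i \<in> J \<Longrightarrow> X i \<subseteq> carrier (N i)"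
    "\<And>i S. i \<in> J \<Longrightarrow> right_submodule R S (N i) \<Longrightarrow> X i \<subseteq> S \<Longrightarrow> S = carrier (N i)"
    by metis
  define emb where "emb i x = (\<lambda>j\<in>J. if j = i then x else \<zero>\<^bsub>N j\<^esub>)" for i x
  let ?D = "direct_sum J N"
  let ?X = "\<Union>i\<in>J. emb i ` X i"
  have bm: "bound_module Q I Z (N i)" if "i \<in> J" for i
    using rm[OF that] by unfold_locales
  have ag: "abelian_group (N i)" if "i \<in> J" for i
    using rm[OF that] by (simp add: right_module_def)
  have zc: "\<zero>\<^bsub>N i\<^esub> \<in> carrier (N i)" if "i \<in> J" for i
    using ag[OF that] by (simp add: abelian_group_def abelian_monoid.zero_closed)
  have zl: "\<zero>\<^bsub>N i\<^esub> \<oplus>\<^bsub>N i\<^esub> x = x" "x \<oplus>\<^bsub>N i\<^esub> \<zero>\<^bsub>N i\<^esub> = x" if "i \<in> J" "x \<in> carrier (N i)" for i x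
    using ag[OF that(1)] that(2)
    by (simp_all add: abelian_group_def abelian_monoid.l_zero abelian_monoid.r_zero)
  have az: "a \<odot>\<^bsub>N i\<^esub> \<zero>\<^bsub>N i\<^esub> = \<zero>\<^bsub>N i\<^esub>" if "i \<in> J" "a \<in> carrier R" for i a
    using bound_module.act_zero[OF bm[OF that(1)]] that(2) by (auto simp: carrier_R lact_def)
  have "S = carrier ?D" if S: "right_submodule R S ?D" and XS: "?X \<subseteq> S" for S
  proof
    show "S \<subseteq> carrier ?D"
      using S by (simp add: right_submodule_def)
    have emb_S: "emb i x \<in> S" if i: "i \<in> J" and x: "x \<in> carrier (N i)" for i x
    proof -
      \<comment> \<open>Pulling \<open>S\<close> back to a single summand makes the generators of
        that summand applicable.\<close>
      let ?T = "{x \<in> carrier (N i). emb i x \<in> S}"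
      have "right_submodule R ?T (N i)"
        unfolding right_submodule_def
      proof (intro conjI ballI)
        have "emb i \<zero>\<^bsub>N i\<^esub> = \<zero>\<^bsub>?D\<^esub>"
          by (auto simp: emb_def)
        then show "\<zero>\<^bsub>N i\<^esub> \<in> ?T"
          using S i zc by (simp add: right_submodule_def)
      next
        fix x y assume xy: "x \<in> ?T" "y \<in> ?T"
        then have "emb i (x \<oplus>\<^bsub>N i\<^esub> y) = emb i x \<oplus>\<^bsub>?D\<^esub> emb i y"
          using zc zl by (auto simp: emb_def)
        moreover have "emb i x \<oplus>\<^bsub>?D\<^esub> emb i y \<in> S"
          using S xy unfolding right_submodule_def by blast
        ultimately show "x \<oplus>\<^bsub>N i\<^esub> y \<in> ?T"
          using xy ag[OF i] by (simp add: abelian_group_def abelian_monoid.a_closed)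
      next
        fix a x assume ax: "a \<in> carrier R" "x \<in> ?T"
        then have "emb i (a \<odot>\<^bsub>N i\<^esub> x) = a \<odot>\<^bsub>?D\<^esub> emb i x"
          using az by (auto simp: emb_def)
        moreover have "a \<odot>\<^bsub>?D\<^esub> emb i x \<in> S"
          using S ax unfolding right_submodule_def by blast
        ultimately show "a \<odot>\<^bsub>N i\<^esub> x \<in> ?T"
          using ax rm[OF i] by (simp add: right_module_def)
      qed auto
      moreover have "X i \<subseteq> ?T"
        using X(2)[OF i] XS i by auto
      ultimately show ?thesis
        using X(3)[OF i] x by blast
    qed
    have "x \<in> S" if "finite F" "F \<subseteq> J" "x \<in> carrier ?D" "\<And>i. i \<in> J - F \<Longrightarrow> x i = \<zero>\<^bsub>N i\<^esub>" for F x
      using that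
    proof (induction F arbitrary: x rule: finite_induct)
      case empty
      then have "x = \<zero>\<^bsub>?D\<^esub>"
        by (auto simp: fun_eq_iff PiE_iff extensional_def)
      then show ?case
        using S unfolding right_submodule_def by blast
    next
      case (insert i F)
      let ?y = "x(i := \<zero>\<^bsub>N i\<^esub>)"
      have i: "i \<in> J"
        using insert.prems by simp
      have "?y \<in> S"
        using insert.prems zc i by (intro insert.IH) (auto simp: PiE_iff extensional_def)
      moreover have "emb i (x i) \<in> S"
        using insert.prems i by (intro emb_S) (auto simp: PiE_iff)
      ultimately have "emb i (x i) \<oplus>\<^bsub>?D\<^esub> ?y \<in> S"
        using S unfolding right_submodule_def by blast
      moreover have "emb i (x i) \<oplus>\<^bsub>?D\<^esub> ?y = x"
        using insert.prems zl i by (auto simp: emb_def fun_eq_iff PiE_iff extensional_def)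
      ultimately show ?case
        by simp
    qed
    then show "carrier ?D \<subseteq> S"
      using J by blast
  qed
  moreover have "finite ?X"
    using J X(1) by simp
  moreover have "?X \<subseteq> carrier ?D"
    using X(2) zc by (fastforce simp: emb_def)
  ultimately show ?thesis
    unfolding fg_module_def using right_module_direct_sum[of J N] rm by blast
qed

lemma module_maps_direct_sum:
  assumes "\<And>i. i \<in> J \<Longrightarrow> f i \<in> module_maps R M (N i)"
  shows "(\<lambda>x. \<lambda>i\<in>J. f i x) \<in> module_maps R M (direct_sum J N)"
  using assms by (fastforce simp: module_maps_def fun_eq_iff)

lemma module_maps_component:
  assumes "f \<in> module_maps R M (direct_sum J N)" "i \<in> J"
  shows "(\<lambda>x. f x i) \<in> module_maps R M (N i)"
  using assms by (auto simp: module_maps_def)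

lemma injective_direct_sum:
  assumes J: "finite J" and N: "\<And>i. i \<in> J \<Longrightarrow> injective_module TYPE('x) TYPE('y) R (N i)"
  shows "injective_module TYPE('x) TYPE('y) R (direct_sum J N)"
proof -
  have "\<exists>h \<in> module_maps R Y (direct_sum J N). \<forall>x \<in> carrier X. h (f x) = g x"
    if f: "f \<in> module_maps R X Y" and g: "g \<in> module_maps R X (direct_sum J N)"
      and fg: "fg_module R X" "fg_module R Y" "inj_on f (carrier X)"
    for X :: "((('v, 'e) qpath \<Rightarrow> 'k) set, 'x) module"
      and Y :: "((('v, 'e) qpath \<Rightarrow> 'k) set, 'y) module" and f g
  proof -
    have "\<exists>h \<in> module_maps R Y (N i). \<forall>x \<in> carrier X. h (f x) = g x i" if "i \<in> J" for i
      using N[OF that, unfolded injective_module_def, THEN conjunct2, rule_format,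
          OF f module_maps_component[OF g that]] fg by blast
    then obtain h where h: "\<And>i. i \<in> J \<Longrightarrow> h i \<in> module_maps R Y (N i)"
      "\<And>i x. i \<in> J \<Longrightarrow> x \<in> carrier X \<Longrightarrow> h i (f x) = g x i"
      by metis
    have "(\<lambda>i\<in>J. h i (f x)) = g x" if "x \<in> carrier X" for x
    proof -
      have "g x \<in> (\<Pi>\<^sub>E i\<in>J. carrier (N i))"
        using g that by (auto simp: module_maps_def)
      then show ?thesis
        using h(2) that by (auto simp: fun_eq_iff PiE_iff extensional_def)
    qed
    then show ?thesis
      using module_maps_direct_sum[of J h Y N] h(1) by (intro bexI[of _ "\<lambda>y. \<lambda>i\<in>J. h i y"]) auto
  qed
  moreover have "fg_module R (direct_sum J N)"
    using N by (intro fg_module_direct_sum J) (simp add: injective_module_def)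
  ultimately show ?thesis
    unfolding injective_module_def by blast
qed

lemma socle_direct_sum: "x \<in> socle (direct_sum J N) \<longleftrightarrow> x \<in> (\<Pi>\<^sub>E i\<in>J. socle (N i))"
  by (auto simp: socle_def act_direct_sum PiE_iff fun_eq_iff)

end

section \<open>From functionals on a walk module to its injective envelope\<close>

lemma (in injective_walk) hom_of_functional:
  assumes Y: "right_module R Y" and \<xi>: "functional Y (carrier Y) \<xi>"
  shows "\<exists>h \<in> module_maps R Y N. \<forall>y \<in> carrier Y. h y i0 = \<xi> (act Y (mon 1 (vertex_at W i0, [])) y)"
  using coeffs_hom[OF assms] i0 pth_i0 by (intro bexI[of _ "coeffs Y \<xi>"]) (simp_all add: coeffs_def)

lemma (in bound_quiver) module_maps_socle:
  assumes M: "right_module R M" and N: "right_module R N"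
    and f: "f \<in> module_maps R M N" and x: "x \<in> socle M"
  shows "f x \<in> socle N"
proof -
  interpret M: bound_module Q I Z M
    using M by unfold_locales
  interpret N: bound_module Q I Z N
    using N by unfold_locales
  have "f \<zero>\<^bsub>M\<^esub> \<in> carrier N"
    using f by (auto simp: module_maps_def)
  moreover have "f (\<zero>\<^bsub>M\<^esub> \<oplus>\<^bsub>M\<^esub> \<zero>\<^bsub>M\<^esub>) = f \<zero>\<^bsub>M\<^esub> \<oplus>\<^bsub>N\<^esub> f \<zero>\<^bsub>M\<^esub>"
    using f M.M.zero_closed unfolding module_maps_def by blast
  ultimately have zero: "f \<zero>\<^bsub>M\<^esub> = \<zero>\<^bsub>N\<^esub>"
    using N.M.add.l_cancel_one[of "f \<zero>\<^bsub>M\<^esub>" "f \<zero>\<^bsub>M\<^esub>"] by simp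
  have xc: "x \<in> carrier M"
    using x by (simp add: socle_def)
  have "f x \<in> carrier N"
    using f xc by (auto simp: module_maps_def)
  moreover have "act N (arrow \<alpha>) (f x) = \<zero>\<^bsub>N\<^esub>" if "\<alpha> \<in> arrs Q" for \<alpha>
    using module_maps_act[OF f arrow_closed[OF that] xc] x zero that by (simp add: socle_def)
  ultimately show ?thesis
    by (simp add: socle_def)
qed

context bound_walk
begin

definition sinks :: "nat set" where
  "sinks = {i \<in> positions W. \<forall>j \<in> letters W. letter_source W j \<noteq> i}"

lemma socle_sinks: "socle N = {f. \<forall>i. i \<notin> sinks \<longrightarrow> f i = 0}"
  unfolding socle_N sinks_def by (auto simp: carrier_N)

text \<open>Common frame of the string and the band case: on the socle the component
  \<open>h i\<close> depends only on the coefficient at the sink \<open>i\<close>, through a map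
  \<open>k i\<close> that identifies the coefficient space with the socle of
  \<open>D i\<close>.\<close>

lemma injective_envelope_sinks:
  assumes D: "\<And>i. i \<in> sinks \<Longrightarrow> injective_module TYPE('x) TYPE('y) R (D i)"
    and h: "\<And>i. i \<in> sinks \<Longrightarrow> h i \<in> module_maps R N (D i)"
    and h_socle: "\<And>i y. i \<in> sinks \<Longrightarrow> y \<in> socle N \<Longrightarrow> h i y = k i (y i)"
    and k_inj: "\<And>i x. i \<in> sinks \<Longrightarrow> k i x = \<zero>\<^bsub>D i\<^esub> \<Longrightarrow> x = 0"
    and k_surj: "\<And>i. i \<in> sinks \<Longrightarrow> socle (D i) \<subseteq> range (k i)"
  shows "injective_envelope TYPE('x) TYPE('y) R N (direct_sum sinks D) (\<lambda>y. \<lambda>i\<in>sinks. h i y)"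
proof (rule injective_envelopeI)
  show "fg_module R N"
    by (rule fg_module_N)
  have "finite sinks"
    using finite_positions by (simp add: sinks_def)
  then show "injective_module TYPE('x) TYPE('y) R (direct_sum sinks D)"
    using D by (rule injective_direct_sum)
  show "(\<lambda>y. \<lambda>i\<in>sinks. h i y) \<in> module_maps R N (direct_sum sinks D)"
    using h by (rule module_maps_direct_sum)
next
  fix y assume y: "y \<in> socle N" "(\<lambda>i\<in>sinks. h i y) = \<zero>\<^bsub>direct_sum sinks D\<^esub>"
  have "y i = 0" if "i \<in> sinks" for i
    using fun_cong[OF y(2), of i] that h_socle[OF that y(1)] k_inj[OF that] by simp
  then show "y = \<zero>\<^bsub>N\<^esub>"
    using y(1) by (auto simp: socle_sinks)
next
  show "socle (direct_sum sinks D) \<subseteq> (\<lambda>y. \<lambda>i\<in>sinks. h i y) ` carrier N"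
  proof
    fix z assume z: "z \<in> socle (direct_sum sinks D)"
    then have "\<forall>i \<in> sinks. \<exists>w. z i = k i w"
      using k_surj by (fastforce simp: socle_direct_sum PiE_iff)
    then obtain w where w: "\<And>i. i \<in> sinks \<Longrightarrow> z i = k i (w i)"
      by metis
    define y where "y i = (if i \<in> sinks then w i else 0)" for i
    have y: "y \<in> socle N"
      by (simp add: socle_sinks y_def)
    have "z = (\<lambda>i\<in>sinks. h i y)"
      using z w h_socle[OF _ y] by (auto simp: socle_direct_sum PiE_iff extensional_def fun_eq_iff y_def)
    then show "z \<in> (\<lambda>y. \<lambda>i\<in>sinks. h i y) ` carrier N"
      using y by (auto simp: socle_def)
  qed
qed

lemma act_vertex_socle:
  "f \<in> carrier N \<Longrightarrow> i \<in> positions W \<Longrightarrow> act N (mon 1 (vertex_at W i, [])) f i = f i"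
  using vertex_verts by (simp add: act_N algebra_act_mon vertex_act_def)

lemma functional_coordinate:
  assumes \<mu>: "Vector_Spaces.linear scl (*) \<mu>"
  shows "functional N (carrier N) (\<lambda>f. \<mu> (f i))"
  unfolding functional_def using Vector_Spaces.linear_iff[THEN iffD1, OF \<mu>]
  by (simp add: act_N algebra_act_scal)

text \<open>A module map sends the socle into the socle, which in the target is concentrated at
  \<open>d\<close>. So on socle elements it is known from its coordinate at \<open>d\<close>, which
  is the chosen functional because the vertices of \<open>d\<close> and \<open>i\<close>
  agree.\<close>

lemma injective_walk_hom:
  assumes D: "injective_walk Q I Z D d pth" and i: "i \<in> sinks" "vertex_at D d = vertex_at W i"
    and \<mu>: "Vector_Spaces.linear scl (*) \<mu>"
  shows "\<exists>h \<in> module_maps R N (walk_module (*) D).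
    \<forall>y \<in> socle N. h y = (\<lambda>s. if s = d then \<mu> (y i) else 0)"
proof -
  interpret D: injective_walk Q I Z D d pth
    by (rule D)
  from D.hom_of_functional[OF right_module_N functional_coordinate[OF \<mu>, of i]]
  obtain h where h: "h \<in> module_maps R N D.N"
    "\<And>y. y \<in> carrier N \<Longrightarrow> h y d = \<mu> (act N (mon 1 (vertex_at W i, [])) y i)"
    using i(2) by auto
  have "h y = (\<lambda>s. if s = d then \<mu> (y i) else 0)" if y: "y \<in> socle N" for y
  proof -
    have "h y \<in> socle D.N"
      by (rule module_maps_socle[OF right_module_N D.right_module_N h(1) y])
    moreover have "h y d = \<mu> (y i)"
      using h(2)[of y] y i(1) act_vertex_socle by (simp add: socle_def sinks_def)
    ultimately show ?thesis
      by (auto simp: D.socle_injective_walk fun_eq_iff)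
  qed
  then show ?thesis
    using h(1) by blast
qed

text \<open>Each coordinate of \<open>'w\<close> with respect to the basis \<open>B\<close> gives
  one map into the injective module of the sink. Together they account for the multiplicity, which
  is the number of basis vectors.\<close>

lemma injective_envelope_band:
  assumes D: "\<And>i. i \<in> sinks \<Longrightarrow> injective_walk Q I Z (D i) (d i) (pth i)"
    and D_vertex: "\<And>i. i \<in> sinks \<Longrightarrow> vertex_at (D i) (d i) = vertex_at W i"
  shows "\<exists>\<iota>. injective_envelope TYPE('x) TYPE('y) R N
    (direct_sum sinks (\<lambda>i. direct_sum {..<V.dim UNIV} (\<lambda>_. walk_module (*) (D i)))) \<iota>"
proof -
  obtain b where b: "bij_betw b {..<V.dim UNIV} B"
    using ex_bij_betw_nat_finite[OF V.finite_Basis] by (auto simp: atLeast0LessThan)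
  let ?J = "{..<V.dim UNIV}"
  define coord where "coord t x = V.representation B x (b t)" for t x
  have coord_linear: "Vector_Spaces.linear scl (*) (coord t)" for t
    unfolding coord_def by (rule V.linear_representation[OF V.independent_Basis V.span_Basis])
  have "\<exists>h \<in> module_maps R N (walk_module (*) (D i)).
      \<forall>y \<in> socle N. h y = (\<lambda>s. if s = d i then coord t (y i) else 0)" if "i \<in> sinks" for i t
    using injective_walk_hom[OF D[OF that] that D_vertex[OF that] coord_linear] .
  then obtain h where h: "\<And>i t. i \<in> sinks \<Longrightarrow> h i t \<in> module_maps R N (walk_module (*) (D i))"
    "\<And>i t y. i \<in> sinks \<Longrightarrow> y \<in> socle N \<Longrightarrow> h i t y = (\<lambda>s. if s = d i then coord t (y i) else 0)"
    by metis
  define k where "k i x = (\<lambda>t\<in>?J. \<lambda>s. if s = d i then coord t x else 0)" for i :: nat and x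
  have "injective_envelope TYPE('x) TYPE('y) R N
      (direct_sum sinks (\<lambda>i. direct_sum ?J (\<lambda>_. walk_module (*) (D i))))
      (\<lambda>y. \<lambda>i\<in>sinks. (\<lambda>t\<in>?J. h i t y))"
  proof (rule injective_envelope_sinks[where k = k])
    fix i assume i: "i \<in> sinks"
    interpret Di: injective_walk Q I Z "D i" "d i" "pth i"
      by (rule D[OF i])
    show "injective_module TYPE('x) TYPE('y) R (direct_sum ?J (\<lambda>_. walk_module (*) (D i)))"
      by (intro injective_direct_sum Di.injective_N) simp
    show "(\<lambda>y. \<lambda>t\<in>?J. h i t y) \<in> module_maps R N (direct_sum ?J (\<lambda>_. walk_module (*) (D i)))"
      using h(1)[OF i] by (intro module_maps_direct_sum)
    show "(\<lambda>t\<in>?J. h i t y) = k i (y i)" if "y \<in> socle N" for y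
      using h(2)[OF i that] by (simp add: k_def)
    show "x = 0" if zero: "k i x = \<zero>\<^bsub>direct_sum ?J (\<lambda>_. walk_module (*) (D i))\<^esub>" for x
    proof -
      have "coord t x = 0" if "t \<in> ?J" for t
        using fun_cong[OF fun_cong[OF zero], of t "d i"] that by (simp add: k_def walk_module_def)
      then have "V.representation B x v = 0" if "v \<in> B" for v
        using b that unfolding coord_def bij_betw_def by blast
      then have "{v. V.representation B x v \<noteq> 0} = {}"
        using V.representation_ne_zero by blast
      then show ?thesis
        using V.sum_nonzero_representation_eq[OF V.independent_Basis, of x] V.span_Basis by simp
    qed
    show "socle (direct_sum ?J (\<lambda>_. walk_module (*) (D i))) \<subseteq> range (k i)"
    proof
      fix z assume z: "z \<in> socle (direct_sum ?J (\<lambda>_. walk_module (*) (D i)))"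
      \<comment> \<open>A socle element is nonzero only at \<open>d i\<close>; its values there,
        over all copies, are the coordinates of the wanted preimage.\<close>
      define x where "x = (\<Sum>t\<in>?J. scl (z t (d i)) (b t))"
      have "coord t x = z t (d i)" if t: "t \<in> ?J" for t
      proof -
        have rep: "coord t (b u) = (if u = t then 1 else 0)" if "u \<in> ?J" for u
        proof -
          have "b u \<in> B" "b u = b t \<longleftrightarrow> u = t"
            using b t that by (auto simp: bij_betw_def inj_on_def)
          then show ?thesis
            using V.representation_basis[OF V.independent_Basis, of "b u"] by (auto simp: coord_def)
        qed
        have "coord t x = (\<Sum>u\<in>?J. coord t (scl (z u (d i)) (b u)))"
          unfolding x_def using Vector_Spaces.linear_iff[THEN iffD1, OF coord_linear[of t]]
          by (intro module_hom.sum[of scl "(*)"]) (metis coord_linear Vector_Spaces.linear_def module_hom_iff_linear)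
        also have "\<dots> = (\<Sum>u\<in>?J. z u (d i) * (if u = t then 1 else 0))"
          using Vector_Spaces.linear_iff[THEN iffD1, OF coord_linear[of t]] rep
          by (intro sum.cong) auto
        also have "\<dots> = z t (d i)"
          using t by (simp add: if_distrib cong: if_cong)
        finally show ?thesis .
      qed
      moreover have "z t s = 0" if "t \<in> ?J" "s \<noteq> d i" for t s
        using z that by (auto simp: socle_direct_sum Di.socle_injective_walk PiE_iff)
      ultimately have "z = k i x"
        using z by (auto simp: k_def socle_direct_sum PiE_iff extensional_def fun_eq_iff)
      then show "z \<in> range (k i)"
        by blast
    qed
  qed
  then show ?thesis
    by blast
qed

end

text \<open>Here the coefficient space is the field and the identity serves as the functional, so
  the envelope has no inner direct sum over coordinates.\<close>

lemma (in bound_quiver) injective_envelope_string: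
  fixes W :: "('v, 'e, 'k) walk"
  assumes W: "bound_walk Q I Z (*) {1} W"
    and D: "\<And>i. i \<in> bound_walk.sinks W \<Longrightarrow> injective_walk Q I Z (D i) (d i) (pth i)"
    and D_vertex: "\<And>i. i \<in> bound_walk.sinks W \<Longrightarrow> vertex_at (D i) (d i) = vertex_at W i"
  shows "\<exists>\<iota>. injective_envelope TYPE('x) TYPE('y) R (walk_module (*) W)
    (direct_sum (bound_walk.sinks W) (\<lambda>i. walk_module (*) (D i))) \<iota>"
proof -
  interpret W: bound_walk Q I Z "(*)" "{1}" W
    by (rule W)
  have linear: "Vector_Spaces.linear (*) (*) (\<lambda>x :: 'k. x)"
    by (rule vector_space_over_itself.linear_ident)
  have "\<exists>h \<in> module_maps R W.N (walk_module (*) (D i)).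
      \<forall>y \<in> socle W.N. h y = (\<lambda>s. if s = d i then y i else 0)" if "i \<in> W.sinks" for i
    using W.injective_walk_hom[OF D[OF that] that D_vertex[OF that] linear] .
  then obtain h where h: "\<And>i. i \<in> W.sinks \<Longrightarrow> h i \<in> module_maps R W.N (walk_module (*) (D i))"
    "\<And>i y. i \<in> W.sinks \<Longrightarrow> y \<in> socle W.N \<Longrightarrow> h i y = (\<lambda>s. if s = d i then y i else 0)"
    by metis
  define k where "k i x = (\<lambda>s. if s = d i then x else 0)" for i :: nat and x :: 'k
  have "injective_envelope TYPE('x) TYPE('y) R W.N
      (direct_sum W.sinks (\<lambda>i. walk_module (*) (D i))) (\<lambda>y. \<lambda>i\<in>W.sinks. h i y)"
  proof (rule W.injective_envelope_sinks[where k = k])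
    fix i assume i: "i \<in> W.sinks"
    interpret Di: injective_walk Q I Z "D i" "d i" "pth i"
      by (rule D[OF i])
    show "injective_module TYPE('x) TYPE('y) R (walk_module (*) (D i))"
      by (rule Di.injective_N)
    show "h i \<in> module_maps R W.N (walk_module (*) (D i))"
      by (rule h(1)[OF i])
    show "h i y = k i (y i)" if "y \<in> socle W.N" for y
      using h(2)[OF i that] by (simp add: k_def)
    show "x = 0" if "k i x = \<zero>\<^bsub>walk_module (*) (D i)\<^esub>" for x
      using fun_cong[OF that, of "d i"] by (simp add: k_def)
    show "socle (walk_module (*) (D i)) \<subseteq> range (k i)"
    proof
      fix z assume "z \<in> socle (walk_module (*) (D i))"
      then have "z = k i (z (d i))"
        by (auto simp: Di.socle_injective_walk k_def)
      then show "z \<in> range (k i)"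
        by blast
    qed
  qed
  then show ?thesis
    by blast
qed

section \<open>Walks of curves on a surface\<close>

lemma prev_side_eq: "x < n \<Longrightarrow> prev_side n x = (if x = 0 then n - 1 else x - 1)"
  by (cases x) (auto simp: prev_side_def mod_add_eq[symmetric] simp flip: add_Suc)

lemma prev_side_inj: "x < n \<Longrightarrow> y < n \<Longrightarrow> prev_side n x = prev_side n y \<Longrightarrow> x = y"
  by (auto simp: prev_side_eq split: if_splits)

lemma opposite_end_simps [simp]:
  "fst (opposite_end e) = fst e" "opposite_end e \<noteq> e" "e \<noteq> opposite_end e"
  "opposite_end (opposite_end e) = e"
  by (auto simp: opposite_end_def prod_eq_iff)

lemma end_cases: "fst e = fst e' \<Longrightarrow> e = e' \<or> e = opposite_end e'"
  by (cases e; cases e') (auto simp: opposite_end_def)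

lemma sorted_wrt_tranclp_chain:
  assumes "\<And>j. a \<le> j \<Longrightarrow> Suc j < b \<Longrightarrow> r (f j) (f (Suc j))"
  shows "sorted_wrt r\<^sup>+\<^sup>+ (map f [a..<b])"
proof -
  have "r\<^sup>+\<^sup>+ (f j) (f k)" if "a \<le> j" "j < k" "k < b" for j k
    using that(2,3)
  proof (induction k)
    case (Suc k)
    then have step: "r (f k) (f (Suc k))"
      using assms that(1) by simp
    show ?case
    proof (cases "j = k")
      case False
      then show ?thesis
        using Suc step by (meson Suc_lessD less_SucE tranclp.trancl_into_trancl)
    qed (use step in blast)
  qed simp
  then show ?thesis
    by (auto simp: sorted_wrt_iff_nth_less)
qed

lemma string_walk_sels [simp]:
  "positions (string_walk X \<theta> tr) = {j. 1 \<le> j \<and> j < len tr}"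
  "vertex_at (string_walk X \<theta> tr) = crossed X tr"
  "letters (string_walk X \<theta> tr) = {j. 1 \<le> j \<and> j + 2 \<le> len tr}"
  "letter_source (string_walk X \<theta> tr) = (\<lambda>j. if on_left tr j then j else j + 1)"
  "letter_target (string_walk X \<theta> tr) = (\<lambda>j. if on_left tr j then j + 1 else j)"
  "letter_arrow (string_walk X \<theta> tr) = (\<lambda>j. \<theta> (crossing_corner tr j))"
  "letter_map (string_walk X \<theta> tr) = (\<lambda>_ x. x)"
  by (simp_all add: string_walk_def)

lemma band_walk_sels [simp]:
  "positions (band_walk X \<theta> tr l \<phi>) = {1..len tr}"
  "vertex_at (band_walk X \<theta> tr l \<phi>) = crossed X tr"
  "letters (band_walk X \<theta> tr l \<phi>) = {1..len tr}"
  "letter_source (band_walk X \<theta> tr l \<phi>) = (\<lambda>j. if on_left tr j then j else cyc_next (len tr) j)"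
  "letter_target (band_walk X \<theta> tr l \<phi>) = (\<lambda>j. if on_left tr j then cyc_next (len tr) j else j)"
  "letter_arrow (band_walk X \<theta> tr l \<phi>) = (\<lambda>j. \<theta> (crossing_corner tr j))"
  "letter_map (band_walk X \<theta> tr l \<phi>) = (\<lambda>j x. if j = l then \<phi> x else x)"
  by (simp_all add: band_walk_def)

locale surface_algebra =
  fixes Q :: "('v, 'e) quiver" and I :: "(('v, 'e) qpath \<Rightarrow> 'k::field) set"
    and X :: "('p, 'v, 'g) ribbon_surface" and \<theta> :: "'g \<times> nat \<Rightarrow> 'e"
  assumes gentle: "gentle Q I" and surface: "marked_ribbon_surface X"
    and algebra: "algebra_of_surface X Q I \<theta>"
begin

abbreviation pre :: "'g \<Rightarrow> nat \<Rightarrow> nat" where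
  "pre P x \<equiv> prev_side (sides X P) x"

text \<open>The second arrow starts at the very side where the first one ends. Equality of the arcs
  would be too weak, as an arc may lie on two sides of the polygon.\<close>

definition polygon_relations :: "('e \<times> 'e) set" where
  "polygon_relations = {(\<theta> (P, x), \<theta> (P, pre P x)) | P x.
     (P, x) \<in> corners X \<and> (P, pre P x) \<in> corners X}"

lemma corners_iff: "(P, x) \<in> corners X \<longleftrightarrow> arc_side X P x \<and> arc_side X P (pre P x)"
  by (simp add: corners_def)

lemma arc_side_less: "arc_side X P x \<Longrightarrow> x < sides X P"
  by (cases "shape X P") (auto simp: arc_side_def)

lemma side_bij: "bij_betw (\<lambda>(P, x). side X P x) {(P, x). arc_side X P x} (arcs X \<times> UNIV)"
  using surface by (simp add: marked_ribbon_surface_def polygonal_dissection_def)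

lemma side_arcs: "arc_side X P x \<Longrightarrow> fst (side X P x) \<in> arcs X"
  using bij_betwE[OF side_bij] by force

lemma side_inj:
  assumes "arc_side X P x" "arc_side X P' x'" "side X P x = side X P' x'"
  shows "P = P'" "x = x'"
  using inj_onD[OF bij_betw_imp_inj_on[OF side_bij], of "(P, x)" "(P', x')"] assms by auto

lemma \<theta>_bij: "bij_betw \<theta> (corners X) (arrs Q)"
  using algebra by (simp add: algebra_of_surface_def)

lemma \<theta>_arrs: "p \<in> corners X \<Longrightarrow> \<theta> p \<in> arrs Q"
  using bij_betwE[OF \<theta>_bij] by blast

lemma \<theta>_inj: "p \<in> corners X \<Longrightarrow> q \<in> corners X \<Longrightarrow> \<theta> p = \<theta> q \<Longrightarrow> p = q"
  using bij_betw_imp_inj_on[OF \<theta>_bij] by (auto dest: inj_onD)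

lemma src_\<theta>: "(P, x) \<in> corners X \<Longrightarrow> src Q (\<theta> (P, x)) = fst (side X P x)"
  and tgt_\<theta>: "(P, x) \<in> corners X \<Longrightarrow> tgt Q (\<theta> (P, x)) = fst (side X P (pre P x))"
  using algebra by (auto simp: algebra_of_surface_def)

lemma verts_arcs: "verts Q = arcs X"
  using algebra by (simp add: algebra_of_surface_def)

sublocale bound_quiver Q I polygon_relations
proof
  show "finite_quiver Q" "admissible_ideal Q I"
    using gentle by (simp_all add: gentle_def)
  show "polygon_relations \<subseteq> {(\<alpha>, \<beta>). \<alpha> \<in> arrs Q \<and> \<beta> \<in> arrs Q \<and> tgt Q \<alpha> = src Q \<beta>}"
    by (auto simp: polygon_relations_def \<theta>_arrs src_\<theta> tgt_\<theta>)
  have "{comp2 Q (\<theta> (P, x)) (\<theta> (P, pre P x)) | P x. (P, x) \<in> corners X \<and> (P, pre P x) \<in> corners X}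
      = ((\<lambda>(\<alpha>, \<beta>). comp2 Q \<alpha> \<beta>) ` polygon_relations :: (_ \<Rightarrow> 'k) set)"
    by (force simp: polygon_relations_def)
  then show "I = genideal (path_algebra Q) ((\<lambda>(\<alpha>, \<beta>). comp2 Q \<alpha> \<beta>) ` polygon_relations)"
    using algebra by (simp add: algebra_of_surface_def)
qed

text \<open>The part of \<open>triangle\<close> that is left without the homotopy. For a left turn
  the common vertex is the start of the entry side, so the exit side is the preceding one in the
  counterclockwise numbering.\<close>

definition turn :: "'g trace \<Rightarrow> nat \<Rightarrow> bool" where
  "turn tr j \<longleftrightarrow> arc_side X (poly tr j) (entry tr j) \<and> arc_side X (poly tr j) (exit_side tr j) \<and>
     (if on_left tr j then exit_side tr j = pre (poly tr j) (entry tr j)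
      else entry tr j = pre (poly tr j) (exit_side tr j))"

text \<open>The banks of an arc are labelled by the two directions, so passing to the other bank is
  \<open>opposite_end\<close>.\<close>

definition cross :: "'g trace \<Rightarrow> nat \<Rightarrow> nat \<Rightarrow> bool" where
  "cross tr j j' \<longleftrightarrow> arc_side X (poly tr j) (exit_side tr j) \<and> arc_side X (poly tr j') (entry tr j') \<and>
     side X (poly tr j) (exit_side tr j) = opposite_end (left_end X tr j')"

lemma triangle_turn:
  "triangle X (poly tr j) (entry tr j) (exit_side tr j) (on_left tr j) \<sigma> \<Longrightarrow> turn tr j"
  by (auto simp: triangle_def turn_def Let_def split: if_splits)

lemma crossing_cross:
  "crossing X (poly tr j) (exit_side tr j) \<sigma> (poly tr j') (entry tr j') \<sigma>' \<Longrightarrow> cross tr j j'"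
  by (auto simp: crossing_def cross_def left_end_def opposite_end_def prod_eq_iff)

lemma turn_corner: "turn tr j \<Longrightarrow> crossing_corner tr j \<in> corners X"
  by (auto simp: turn_def crossing_corner_def corners_iff)

lemma crossed_left_end: "crossed X tr j = fst (left_end X tr j)"
  by (simp add: crossed_def left_end_def)

text \<open>A side is never the opposite bank of itself, since the directions differ. This is what
  prevents a curve from backtracking.\<close>

lemma cross_irrefl:
  assumes "cross tr j j'" "poly tr j = poly tr j'" "exit_side tr j = entry tr j'"
  shows False
  using assms by (simp add: cross_def left_end_def)

text \<open>\<open>nxt\<close> is the successor for strings and the cyclic successor for bands. A
  repeated arrow into one position, or a polygon relation between successive letters, would force
  the curve to leave and enter through one and the same side.\<close>

lemma bound_walk_trace:
  fixes scl :: "'k \<Rightarrow> 'w \<Rightarrow> 'w::ab_group_add" and W :: "('v, 'e, 'w) walk"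
  assumes fd: "finite_dimensional_vector_space scl B"
    and W: "finite (positions W)" "finite (letters W)" "vertex_at W = crossed X tr"
      "letter_source W = (\<lambda>j. if on_left tr j then j else nxt j)"
      "letter_target W = (\<lambda>j. if on_left tr j then nxt j else j)"
      "letter_arrow W = (\<lambda>j. \<theta> (crossing_corner tr j))"
    and maps: "\<And>j. j \<in> letters W \<Longrightarrow> Vector_Spaces.linear scl scl (letter_map W j)"
      "\<And>j x. j \<in> letters W \<Longrightarrow> letter_map W j x = 0 \<Longrightarrow> x = 0"
    and pos: "\<And>j. j \<in> positions W \<Longrightarrow> arc_side X (poly tr j) (entry tr j)"
    and let_pos: "\<And>j. j \<in> letters W \<Longrightarrow> j \<in> positions W \<and> nxt j \<in> positions W"
    and let_turn: "\<And>j. j \<in> letters W \<Longrightarrow> turn tr j"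
    and let_cross: "\<And>j. j \<in> letters W \<Longrightarrow> cross tr j (nxt j)"
    and nxt_inj: "inj_on nxt (letters W)"
  shows "bound_walk Q I polygon_relations scl B W"
proof -
  interpret V: finite_dimensional_vector_space scl B
    by (rule fd)
  have corner: "crossing_corner tr j \<in> corners X" if "j \<in> letters W" for j
    using turn_corner let_turn that by blast
  have left: "crossing_corner tr j = (poly tr j, entry tr j)"
    "exit_side tr j = pre (poly tr j) (entry tr j)" if "j \<in> letters W" "on_left tr j" for j
    using let_turn[OF that(1)] that(2) by (auto simp: turn_def crossing_corner_def)
  have right: "crossing_corner tr j = (poly tr j, exit_side tr j)"
    "entry tr j = pre (poly tr j) (exit_side tr j)" if "j \<in> letters W" "\<not> on_left tr j" for j
    using let_turn[OF that(1)] that(2) by (auto simp: turn_def crossing_corner_def)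
  have exit: "fst (side X (poly tr j) (exit_side tr j)) = crossed X tr (nxt j)" if "j \<in> letters W" for j
    using let_cross[OF that] by (simp add: cross_def crossed_left_end)
  have entry: "fst (side X (poly tr j) (entry tr j)) = crossed X tr j" for j
    by (simp add: crossed_def)
  show ?thesis
  proof (intro bound_walk.intro bound_walk_axioms.intro)
    show "bound_quiver Q I polygon_relations" "finite_dimensional_vector_space scl B"
      by (rule bound_quiver_axioms, rule fd)
    show "vertex_at W i \<in> verts Q" if "i \<in> positions W" for i
      using pos[OF that] side_arcs by (simp add: W verts_arcs crossed_def)
  next
    fix j assume j: "j \<in> letters W"
    show "letter_source W j \<in> positions W" "letter_target W j \<in> positions W"
      using let_pos[OF j] by (simp_all add: W)
    show "letter_arrow W j \<in> arrs Q"
      using corner[OF j] by (simp add: W \<theta>_arrs)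
    show "src Q (letter_arrow W j) = vertex_at W (letter_source W j)"
      using corner[OF j] left(1)[OF j] right(1)[OF j] exit[OF j] entry[of j]
      by (cases "on_left tr j") (simp_all add: W src_\<theta>)
    show "tgt Q (letter_arrow W j) = vertex_at W (letter_target W j)"
    proof (cases "on_left tr j")
      case True
      then show ?thesis
        using corner[OF j] left(1)[OF j True] exit[OF j] by (simp add: W tgt_\<theta> flip: left(2)[OF j True])
    next
      case False
      then show ?thesis
        using corner[OF j] right(1)[OF j False] entry[of j]
        by (simp add: W tgt_\<theta> flip: right(2)[OF j False])
    qed
  next
    fix j j' assume j: "j \<in> letters W" "j' \<in> letters W" "letter_target W j = letter_target W j'"
      "letter_arrow W j = letter_arrow W j'"
    then have eq: "crossing_corner tr j = crossing_corner tr j'"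
      using \<theta>_inj corner by (simp add: W)
    \<comment> \<open>If a left turn is followed by a right turn at the same corner, the exit side
      of the first is the entry side of the second.\<close>
    have mixed: False if "i \<in> letters W" "i' \<in> letters W" "on_left tr i" "\<not> on_left tr i'"
      "crossing_corner tr i = crossing_corner tr i'" "nxt i = i'" for i i'
    proof (rule cross_irrefl)
      show "cross tr i i'"
        using let_cross[OF that(1)] that(6) by simp
      show p: "poly tr i = poly tr i'"
        using that(5) left(1)[OF that(1,3)] right(1)[OF that(2,4)] by simp
      have "entry tr i = exit_side tr i'"
        using that(5) left(1)[OF that(1,3)] right(1)[OF that(2,4)] by simp
      then show "exit_side tr i = entry tr i'"
        using p left(2)[OF that(1,3)] right(2)[OF that(2,4)] by metis
    qed
    show "j = j'"
    proof (cases "on_left tr j"; cases "on_left tr j'")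
      assume "on_left tr j" "on_left tr j'"
      then show ?thesis
        using j(1-3) inj_onD[OF nxt_inj, of j j'] by (simp add: W)
    next
      assume l: "on_left tr j" "\<not> on_left tr j'"
      then have "nxt j = j'"
        using j(3) by (simp add: W)
      then show ?thesis
        using mixed[OF j(1,2) l eq] by blast
    next
      assume l: "\<not> on_left tr j" "on_left tr j'"
      then have "nxt j' = j"
        using j(3) by (simp add: W)
      then show ?thesis
        using mixed[OF j(2,1) l(2,1) eq[symmetric]] by blast
    next
      assume "\<not> on_left tr j" "\<not> on_left tr j'"
      then show ?thesis
        using j(3) by (simp add: W)
    qed
  next
    fix j j' assume j: "j \<in> letters W" "j' \<in> letters W" "letter_target W j = letter_source W j'"
    show "(letter_arrow W j, letter_arrow W j') \<notin> polygon_relations"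
    proof
      assume "(letter_arrow W j, letter_arrow W j') \<in> polygon_relations"
      then obtain P x where "\<theta> (crossing_corner tr j) = \<theta> (P, x)" "(P, x) \<in> corners X"
        "\<theta> (crossing_corner tr j') = \<theta> (P, pre P x)" "(P, pre P x) \<in> corners X"
        by (auto simp: polygon_relations_def W)
      then have c: "crossing_corner tr j = (P, x)" "crossing_corner tr j' = (P, pre P x)"
        using \<theta>_inj corner j by metis+
      \<comment> \<open>Turns in the same direction would mean crossing from a side to itself; turns
        in opposite directions would force \<open>j = j'\<close>.\<close>
      consider "on_left tr j" "on_left tr j'" | "on_left tr j" "\<not> on_left tr j'"
        | "\<not> on_left tr j" "on_left tr j'" | "\<not> on_left tr j" "\<not> on_left tr j'"
        by blast
      then show False
      proof cases
        case 1
        have "cross tr j j'"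
          using let_cross[OF j(1)] j(3) 1 by (simp add: W)
        moreover have "poly tr j = poly tr j'" "exit_side tr j = entry tr j'"
          using c left[OF j(1) 1(1)] left(1)[OF j(2) 1(2)] by (metis prod.inject)+
        ultimately show False
          by (rule cross_irrefl)
      next
        case 2
        then show False
          using j nxt_inj by (auto simp: W inj_on_def)
      next
        case 3
        then show False
          using j by (auto simp: W)
      next
        case 4
        have "cross tr j' j"
          using let_cross[OF j(2)] j(3) 4 by (simp add: W)
        moreover have "poly tr j' = poly tr j" "exit_side tr j' = entry tr j"
          using c right[OF j(1) 4(1)] right(1)[OF j(2) 4(2)] by (metis prod.inject)+
        ultimately show False
          by (rule cross_irrefl)
      qed
    qed
  qed (use W maps in auto)
qed

text \<open>Segment \<open>j\<close> lies between the crossings \<open>j\<close> and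
  \<open>j + 1\<close>. The triangle condition concerns the inner segments, so turns are indexed
  from 1 to \<open>len tr - 2\<close>.\<close>

lemma string_trace:
  assumes "permissible_curve X c tr"
  shows "\<And>j. 1 \<le> j \<Longrightarrow> j < len tr \<Longrightarrow> cross tr (j - 1) j"
    and "\<And>j. 1 \<le> j \<Longrightarrow> j + 2 \<le> len tr \<Longrightarrow> turn tr j"
proof -
  from assms obtain \<sigma> where
    "\<And>j. 1 \<le> j \<Longrightarrow> j < len tr \<Longrightarrow> crossing X (poly tr (j - 1)) (exit_side tr (j - 1)) (\<sigma> (j - 1))
       (poly tr j) (entry tr j) (\<sigma> j)"
    "\<And>j. 1 \<le> j \<Longrightarrow> j + 2 \<le> len tr \<Longrightarrow>
       triangle X (poly tr j) (entry tr j) (exit_side tr j) (on_left tr j) (\<sigma> j)"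
    unfolding permissible_curve_def Let_def by blast
  then show "\<And>j. 1 \<le> j \<Longrightarrow> j < len tr \<Longrightarrow> cross tr (j - 1) j"
    "\<And>j. 1 \<le> j \<Longrightarrow> j + 2 \<le> len tr \<Longrightarrow> turn tr j"
    using crossing_cross triangle_turn by blast+
qed

lemma band_trace:
  assumes "permissible_closed_curve X c tr" "j \<in> {1..len tr}"
  shows "cross tr (cyc_prev (len tr) j) j" "turn tr j"
proof -
  from assms obtain \<sigma> where
    "crossing X (poly tr (cyc_prev (len tr) j)) (exit_side tr (cyc_prev (len tr) j))
       (\<sigma> (cyc_prev (len tr) j)) (poly tr j) (entry tr j) (\<sigma> j)"
    "triangle X (poly tr j) (entry tr j) (exit_side tr j) (on_left tr j) (\<sigma> j)"
    unfolding permissible_closed_curve_def Let_def by blast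
  then show "cross tr (cyc_prev (len tr) j) j" "turn tr j"
    using crossing_cross triangle_turn by blast+
qed

section \<open>Walks of the given curve and their sinks\<close>

lemma bound_walk_string:
  assumes c: "permissible_curve X c tr"
  shows "bound_walk Q I polygon_relations (*) {1} (string_walk X \<theta> tr :: ('v, 'e, 'k) walk)"
proof (rule bound_walk_trace[where tr = tr and nxt = Suc])
  show "finite_dimensional_vector_space ((*) :: 'k \<Rightarrow> 'k \<Rightarrow> 'k) {1}"
    by (rule vector_space_over_itself.finite_dimensional_vector_space_axioms)
  have "{j. 1 \<le> j \<and> j < len tr} \<subseteq> {..len tr}" "{j. 1 \<le> j \<and> j + 2 \<le> len tr} \<subseteq> {..len tr}"
    by auto
  then show "finite (positions (string_walk X \<theta> tr :: ('v, 'e, 'k) walk))"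
    "finite (letters (string_walk X \<theta> tr :: ('v, 'e, 'k) walk))"
    by (simp_all add: finite_subset[of _ "{..len tr}"])
  show "arc_side X (poly tr j) (entry tr j)"
    if "j \<in> positions (string_walk X \<theta> tr :: ('v, 'e, 'k) walk)" for j
    using string_trace(1)[OF c, of j] that by (simp add: cross_def)
  show "cross tr j (Suc j)" "turn tr j"
    if "j \<in> letters (string_walk X \<theta> tr :: ('v, 'e, 'k) walk)" for j
    using string_trace(1)[OF c, of "Suc j"] string_trace(2)[OF c, of j] that by simp_all
qed (auto simp: vector_space_over_itself.linear_ident)

lemma bound_walk_band:
  fixes scl :: "'k \<Rightarrow> 'w \<Rightarrow> 'w::ab_group_add"
  assumes c: "permissible_closed_curve X c tr"
    and fd: "finite_dimensional_vector_space scl B"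
    and \<phi>: "Vector_Spaces.linear scl scl \<phi>" "bij \<phi>"
  shows "bound_walk Q I polygon_relations scl B (band_walk X \<theta> tr l \<phi>)"
proof (rule bound_walk_trace[where tr = tr and nxt = "cyc_next (len tr)"])
  interpret V: finite_dimensional_vector_space scl B
    by (rule fd)
  show "finite_dimensional_vector_space scl B"
    by (rule fd)
  show "arc_side X (poly tr j) (entry tr j)" if "j \<in> positions (band_walk X \<theta> tr l \<phi>)" for j
    using band_trace(2)[OF c, of j] that by (simp add: turn_def)
  fix j assume j: "j \<in> letters (band_walk X \<theta> tr l \<phi>)"
  show "Vector_Spaces.linear scl scl (letter_map (band_walk X \<theta> tr l \<phi>) j)"
    using \<phi>(1) V.linear_ident by (cases "j = l") simp_all
  show "x = 0" if "letter_map (band_walk X \<theta> tr l \<phi>) j x = 0" for x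
  proof -
    have "\<phi> 0 = 0"
      using \<phi>(1) by (metis Vector_Spaces.linear_iff V.scale_zero_left)
    then show ?thesis
      using that injD[OF bij_is_inj[OF \<phi>(2)], of x 0] by (simp split: if_splits)
  qed
  show "turn tr j"
    using band_trace(2)[OF c, of j] j by simp
  have next_pos: "cyc_next (len tr) j \<in> {1..len tr}" and "cyc_prev (len tr) (cyc_next (len tr) j) = j"
    using j by (auto simp: cyc_next_def cyc_prev_def)
  then show "cross tr j (cyc_next (len tr) j)"
    using band_trace(1)[OF c, of "cyc_next (len tr) j"] by simp
  show "j \<in> positions (band_walk X \<theta> tr l \<phi>) \<and> cyc_next (len tr) j \<in> positions (band_walk X \<theta> tr l \<phi>)"
    using next_pos j by simp
qed (auto simp: inj_on_def cyc_next_def split: if_splits)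

lemma sinks_string: "bound_walk.sinks (string_walk X \<theta> tr :: ('v, 'e, 'k) walk) = string_indices tr"
  if c: "permissible_curve X c tr"
proof -
  interpret W: bound_walk Q I polygon_relations "(*)" "{1}" "string_walk X \<theta> tr :: ('v, 'e, 'k) walk"
    by (rule bound_walk_string[OF c])
  \<comment> \<open>Only the letters \<open>i - 1\<close> and \<open>i\<close> touch the position
    \<open>i\<close>. Each condition is vacuous where its letter is missing, which covers the two
    ends of the walk and the case of a single crossing.\<close>
  have "i \<in> W.sinks \<longleftrightarrow> 1 \<le> i \<and> i < len tr \<and>
      (i + 2 \<le> len tr \<longrightarrow> \<not> on_left tr i) \<and> (2 \<le> i \<longrightarrow> on_left tr (i - 1))" for i
  proof
    assume "i \<in> W.sinks"
    then have *: "1 \<le> i" "i < len tr" "\<And>j. 1 \<le> j \<Longrightarrow> j + 2 \<le> len tr \<Longrightarrow> (if on_left tr j then j else j + 1) \<noteq> i"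
      by (auto simp: W.sinks_def)
    have "\<not> on_left tr i" if "i + 2 \<le> len tr"
      using *(3)[of i] *(1) that by auto
    moreover have "on_left tr (i - 1)" if "2 \<le> i"
    proof -
      have "1 \<le> i - 1" "i - 1 + 2 \<le> len tr" "i - 1 + 1 = i"
        using *(2) that by simp_all
      then show ?thesis
        using *(3)[of "i - 1"] by metis
    qed
    ultimately show "1 \<le> i \<and> i < len tr \<and>
        (i + 2 \<le> len tr \<longrightarrow> \<not> on_left tr i) \<and> (2 \<le> i \<longrightarrow> on_left tr (i - 1))"
      using *(1,2) by blast
  next
    assume "1 \<le> i \<and> i < len tr \<and>
      (i + 2 \<le> len tr \<longrightarrow> \<not> on_left tr i) \<and> (2 \<le> i \<longrightarrow> on_left tr (i - 1))"
    then show "i \<in> W.sinks"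
      by (auto simp: W.sinks_def split: if_splits)
  qed
  moreover have "i \<in> string_indices tr \<longleftrightarrow> 1 \<le> i \<and> i < len tr \<and>
      (i + 2 \<le> len tr \<longrightarrow> \<not> on_left tr i) \<and> (2 \<le> i \<longrightarrow> on_left tr (i - 1))" for i
  proof -
    have "i = len tr - 1 \<Longrightarrow> len tr - 2 = i - 1"
      by simp
    then show ?thesis
      by (cases "i = 1"; cases "i = len tr - 1") (auto simp: string_indices_def Let_def)
  qed
  ultimately show ?thesis
    by blast
qed

lemma sinks_band:
  fixes scl :: "'k \<Rightarrow> 'w \<Rightarrow> 'w::ab_group_add"
  assumes "bound_walk Q I polygon_relations scl B (band_walk X \<theta> tr l \<phi>)"
  shows "bound_walk.sinks (band_walk X \<theta> tr l \<phi>) = band_indices tr"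
proof -
  interpret W: bound_walk Q I polygon_relations scl B "band_walk X \<theta> tr l \<phi>"
    by (rule assms)
  show ?thesis
  proof (intro equalityI subsetI)
    fix i assume "i \<in> W.sinks"
    then have i: "i \<in> {1..len tr}"
      "\<And>j. j \<in> {1..len tr} \<Longrightarrow> (if on_left tr j then j else cyc_next (len tr) j) \<noteq> i"
      by (auto simp: W.sinks_def)
    have "cyc_prev (len tr) i \<in> {1..len tr}" "cyc_next (len tr) (cyc_prev (len tr) i) = i"
      using i(1) by (auto simp: cyc_prev_def cyc_next_def)
    then show "i \<in> band_indices tr"
      using i(1) i(2)[of i] i(2)[of "cyc_prev (len tr) i"]
      by (cases "on_left tr i"; cases "on_left tr (cyc_prev (len tr) i)") (auto simp: band_indices_def)
  next
    fix i assume i: "i \<in> band_indices tr"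
    have "cyc_prev (len tr) (cyc_next (len tr) j) = j" if "j \<in> {1..len tr}" for j
      using that by (auto simp: cyc_prev_def cyc_next_def)
    then show "i \<in> W.sinks"
      using i by (fastforce simp: W.sinks_def band_indices_def)
  qed
qed

lemma polygon_relationsI:
  "(P, x) \<in> corners X \<Longrightarrow> (P, pre P x) \<in> corners X \<Longrightarrow>
     (\<theta> (P, x), \<theta> (P, pre P x)) \<in> polygon_relations" for P x
  unfolding polygon_relations_def by blast

section \<open>Fans of arc ends around a marked point\<close>

lemma chart_side:
  "arc_side X P x \<Longrightarrow> s \<in> {0..1} \<Longrightarrow> chart X P (model_side (sides X P) x s) =
     arc_path X (fst (side X P x)) (if snd (side X P x) then s else 1 - s)" for P x
proof -
  assume arc: "arc_side X P x" and s: "s \<in> {0..1}"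
  have "\<forall>P x \<gamma> d. arc_side X P x \<and> side X P x = (\<gamma>, d) \<longrightarrow>
      (\<forall>s \<in> {0..1}. chart X P (model_side (sides X P) x s) = arc_path X \<gamma> (if d then s else 1 - s))"
    using surface unfolding marked_ribbon_surface_def polygonal_dissection_def by (elim conjE) assumption
  from this[rule_format, of P x "fst (side X P x)" "snd (side X P x)" s] show ?thesis
    using arc s by simp
qed

lemma endpoint_side: "arc_side X P x \<Longrightarrow> endpoint X (side X P x) = chart X P (circ (sides X P) (real x))"
  for P x
  using chart_side[of P x 0] by (auto simp: endpoint_def model_side_def)

lemma endpoint_opposite_side:
  "arc_side X P x \<Longrightarrow> endpoint X (opposite_end (side X P x)) = chart X P (circ (sides X P) (real x + 1))"
  for P x
  using chart_side[of P x 1] by (auto simp: endpoint_def opposite_end_def model_side_def)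

text \<open>Consecutive sides share a vertex; at side 0 this is the periodicity of the
  circle.\<close>

lemma circ_prev_side:
  assumes "x < n" shows "circ n (real (prev_side n x) + 1) = circ n (real x)"
proof (cases "x = 0")
  case True
  then have "real (prev_side n x) + 1 = real n"
    using assms by (simp add: prev_side_eq of_nat_diff)
  then show ?thesis
    using True assms by (simp add: circ_def)
next
  case False
  then show ?thesis
    using assms by (simp add: prev_side_eq of_nat_diff)
qed

lemma ccw_nextI:
  "(P, x) \<in> corners X \<Longrightarrow> ccw_next X (side X P x) (opposite_end (side X P (pre P x)))" for P x
  by (auto simp: ccw_next_def)

text \<open>Side \<open>x\<close> starts, and the preceding side finishes, at vertex
  \<open>x\<close> of the polygon. The gluing of the sides carries this common vertex to the
  surface.\<close>

lemma ccw_next_props: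
  assumes "ccw_next X e e'"
  shows "fst e \<in> arcs X" "fst e' \<in> arcs X" "endpoint X e = endpoint X e'"
proof -
  obtain P x where Px: "(P, x) \<in> corners X" "e = side X P x" "e' = opposite_end (side X P (pre P x))"
    using assms by (auto simp: ccw_next_def)
  then have *: "arc_side X P x" "arc_side X P (pre P x)"
    by (simp_all add: corners_iff)
  show "fst e \<in> arcs X" "fst e' \<in> arcs X"
    using Px * side_arcs by simp_all
  show "endpoint X e = endpoint X e'"
    using Px * endpoint_side[of P x] endpoint_opposite_side[of P "pre P x"]
      circ_prev_side[OF arc_side_less[of P x]] by simp
qed

text \<open>Every step keeps the marked point. Because of \<open>a < b\<close> each index takes part
  in some step, which is how its end is seen to belong to an arc.\<close>

lemma ccw_chain:
  assumes step: "\<And>j. a \<le> j \<Longrightarrow> j < b \<Longrightarrow> ccw_next X (f j) (f (Suc j))" and "a < b"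
  shows "surround_ccw X (endpoint X (f b)) (map f [a..<Suc b])"
proof -
  have arcs: "fst (f j) \<in> arcs X" if "a \<le> j" "j \<le> b" for j
  proof (cases "j = b")
    case True
    have "Suc (b - 1) = b" "a \<le> b - 1" "b - 1 < b"
      using assms(2) by simp_all
    then have "ccw_next X (f (b - 1)) (f b)"
      using step[of "b - 1"] by metis
    then show ?thesis
      using ccw_next_props(2) True by blast
  next
    case False
    then show ?thesis
      using ccw_next_props(1)[OF step[of j]] that by simp
  qed
  have ends: "endpoint X (f j) = endpoint X (f b)" if "a \<le> j" "j \<le> b" for j
    using that(2,1)
  proof (induction j rule: inc_induct)
    case (step j)
    then show ?case
      using ccw_next_props(3)[OF assms(1)[of j]] by simp
  qed simp
  have "fst e \<in> arcs X \<and> endpoint X e = endpoint X (f b)" if e: "e \<in> set (map f [a..<Suc b])" for e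
  proof -
    obtain j where "e = f j" "a \<le> j" "j \<le> b"
      using e by auto
    then show ?thesis
      using arcs[of j] ends[of j] by blast
  qed
  moreover have "sorted_wrt (ccw_next X)\<^sup>+\<^sup>+ (map f [a..<Suc b])"
    by (rule sorted_wrt_tranclp_chain) (use step in auto)
  ultimately show ?thesis
    unfolding surround_ccw_def by blast
qed

lemma cw_chain:
  assumes step: "\<And>j. a \<le> j \<Longrightarrow> j < b \<Longrightarrow> ccw_next X (f (Suc j)) (f j)" and "a < b"
  shows "surround_cw X (endpoint X (f a)) (map f [a..<Suc b])"
proof -
  \<comment> \<open>Reflecting the index interval turns a clockwise chain into a counterclockwise
    one.\<close>
  have "rev [a..<Suc b] = map (\<lambda>j. a + b - j) [a..<Suc b]"
    using assms(2) by (intro nth_equalityI) (auto simp: rev_nth simp del: upt_Suc)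
  then have "rev (map f [a..<Suc b]) = map (\<lambda>j. f (a + b - j)) [a..<Suc b]"
    by (simp add: rev_map comp_def del: upt_Suc)
  moreover have "surround_ccw X (endpoint X (f (a + b - b))) (map (\<lambda>j. f (a + b - j)) [a..<Suc b])"
  proof (rule ccw_chain[OF _ assms(2)])
    fix j assume j: "a \<le> j" "j < b"
    then have "a + b - j = Suc (a + b - Suc j)"
      by simp
    then show "ccw_next X (f (a + b - j)) (f (a + b - Suc j))"
      using step[of "a + b - Suc j"] j by simp
  qed
  ultimately show ?thesis
    by (simp add: surround_cw_def)
qed

text \<open>The letters point towards \<open>i\<close> from both sides, so the path of a position is
  read off by walking to \<open>i\<close>. For completeness, a further arrow ending at a crossed arc
  is located by the bank at which it arrives and by the side of \<open>i\<close> on which the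
  crossing lies.\<close>

lemma injective_walk_string:
  assumes inj: "injective_permissible_curve X \<gamma> c tr"
  shows "\<exists>i pth. injective_walk Q I polygon_relations (string_walk X \<theta> tr :: ('v, 'e, 'k) walk) i pth \<and>
    crossed X tr i = \<gamma>"
proof -
  have c: "permissible_curve X c tr"
    using inj by (simp add: injective_permissible_curve_def)
  obtain i where i: "1 \<le> i" "i < len tr" "crossed X tr i = \<gamma>"
    and left: "\<And>j. 1 \<le> j \<Longrightarrow> j < i \<Longrightarrow> on_left tr j"
    and right: "\<And>j. i \<le> j \<Longrightarrow> j + 2 \<le> len tr \<Longrightarrow> \<not> on_left tr j"
    and max_left: "\<And>e. \<not> surround_ccw X (endpoint X (left_end X tr i)) (e # map (left_end X tr) [1..<Suc i])"
    and max_right: "\<And>e. \<not> surround_cw X (endpoint X (right_end X tr i))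
      (map (right_end X tr) [i..<len tr] @ [e])"
    using inj unfolding injective_permissible_curve_def Let_def by metis
  note cross = string_trace(1)[OF c] and turn = string_trace(2)[OF c]
  let ?W = "string_walk X \<theta> tr :: ('v, 'e, 'k) walk"
  interpret W: bound_walk Q I polygon_relations "(*)" "{1}" ?W
    by (rule bound_walk_string[OF c])
  let ?arr = "\<lambda>j. \<theta> (crossing_corner tr j)"
  \<comment> \<open>Letter \<open>j\<close> lies between the positions \<open>j\<close> and
    \<open>j + 1\<close>. Before \<open>i\<close> the letters from \<open>s\<close> to
    \<open>i - 1\<close> are read upwards, after \<open>i\<close> those from \<open>s - 1\<close> to
    \<open>i\<close> downwards.\<close>
  define pth where "pth s = (if s \<le> i then map ?arr [s..<i] else map ?arr (rev [i..<s]))" for s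
  have corner_left: "(poly tr j, entry tr j) \<in> corners X" "exit_side tr j = pre (poly tr j) (entry tr j)"
    "crossing_corner tr j = (poly tr j, entry tr j)" if "1 \<le> j" "j < i" for j
    using turn[of j] left[of j] that i turn_corner[of tr j] by (auto simp: turn_def crossing_corner_def)
  have corner_right: "(poly tr j, exit_side tr j) \<in> corners X" "entry tr j = pre (poly tr j) (exit_side tr j)"
    "crossing_corner tr j = (poly tr j, exit_side tr j)" if "i \<le> j" "j + 2 \<le> len tr" for j
    using turn[of j] right[of j] that i turn_corner[of tr j] by (auto simp: turn_def crossing_corner_def)
  have exit_end: "side X (poly tr j) (exit_side tr j) = opposite_end (left_end X tr (Suc j))"
    if "Suc j < len tr" for j
    using cross[of "Suc j"] that by (simp add: cross_def)
  have exit_arc: "arc_side X (poly tr j) (exit_side tr j)" if "Suc j < len tr" for j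
    using cross[of "Suc j"] that by (simp add: cross_def)
  have entry_arc: "arc_side X (poly tr j) (entry tr j)" if "1 \<le> j" "j < len tr" for j
    using cross[of j] that by (simp add: cross_def)
  \<comment> \<open>Such a corner in the first polygon would supply an arc end preceding all left
    ends counterclockwise around \<open>m\<close>; it is inserted at index 0.\<close>
  have no_corner_left: False
    if Px: "(P, x) \<in> corners X" and e: "side X P (pre P x) = side X (poly tr 0) (exit_side tr 0)" for P x
  proof -
    let ?f = "\<lambda>j. if j = 0 then side X P x else left_end X tr j"
    have "surround_ccw X (endpoint X (?f i)) (map ?f [0..<Suc i])"
    proof (rule ccw_chain)
      fix j assume j: "j < i"
      show "ccw_next X (?f j) (?f (Suc j))"
      proof (cases "j = 0")
        case True
        then show ?thesis
          using ccw_nextI[OF Px] e exit_end[of 0] i by simp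
      next
        case False
        then show ?thesis
          using ccw_nextI[OF corner_left(1)[of j]] corner_left(2)[of j] exit_end[of j] i j
          by (simp add: left_end_def)
      qed
    qed (use i in auto)
    moreover have "map ?f [0..<Suc i] = side X P x # map (left_end X tr) [1..<Suc i]"
      by (simp add: upt_conv_Cons del: upt_Suc)
    ultimately show False
      using max_left i by simp
  qed
  \<comment> \<open>The mirror image in the last polygon: the new end continues the right ends
    clockwise around \<open>m'\<close> and is inserted at index \<open>len tr\<close>.\<close>
  have no_corner_right: False
    if Px: "(P, x) \<in> corners X" and e: "side X P (pre P x) = left_end X tr (len tr - 1)" for P x
  proof -
    let ?f = "\<lambda>j. if j = len tr then side X P x else right_end X tr j"
    have "surround_cw X (endpoint X (?f i)) (map ?f [i..<Suc (len tr)])"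
    proof (rule cw_chain)
      fix j assume j: "i \<le> j" "j < len tr"
      show "ccw_next X (?f (Suc j)) (?f j)"
      proof (cases "Suc j = len tr")
        case True
        then have "len tr - 1 = j"
          by simp
        then show ?thesis
          using ccw_nextI[OF Px] e True j by (simp add: right_end_def)
      next
        case False
        then show ?thesis
          using ccw_nextI[OF corner_right(1)[of j]] corner_right(2)[of j] exit_end[of j] j
          by (simp add: right_end_def left_end_def)
      qed
    qed (use i in auto)
    moreover have "map ?f [i..<Suc (len tr)] = map (right_end X tr) [i..<len tr] @ [side X P x]"
      using i by simp
    ultimately show False
      using max_right i(2) by (simp del: upt_Suc)
  qed
  have "injective_walk Q I polygon_relations ?W i pth"
  proof
    show "i \<in> positions ?W" "pth i = []"
      using i by (simp_all add: pth_def)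
    show "letter_map ?W j x = x" for j x
      by simp
  next
    fix j assume j: "j \<in> letters ?W"
    show "pth (letter_source ?W j) = letter_arrow ?W j # pth (letter_target ?W j)"
    proof (cases "j < i")
      case True
      then show ?thesis
        using left[of j] j by (simp add: pth_def upt_conv_Cons)
    next
      case False
      then show ?thesis
        using right[of j] j by (simp add: pth_def)
    qed
  next
    fix s assume s: "s \<in> positions ?W" "s \<noteq> i"
    show "\<exists>j \<in> letters ?W. letter_source ?W j = s"
    proof (cases "s < i")
      case True
      then show ?thesis
        using left[of s] s i by (intro bexI[of _ s]) auto
    next
      case False
      then show ?thesis
        using right[of "s - 1"] s i by (intro bexI[of _ "s - 1"]) auto
    qed
  next
    fix s \<alpha> assume s: "s \<in> positions ?W" and \<alpha>: "\<alpha> \<in> arrs Q" "tgt Q \<alpha> = vertex_at ?W s"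
    obtain P x where Px: "(P, x) \<in> corners X" "\<alpha> = \<theta> (P, x)"
      using \<alpha>(1) bij_betw_imp_surj_on[OF \<theta>_bij] by fastforce
    have arc: "arc_side X P x" "arc_side X P (pre P x)"
      using Px by (simp_all add: corners_iff)
    have s': "1 \<le> s" "s < len tr"
      using s by simp_all
    have "fst (side X P (pre P x)) = fst (left_end X tr s)"
      using \<alpha>(2) Px tgt_\<theta> by (simp add: crossed_left_end)
    \<comment> \<open>The arrow ends at one of the two banks of the crossed arc: that of the segment
      after the crossing or that of the segment before it.\<close>
    then consider (entry) "side X P (pre P x) = left_end X tr s"
      | (exit) "side X P (pre P x) = side X (poly tr (s - 1)) (exit_side tr (s - 1))"
    proof -
      have "side X (poly tr (s - 1)) (exit_side tr (s - 1)) = opposite_end (left_end X tr s)"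
        using exit_end[of "s - 1"] s' by simp
      then show thesis
        using end_cases[of "side X P (pre P x)" "left_end X tr s"] that
          \<open>fst (side X P (pre P x)) = fst (left_end X tr s)\<close> by metis
    qed
    then show "(\<exists>j \<in> letters ?W. letter_target ?W j = s \<and> letter_arrow ?W j = \<alpha>) \<or>
        (\<exists>\<beta> es. pth s = \<beta> # es \<and> (\<alpha>, \<beta>) \<in> polygon_relations)"
    proof cases
      case entry
      then have P: "P = poly tr s" and x: "pre P x = entry tr s"
        using side_inj[OF arc(2) entry_arc[OF s']] by (simp_all add: left_end_def)
      consider "s < i" | "i \<le> s" "s + 2 \<le> len tr" | "s = len tr - 1"
        using s' by linarith
      then show ?thesis
      proof cases
        \<comment> \<open>Before \<open>i\<close> the letter \<open>s\<close> leaves the same side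
          at which \<open>\<alpha>\<close> arrives, so the two come from one polygon and form a
          relation.\<close>
        case 1
        then have "pth s = ?arr s # map ?arr [Suc s..<i]"
          by (simp add: pth_def upt_conv_Cons)
        moreover have "(\<alpha>, ?arr s) \<in> polygon_relations"
        proof -
          have "(P, pre P x) = (poly tr s, entry tr s)"
            using P x by simp
          then have "(P, pre P x) \<in> corners X" "?arr s = \<theta> (P, pre P x)"
            using corner_left(1,3)[OF s'(1) 1] by metis+
          then show ?thesis
            using polygon_relationsI[OF Px(1)] Px(2) by metis
        qed
        ultimately show ?thesis
          by blast
      next
        \<comment> \<open>From \<open>i\<close> on, the right turn of segment \<open>s\<close> ends
          at its entry side, and a side has only one successor. So \<open>\<alpha>\<close> is letter
          \<open>s\<close>.\<close>
        case 2
        then have "x = exit_side tr s"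
          using prev_side_inj[of x "sides X P" "exit_side tr s"] corner_right(2)[OF 2] P x
            arc_side_less[OF arc(1)] arc_side_less[OF exit_arc[of s]] by simp
        then have "\<theta> (crossing_corner tr s) = \<alpha>"
          using corner_right(3)[OF 2] Px P by simp
        then show ?thesis
          using 2 right[OF 2] s' by (intro disjI1 bexI[of _ s]) auto
      next
        case 3
        then show ?thesis
          using no_corner_right[OF Px(1)] entry by simp
      qed
    next
      case exit
      have P: "P = poly tr (s - 1)" and x: "pre P x = exit_side tr (s - 1)"
        using side_inj[OF arc(2) exit_arc[of "s - 1"] exit] s' by simp_all
      consider "s = 1" | "2 \<le> s" "s \<le> i" | "i < s"
        using s' by linarith
      then show ?thesis
      proof cases
        case 1
        then show ?thesis
          using no_corner_left[OF Px(1)] exit by simp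
      next
        \<comment> \<open>The left turn of segment \<open>s - 1\<close> ends at its exit side, so
          \<open>\<alpha>\<close> is letter \<open>s - 1\<close>.\<close>
        case s2: 2
        then have l: "1 \<le> s - 1" "s - 1 < i"
          by simp_all
        then have "x = entry tr (s - 1)"
          using prev_side_inj[of x "sides X P" "entry tr (s - 1)"] corner_left(2)[OF l] P x
            arc_side_less[OF arc(1)] arc_side_less[OF entry_arc[of "s - 1"]] i by simp
        then have "\<theta> (crossing_corner tr (s - 1)) = \<alpha>"
          using corner_left(3)[OF l] Px P by simp
        then show ?thesis
          using l left[OF l] s' s2 by (intro disjI1 bexI[of _ "s - 1"]) auto
      next
        \<comment> \<open>After \<open>i\<close> the path of \<open>s\<close> begins with letter
          \<open>s - 1\<close>, which leaves the side at which \<open>\<alpha>\<close> arrives; this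
          again is a relation.\<close>
        case 3
        then have r: "i \<le> s - 1" "s - 1 + 2 \<le> len tr"
          using s' by simp_all
        have "[i..<s] = [i..<s - 1] @ [s - 1]"
          using 3 by (metis Suc_diff_1 le_add_diff_inverse less_Suc_eq_le not_less_zero upt_Suc_append gr0I)
        then have "pth s = ?arr (s - 1) # map ?arr (rev [i..<s - 1])"
          using 3 by (simp add: pth_def)
        moreover have "(\<alpha>, ?arr (s - 1)) \<in> polygon_relations"
        proof -
          have "(P, pre P x) = (poly tr (s - 1), exit_side tr (s - 1))"
            using P x by simp
          then have "(P, pre P x) \<in> corners X" "?arr (s - 1) = \<theta> (P, pre P x)"
            using corner_right(1,3)[OF r] by metis+
          then show ?thesis
            using polygon_relationsI[OF Px(1)] Px(2) by metis
        qed
        ultimately show ?thesis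
          by blast
      qed
    qed
  qed
  then show ?thesis
    using i(3) by blast
qed

end

text \<open>The envelope constructed is the direct sum itself, so the identity is the isomorphism
  asked for.\<close>

lemma module_iso_refl: "module_iso R M M"
  unfolding module_iso_def by (rule bexI[of _ "\<lambda>x. x"]) (auto simp: module_maps_def bij_betw_def)

theorem theorem4p9:
  fixes Q :: "('v, 'e) quiver"
    and I :: "(('v, 'e) qpath \<Rightarrow> 'k::alg_closed_field) set"
    and X :: "('p, 'v, 'g) ribbon_surface"
    and \<theta> :: "'g \<times> nat \<Rightarrow> 'e"
    and scl :: "'k \<Rightarrow> 'w \<Rightarrow> 'w::ab_group_add"
  assumes "gentle Q I"
    and "marked_ribbon_surface X"
    and "algebra_of_surface X Q I \<theta>"
  shows
    "(\<forall>c tr cinj trinj.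
        permissible_curve X c tr \<and> 2 \<le> len tr \<and>
        (\<forall>i \<in> string_indices tr.
           injective_permissible_curve X (crossed X tr i) (cinj i) (trinj i)) \<longrightarrow>
        (\<exists>(E :: (_, nat \<Rightarrow> nat \<Rightarrow> 'k) module) \<iota>.
           injective_envelope TYPE('x) TYPE('y) (path_algebra Q Quot I)
             (string_module X \<theta> tr) E \<iota> \<and>
           module_iso (path_algebra Q Quot I) E
             (direct_sum (string_indices tr) (\<lambda>i. string_module X \<theta> (trinj i)))))
     \<and>
     (\<forall>c tr \<phi> l cinj trinj.
        permissible_closed_curve X c tr \<and> 2 \<le> len tr \<and> l \<in> {1..len tr} \<and>
        indecomposable_automorphism scl \<phi> \<and>
        (\<forall>i \<in> band_indices tr.
           injective_permissible_curve X (crossed X tr i) (cinj i) (trinj i)) \<longrightarrow>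
        (\<exists>(E :: (_, nat \<Rightarrow> nat \<Rightarrow> nat \<Rightarrow> 'k) module) \<iota>.
           injective_envelope TYPE('x) TYPE('y) (path_algebra Q Quot I)
             (band_module scl X \<theta> tr l \<phi>) E \<iota> \<and>
           module_iso (path_algebra Q Quot I) E
             (direct_sum (band_indices tr) (\<lambda>i.
                direct_sum {..<vector_space.dim scl (UNIV :: 'w set)}
                  (\<lambda>_. string_module X \<theta> (trinj i))))))"
proof (intro conjI allI impI; elim conjE)
  interpret surface_algebra Q I X \<theta>
    using assms by unfold_locales
  fix c :: "real \<Rightarrow> 'p" and tr :: "'g trace" and cinj trinj
  assume c: "permissible_curve X c tr"
    and inj: "\<forall>i \<in> string_indices tr. injective_permissible_curve X (crossed X tr i) (cinj i) (trinj i)"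
  let ?W = "string_walk X \<theta> tr :: ('v, 'e, 'k) walk"
  have sinks: "bound_walk.sinks ?W = string_indices tr"
    by (rule sinks_string[OF c])
  have "\<forall>i \<in> string_indices tr. \<exists>d pth. injective_walk Q I polygon_relations
      (string_walk X \<theta> (trinj i) :: ('v, 'e, 'k) walk) d pth \<and> crossed X (trinj i) d = crossed X tr i"
    using inj injective_walk_string by blast
  \<comment> \<open>\<open>d i\<close> is the number of the crossing of the injective curve with the
    arc at position \<open>i\<close> of the given string; it is counted along the injective
    curve.\<close>
  then obtain d pth where d: "\<And>i. i \<in> string_indices tr \<Longrightarrow> injective_walk Q I polygon_relations
      (string_walk X \<theta> (trinj i) :: ('v, 'e, 'k) walk) (d i) (pth i)"
    "\<And>i. i \<in> string_indices tr \<Longrightarrow> crossed X (trinj i) (d i) = crossed X tr i"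
    by metis
  have "\<exists>\<iota>. injective_envelope TYPE('x) TYPE('y) R (walk_module (*) ?W)
      (direct_sum (bound_walk.sinks ?W) (\<lambda>i. walk_module (*) (string_walk X \<theta> (trinj i)))) \<iota>"
    by (rule injective_envelope_string[OF bound_walk_string[OF c], of _ d pth]) (use d sinks in auto)
  then show "\<exists>(E :: (_, nat \<Rightarrow> nat \<Rightarrow> 'k) module) \<iota>.
      injective_envelope TYPE('x) TYPE('y) R (string_module X \<theta> tr) E \<iota> \<and>
      module_iso R E (direct_sum (string_indices tr) (\<lambda>i. string_module X \<theta> (trinj i)))"
    unfolding string_module_def sinks using module_iso_refl by blast
next
  interpret surface_algebra Q I X \<theta>
    using assms by unfold_locales
  fix c :: "real \<Rightarrow> 'p" and tr :: "'g trace" and \<phi> l cinj trinj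
  assume c: "permissible_closed_curve X c tr" and \<phi>: "indecomposable_automorphism scl \<phi>"
    and inj: "\<forall>i \<in> band_indices tr. injective_permissible_curve X (crossed X tr i) (cinj i) (trinj i)"
  obtain B where fd: "finite_dimensional_vector_space scl B"
    and \<phi>': "Vector_Spaces.linear scl scl \<phi>" "bij \<phi>"
    using \<phi> by (auto simp: indecomposable_automorphism_def)
  let ?W = "band_walk X \<theta> tr l \<phi>"
  have W: "bound_walk Q I polygon_relations scl B ?W"
    by (rule bound_walk_band[OF c fd \<phi>'])
  have sinks: "bound_walk.sinks ?W = band_indices tr"
    by (rule sinks_band[OF W])
  have "\<forall>i \<in> band_indices tr. \<exists>d pth. injective_walk Q I polygon_relations
      (string_walk X \<theta> (trinj i) :: ('v, 'e, 'k) walk) d pth \<and> crossed X (trinj i) d = crossed X tr i"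
    using inj injective_walk_string by blast
  then obtain d pth where d: "\<And>i. i \<in> band_indices tr \<Longrightarrow> injective_walk Q I polygon_relations
      (string_walk X \<theta> (trinj i) :: ('v, 'e, 'k) walk) (d i) (pth i)"
    "\<And>i. i \<in> band_indices tr \<Longrightarrow> crossed X (trinj i) (d i) = crossed X tr i"
    by metis
  have "\<exists>\<iota>. injective_envelope TYPE('x) TYPE('y) R (walk_module scl ?W)
      (direct_sum (bound_walk.sinks ?W) (\<lambda>i. direct_sum {..<vector_space.dim scl (UNIV :: 'w set)}
        (\<lambda>_. walk_module (*) (string_walk X \<theta> (trinj i))))) \<iota>"
    by (rule bound_walk.injective_envelope_band[OF W, of _ d pth]) (use d sinks in auto)
  then show "\<exists>(E :: (_, nat \<Rightarrow> nat \<Rightarrow> nat \<Rightarrow> 'k) module) \<iota>.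
      injective_envelope TYPE('x) TYPE('y) R (band_module scl X \<theta> tr l \<phi>) E \<iota> \<and>
      module_iso R E (direct_sum (band_indices tr) (\<lambda>i.
        direct_sum {..<vector_space.dim scl (UNIV :: 'w set)} (\<lambda>_. string_module X \<theta> (trinj i))))"
    unfolding string_module_def band_module_def sinks using module_iso_refl by blast
qed

end
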